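(* For every fixed $\delta>0$ and every integer $t$ that is sufficiently large with respect to $\delta$, there is a graph $G$ with $\chi(G)\geq (\frac32-\delta)t$ which does not have $K_t$ as an odd minor. In particular, for every sufficiently large integer $t$, there is a graph $G$ with $\chi(G)\geq t$ which does not have $K_t$ as an odd minor.
   Context: All graphs are finite and simple; $\chi(G)$ denotes the chromatic number. A graph $G$ has $K_t$ as an odd minor if there exist vertex-disjoint trees $T_1,\dots,T_t\subseteq G$ and functions $\chi_i:V(T_i)\to\{\text{black},\text{white}\}$ such that (i) for every $i$, $\chi_i$ is a proper $2$-coloring of $T_i$ (i.e. $\chi_i(x)\neq\chi_i(y)$ for every edge $\{x,y\}\in E(T_i)$), and (ii) for all $i\neq j$ there are vertices $x_i\in V(T_i)$, $x_j\in V(T_j)$ with $\{x_i,x_j\}\in E(G)$ and $\chi_i(x_i)=\chi_j(x_j)$. *)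

theory Defs
  imports Complex_Main
begin

definition simple_graph :: "'a set \<Rightarrow> 'a set set \<Rightarrow> bool" where
  "simple_graph V E \<longleftrightarrow> finite V \<and> (\<forall>e\<in>E. \<exists>x y. x \<in> V \<and> y \<in> V \<and> x \<noteq> y \<and> e = {x, y})"

definition proper_colouring :: "'a set \<Rightarrow> 'a set set \<Rightarrow> nat \<Rightarrow> ('a \<Rightarrow> nat) \<Rightarrow> bool" where
  "proper_colouring V E k f \<longleftrightarrow> (\<forall>v\<in>V. f v < k) \<and> (\<forall>x y. {x, y} \<in> E \<longrightarrow> f x \<noteq> f y)"

definition chromatic_number :: "'a set \<Rightarrow> 'a set set \<Rightarrow> nat" where
  "chromatic_number V E = (LEAST k. \<exists>f. proper_colouring V E k f)"

definition connected_sub :: "'a set \<Rightarrow> 'a set set \<Rightarrow> bool" where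
  "connected_sub T F \<longleftrightarrow> T \<noteq> {} \<and>
     (\<forall>x\<in>T. \<forall>y\<in>T. (\<lambda>u v. {u, v} \<in> F)\<^sup>*\<^sup>* x y)"

definition is_tree :: "'a set \<Rightarrow> 'a set set \<Rightarrow> bool" where
  "is_tree T F \<longleftrightarrow> simple_graph T F \<and> connected_sub T F \<and> card F + 1 = card T"

definition has_odd_clique_minor :: "'a set \<Rightarrow> 'a set set \<Rightarrow> nat \<Rightarrow> bool" where
  "has_odd_clique_minor V E t \<longleftrightarrow>
     (\<exists>(Ts :: nat \<Rightarrow> 'a set) (Fs :: nat \<Rightarrow> 'a set set) (c :: nat \<Rightarrow> 'a \<Rightarrow> bool).
        (\<forall>i<t. Ts i \<subseteq> V \<and> Fs i \<subseteq> E \<and> is_tree (Ts i) (Fs i)) \<and>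
        (\<forall>i<t. \<forall>j<t. i \<noteq> j \<longrightarrow> Ts i \<inter> Ts j = {}) \<and>
        (\<forall>i<t. \<forall>x y. {x, y} \<in> Fs i \<longrightarrow> c i x \<noteq> c i y) \<and>
        (\<forall>i<t. \<forall>j<t. i \<noteq> j \<longrightarrow>
           (\<exists>x\<in>Ts i. \<exists>y\<in>Ts j. {x, y} \<in> E \<and> c i x = c j y)))"

end

theory Submission
  imports Defs "HOL-Library.FuncSet" "HOL-Analysis.Convex" "HOL-Real_Asymp.Real_Asymp"
begin

text \<open>The graph is the complement of a triangle-free graph \<open>H\<close> on roughly \<open>(3 - O(\<epsilon>)) t\<close> vertices
  with the following property for some \<open>m\<close> of order \<open>\<epsilon> n\<close>: any \<open>2m\<close> distinct vertices \<open>x\<^sub>i\<close>, \<open>y\<^sub>i\<close> admit \<open>i \<noteq> j\<close>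
  such that both \<open>x\<^sub>i x\<^sub>j\<close> and \<open>y\<^sub>i y\<^sub>j\<close> are edges of \<open>H\<close>. Colour classes of the complement are cliques of \<open>H\<close>,
  hence have at most two elements. In an odd clique minor, fewer than \<open>2m\<close> trees are single vertices and fewer
  than \<open>m\<close> are single edges: taking \<open>x\<^sub>i\<close> black and \<open>y\<^sub>i\<close> white, the property exhibits two trees that no
  monochromatic edge joins. All remaining trees have at least three vertices, so \<open>t \<le> n/3 + 3m\<close>.

  To build \<open>H\<close>, assign independent random points of the cube \<open>{-1,1}\<^sup>k\<close> to the vertices, join two vertices
  with probability proportional to the kernel \<open>w(x,y) = \<Prod>\<^sub>l (1 - c x\<^sub>l y\<^sub>l)\<close> restricted to a window of negative
  inner products, and delete all edges that lie in triangles. Vertices with negatively correlated points have few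
  common neighbours, so most edges survive. Expanding \<open>w\<close> into characters, hypercontractivity and duality show
  that \<open>\<Sum>\<^sub>i\<^sub>j w(x\<^sub>i,x\<^sub>j) w(y\<^sub>i,y\<^sub>j)\<close> is at least about \<open>m\<^sup>2/2\<close> for all choices of the \<open>x\<^sub>i\<close>, \<open>y\<^sub>i\<close> at once, and a
  union bound over these choices finishes the argument.\<close>

subsection \<open>Finite product measures\<close>

text \<open>Independent edges of a constant density p cannot give H. The union bound runs over about
  n^(2m) choices of the two families, and the expected number of index pairs kept on both sides is
  of order p^2 m^2 with m of order n, so p^2 n must exceed ln n by a large factor. But p^2 n is also
  the typical number of common neighbours of an adjacent pair, and most edges survive the deletion
  of triangles only if that number is small. The kernel resolves this conflict. It has mean 1, yet
  two points with inner product at most - c k / 2 have average common weight at most exp (- c^3 k /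
  2). The price is that weights depend on positions, and the families may be chosen after seeing
  these. The lower bound must therefore hold for all choices at once; it is derived from a few
  deterministic properties of the sample instead of from concentration for each choice. In the end
  c^3 k = r with ln n of order r^4, and p^2 n = r^12 is harmless against exp (- r / 2). The ratio
  3/2 is the quotient of about n/2 colours and about n/3 trees.\<close>

definition pE :: "'i set \<Rightarrow> 'b set \<Rightarrow> ('i \<Rightarrow> 'b \<Rightarrow> real) \<Rightarrow> (('i \<Rightarrow> 'b) \<Rightarrow> real) \<Rightarrow> real" where
  "pE A B \<mu> f = (\<Sum>z\<in>PiE A (\<lambda>_. B). (\<Prod>i\<in>A. \<mu> i (z i)) * f z)"

text \<open>Independent coordinates indexed by \<open>A\<close>, each with its own density on a
  common finite alphabet \<open>B\<close>. Two instances are used: uniform points of the cube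
  (\<open>B = Pow K\<close>) and independent edge indicators of varying bias (\<open>B\<close> the
  booleans).\<close>

locale prod_prob =
  fixes A :: "'i set" and B :: "'b set" and \<mu> :: "'i \<Rightarrow> 'b \<Rightarrow> real"
  assumes finA: "finite A" and finB: "finite B"
    and mu_nonneg: "\<And>i b. i \<in> A \<Longrightarrow> b \<in> B \<Longrightarrow> 0 \<le> \<mu> i b"
    and mu_sum: "\<And>i. i \<in> A \<Longrightarrow> (\<Sum>b\<in>B. \<mu> i b) = 1"
begin

abbreviation \<Omega> where "\<Omega> \<equiv> PiE A (\<lambda>_. B)"
abbreviation E where "E \<equiv> pE A B \<mu>"

lemma weight_nonneg: "z \<in> \<Omega> \<Longrightarrow> 0 \<le> (\<Prod>i\<in>A. \<mu> i (z i))"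
  by (intro prod_nonneg mu_nonneg ballI) (auto simp: PiE_def Pi_def)

lemma E_prod: "E (\<lambda>z. \<Prod>i\<in>A. h i (z i)) = (\<Prod>i\<in>A. \<Sum>b\<in>B. \<mu> i b * h i b)"
proof -
  have "(\<Prod>i\<in>A. \<Sum>b\<in>B. \<mu> i b * h i b) = (\<Sum>z\<in>\<Omega>. \<Prod>i\<in>A. \<mu> i (z i) * h i (z i))"
    by (rule prod_sum_PiE) (use finA finB in auto)
  then show ?thesis by (simp add: pE_def prod.distrib)
qed

lemma E_const: "E (\<lambda>_. c) = c"
proof -
  have "E (\<lambda>z. \<Prod>i\<in>A. 1) = 1"
    using E_prod[of "\<lambda>_ _. 1"] by (simp add: mu_sum)
  then show ?thesis by (simp add: pE_def flip: sum_distrib_right)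
qed

lemma E_cmult: "E (\<lambda>z. c * f z) = c * E f"
  by (simp add: pE_def sum_distrib_left mult_ac)

lemma E_add: "E (\<lambda>z. f z + g z) = E f + E g"
  by (simp add: pE_def sum.distrib distrib_left)

lemma E_sum: "E (\<lambda>z. \<Sum>x\<in>X. f x z) = (\<Sum>x\<in>X. E (f x))"
  unfolding pE_def by (simp add: sum_distrib_left) (rule sum.swap)

lemma E_mono: "(\<And>z. z \<in> \<Omega> \<Longrightarrow> f z \<le> g z) \<Longrightarrow> E f \<le> E g"
  unfolding pE_def by (intro sum_mono mult_left_mono weight_nonneg)

lemma E_cong: "(\<And>z. z \<in> \<Omega> \<Longrightarrow> f z = g z) \<Longrightarrow> E f = E g"
  unfolding pE_def by (intro sum.cong) auto

lemma E_less_exists: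
  assumes "E f < c" shows "\<exists>z\<in>\<Omega>. f z < c"
proof (rule ccontr)
  assume "\<not> ?thesis"
  then have "E (\<lambda>_. c) \<le> E f" by (intro E_mono) auto
  then show False using assms E_const by simp
qed

text \<open>One-coordinate Fubini. The discarded value of coordinate \<open>i\<close> integrates to
  1 by \<open>mu_sum\<close>, so the outer expectation still ranges over all of \<open>A\<close> and
  repeated resampling needs no change of index set.\<close>

lemma E_resample:
  assumes i: "i \<in> A"
  shows "E f = E (\<lambda>z. \<Sum>b\<in>B. \<mu> i b * f (z(i := b)))"
proof -
  let ?A = "A - {i}"
  have A: "A = insert i ?A" using i by auto
  have ni: "i \<notin> ?A" and fA: "finite ?A" using finA by auto
  let ?P = "PiE ?A (\<lambda>_. B)"
  have *: "E g = (\<Sum>b\<in>B. \<Sum>z\<in>?P. \<mu> i b * (\<Prod>j\<in>?A. \<mu> j (z j)) * g (z(i:=b)))" for g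
  proof -
    have 1: "PiE A (\<lambda>_. B) = (\<lambda>(y, g). g(i := y)) ` (B \<times> ?P)"
      by (subst A, subst PiE_insert_eq) auto
    have 2: "(\<Prod>j\<in>A. \<mu> j ((z(i:=b)) j)) = \<mu> i b * (\<Prod>j\<in>?A. \<mu> j (z j))" for z b
      by (subst A, subst prod.insert) (use fA in \<open>auto intro!: prod.cong\<close>)
    have inj: "inj_on (\<lambda>(y, g). g(i := y)) (B \<times> ?P)"
      by (rule inj_combinator[OF ni])
    have "E g = (\<Sum>(b,z)\<in>B \<times> ?P. \<mu> i b * (\<Prod>j\<in>?A. \<mu> j (z j)) * g (z(i:=b)))"
      unfolding pE_def 1 by (subst sum.reindex[OF inj]) (auto simp: case_prod_unfold 2[unfolded fun_upd_def] fun_upd_def intro!: sum.cong)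
    then show ?thesis by (simp add: sum.cartesian_product)
  qed
  have "E (\<lambda>z. \<Sum>b\<in>B. \<mu> i b * f (z(i := b)))
      = (\<Sum>b\<in>B. \<mu> i b * (\<Sum>z\<in>?P. (\<Prod>j\<in>?A. \<mu> j (z j)) * (\<Sum>b'\<in>B. \<mu> i b' * f (z(i := b')))))"
    by (subst *) (simp add: sum_distrib_left mult_ac)
  also have "\<dots> = (\<Sum>z\<in>?P. (\<Prod>j\<in>?A. \<mu> j (z j)) * (\<Sum>b'\<in>B. \<mu> i b' * f (z(i := b'))))"
    by (simp add: mu_sum[OF i] flip: sum_distrib_right)
  also have "\<dots> = (\<Sum>z\<in>?P. \<Sum>b\<in>B. \<mu> i b * (\<Prod>j\<in>?A. \<mu> j (z j)) * f (z(i:=b)))"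
    by (simp add: sum_distrib_left mult_ac)
  also have "\<dots> = E f"
    by (subst *) (rule sum.swap)
  finally show ?thesis by simp
qed

text \<open>Conditioning on all coordinates but \<open>i\<close>: there \<open>\<Phi>\<close> is a
  constant, and only the conditional mean of \<open>h\<close> has to be bounded. Inductions over
  products peel off one factor at a time in this way.\<close>

lemma E_pull_le:
  assumes i: "i \<in> A" and "\<And>z b. z \<in> \<Omega> \<Longrightarrow> b \<in> B \<Longrightarrow> \<Phi> (z(i := b)) = \<Phi> z"
    and "\<And>z. z \<in> \<Omega> \<Longrightarrow> 0 \<le> \<Phi> z"
    and "\<And>z. z \<in> \<Omega> \<Longrightarrow> (\<Sum>b\<in>B. \<mu> i b * h (z(i := b))) \<le> \<beta>"
  shows "E (\<lambda>z. \<Phi> z * h z) \<le> \<beta> * E \<Phi>"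
proof -
  have "E (\<lambda>z. \<Phi> z * h z) = E (\<lambda>z. \<Sum>b\<in>B. \<mu> i b * (\<Phi> (z(i := b)) * h (z(i := b))))"
    by (rule E_resample[OF i])
  also have "\<dots> = E (\<lambda>z. \<Phi> z * (\<Sum>b\<in>B. \<mu> i b * h (z(i := b))))"
    by (intro E_cong) (simp add: assms(2) sum_distrib_left mult_ac)
  also have "\<dots> \<le> E (\<lambda>z. \<beta> * \<Phi> z)"
    by (intro E_mono) (metis assms(3,4) mult.commute mult_left_mono)
  finally show ?thesis by (simp add: E_cmult)
qed

lemma E_single:
  assumes "i \<in> A" shows "E (\<lambda>z. f (z i)) = (\<Sum>b\<in>B. \<mu> i b * f b)"
  by (subst E_resample[OF assms]) (simp add: E_const)

lemma E_pair:
  assumes "i \<in> A" "j \<in> A" "i \<noteq> j"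
  shows "E (\<lambda>z. f (z i) (z j)) = (\<Sum>a\<in>B. \<Sum>b\<in>B. \<mu> i a * \<mu> j b * f a b)"
proof -
  have "E (\<lambda>z. f (z i) (z j)) = E (\<lambda>z. \<Sum>b\<in>B. \<mu> j b * f (z i) b)"
    by (subst E_resample[OF assms(2)]) (use assms(3) in simp)
  also have "\<dots> = (\<Sum>a\<in>B. \<mu> i a * (\<Sum>b\<in>B. \<mu> j b * f a b))"
    by (rule E_single[OF assms(1)])
  finally show ?thesis by (simp add: sum_distrib_left mult_ac)
qed

text \<open>The coordinates \<open>v j\<close> are pairwise distinct and differ from every
  \<open>u j'\<close>, so each can be integrated out with everything else fixed. The bound
  \<open>bd\<close> is uniform in the value at \<open>u j\<close>, which is why the
  \<open>u j\<close> may coincide.\<close>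

lemma E_prod_pairs_le:
  assumes finJ: "finite J" and uA: "\<And>j. j \<in> J \<Longrightarrow> u j \<in> A" and vA: "\<And>j. j \<in> J \<Longrightarrow> v j \<in> A"
    and injv: "inj_on v J" and uv: "\<And>j j'. j \<in> J \<Longrightarrow> j' \<in> J \<Longrightarrow> u j \<noteq> v j'"
    and h: "\<And>j a b. 0 \<le> h j a b" and \<beta>: "\<And>j. j \<in> J \<Longrightarrow> 0 \<le> \<beta> j"
    and bd: "\<And>j a. j \<in> J \<Longrightarrow> a \<in> B \<Longrightarrow> (\<Sum>b\<in>B. \<mu> (v j) b * h j a b) \<le> \<beta> j"
  shows "E (\<lambda>z. \<Prod>j\<in>J. h j (z (u j)) (z (v j))) \<le> (\<Prod>j\<in>J. \<beta> j)"
  using assms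
proof (induction J rule: finite_induct)
  case empty
  then show ?case by (simp add: E_const)
next
  case (insert j J)
  let ?\<Phi> = "\<lambda>z. \<Prod>j\<in>J. h j (z (u j)) (z (v j))"
  have IH: "E ?\<Phi> \<le> (\<Prod>j\<in>J. \<beta> j)"
    using insert.prems by (intro insert.IH) auto
  have "E (\<lambda>z. \<Prod>j\<in>insert j J. h j (z (u j)) (z (v j))) = E (\<lambda>z. ?\<Phi> z * h j (z (u j)) (z (v j)))"
    using insert.hyps by (simp add: mult.commute)
  also have "\<dots> \<le> \<beta> j * E ?\<Phi>"
  proof (rule E_pull_le[where i = "v j"])
    show "v j \<in> A" using insert.prems by auto
    fix z assume z: "z \<in> \<Omega>"
    show "0 \<le> ?\<Phi> z" using insert.prems by (intro prod_nonneg) auto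
    have "u j \<noteq> v j" using insert.prems by auto
    moreover have "z (u j) \<in> B" using z insert.prems by auto
    ultimately show "(\<Sum>b\<in>B. \<mu> (v j) b * h j ((z(v j := b)) (u j)) ((z(v j := b)) (v j))) \<le> \<beta> j"
      using insert.prems by simp
    fix b assume "b \<in> B"
    show "?\<Phi> (z(v j := b)) = ?\<Phi> z"
    proof (intro prod.cong refl)
      fix l assume l: "l \<in> J"
      have "u l \<noteq> v j" using insert.prems l by auto
      moreover have "v l \<noteq> v j" using insert.prems(3) insert.hyps l by (auto simp: inj_on_def)
      ultimately show "h l ((z(v j := b)) (u l)) ((z(v j := b)) (v l)) = h l (z (u l)) (z (v l))" by simp
    qed
  qed
  also have "\<dots> \<le> \<beta> j * (\<Prod>j\<in>J. \<beta> j)"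
    using insert.prems IH by (intro mult_left_mono) auto
  finally show ?case using insert.hyps by simp
qed

end

subsection \<open>The noise kernel on the cube\<close>

text \<open>A point of the cube is encoded as the set of its coordinates that are \<open>-1\<close>.\<close>

definition sg :: "'a set \<Rightarrow> 'a \<Rightarrow> real" where
  "sg x l = (if l \<in> x then -1 else 1)"

definition chi :: "'a set \<Rightarrow> 'a set \<Rightarrow> real" where
  "chi x S = (\<Prod>l\<in>S. sg x l)"

definition avg :: "'a set \<Rightarrow> ('a set \<Rightarrow> real) \<Rightarrow> real" where
  "avg K f = (\<Sum>x\<in>Pow K. f x) / 2 ^ card K"

text \<open>For c in [0, 1] this is the density, with respect to the uniform measure in
  \<open>y\<close>, of a noisy copy of \<open>x\<close> with correlation \<open>-c\<close> in each
  coordinate; it favours points opposite to \<open>x\<close>.\<close>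

definition wk :: "'a set \<Rightarrow> real \<Rightarrow> 'a set \<Rightarrow> 'a set \<Rightarrow> real" where
  "wk K c x y = (\<Prod>l\<in>K. 1 - c * (sg x l * sg y l))"

lemma sg_sq [simp]: "sg x l * sg x l = 1" "(sg x l)\<^sup>2 = 1"
  by (auto simp: sg_def)

lemma abs_sg [simp]: "\<bar>sg x l\<bar> = 1"
  by (simp add: sg_def)

lemma abs_chi [simp]: "\<bar>chi x S\<bar> = 1"
  by (simp add: chi_def abs_prod)

lemma chi_sq [simp]: "chi x S * chi x S = 1"
  by (metis abs_chi abs_mult_self_eq mult_1)

lemma chi_empty [simp]: "chi x {} = 1"
  by (simp add: chi_def)

lemma chi_mult_chi:
  assumes "finite S" "finite T"
  shows "chi x S * chi x T = chi x ((S - T) \<union> (T - S))"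
proof -
  have S: "chi x S = chi x (S - T) * chi x (S \<inter> T)"
    unfolding chi_def using assms by (subst prod.union_disjoint[symmetric]) (auto simp: Un_Diff_Int intro!: prod.cong)
  have T: "chi x T = chi x (T - S) * chi x (S \<inter> T)"
    unfolding chi_def using assms by (subst prod.union_disjoint[symmetric]) (auto intro!: prod.cong)
  have "chi x ((S - T) \<union> (T - S)) = chi x (S - T) * chi x (T - S)"
    unfolding chi_def using assms by (subst prod.union_disjoint) auto
  then show ?thesis unfolding S T
    by (metis (no_types, lifting) chi_sq mult.assoc mult.commute mult.right_neutral)
qed

lemma avg_prod:
  assumes "finite K"
  shows "avg K (\<lambda>x. \<Prod>l\<in>K. h l (sg x l)) = (\<Prod>l\<in>K. (h l (-1) + h l 1) / 2)"
proof -
  have "(\<Prod>l\<in>K. h l (-1) + h l 1) = (\<Sum>x\<in>Pow K. (\<Prod>l\<in>x. h l (-1)) * (\<Prod>l\<in>K - x. h l 1))"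
    by (rule prod_add[OF assms])
  also have "\<dots> = (\<Sum>x\<in>Pow K. \<Prod>l\<in>K. h l (sg x l))"
  proof (intro sum.cong refl)
    fix x assume x: "x \<in> Pow K"
    have "(\<Prod>l\<in>K. h l (sg x l)) = (\<Prod>l\<in>x. h l (sg x l)) * (\<Prod>l\<in>K - x. h l (sg x l))"
      using x assms by (metis Pow_iff mult.commute prod.subset_diff)
    then show "(\<Prod>l\<in>x. h l (-1)) * (\<Prod>l\<in>K - x. h l 1) = (\<Prod>l\<in>K. h l (sg x l))"
      by (simp add: sg_def)
  qed
  finally show ?thesis by (simp add: avg_def prod_dividef)
qed

lemma avg_sum: "avg K (\<lambda>x. \<Sum>i\<in>I. f i x) = (\<Sum>i\<in>I. avg K (f i))"
  unfolding avg_def by (subst sum.swap) (simp add: sum_divide_distrib)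

lemma avg_cmult: "avg K (\<lambda>x. a * f x) = a * avg K f"
  unfolding avg_def by (simp add: sum_distrib_left)

lemma avg_mono: "(\<And>x. x \<subseteq> K \<Longrightarrow> f x \<le> g x) \<Longrightarrow> avg K f \<le> avg K g"
  unfolding avg_def by (intro divide_right_mono sum_mono) auto

lemma avg_const [simp]: "finite K \<Longrightarrow> avg K (\<lambda>_. a) = a"
  unfolding avg_def by (simp add: card_Pow)

lemma avg_chi:
  assumes "finite K" "S \<subseteq> K"
  shows "avg K (\<lambda>x. chi x S) = (if S = {} then 1 else 0)"
proof -
  have "chi x S = (\<Prod>l\<in>K. if l \<in> S then sg x l else 1)" for x
    unfolding chi_def using assms by (simp add: prod.inter_restrict[symmetric] Int_absorb1)
  then have "avg K (\<lambda>x. chi x S) = (\<Prod>l\<in>K. ((if l \<in> S then -1 else 1) + (if l \<in> S then 1 else 1)) / 2)"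
    using avg_prod[OF assms(1), of "\<lambda>l s. if l \<in> S then s else 1"] by simp
  also have "\<dots> = (if S = {} then 1 else 0)"
    using assms by (cases "S = {}") (auto intro!: prod_zero)
  finally show ?thesis .
qed

lemma avg_chi_chi:
  assumes "finite K" "S \<subseteq> K" "T \<subseteq> K"
  shows "avg K (\<lambda>x. chi x S * chi x T) = (if S = T then 1 else 0)"
proof -
  have "finite S" "finite T" using assms finite_subset by auto
  then have "avg K (\<lambda>x. chi x S * chi x T) = avg K (\<lambda>x. chi x ((S - T) \<union> (T - S)))"
    by (simp add: chi_mult_chi)
  also have "\<dots> = (if S = T then 1 else 0)"
    by (subst avg_chi) (use assms in auto)
  finally show ?thesis .
qed

lemma avg_parseval:
  assumes "finite K" "F \<subseteq> Pow K"
  shows "avg K (\<lambda>x. (\<Sum>S\<in>F. \<gamma> S * chi x S)\<^sup>2) = (\<Sum>S\<in>F. (\<gamma> S)\<^sup>2)"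
proof -
  have fF: "finite F" using assms finite_subset by blast
  have "(\<Sum>S\<in>F. \<gamma> S * chi x S)\<^sup>2 = (\<Sum>S\<in>F. \<Sum>T\<in>F. \<gamma> S * \<gamma> T * (chi x S * chi x T))" for x
    by (simp add: power2_eq_square sum_product mult_ac)
  then have "avg K (\<lambda>x. (\<Sum>S\<in>F. \<gamma> S * chi x S)\<^sup>2)
      = (\<Sum>S\<in>F. \<Sum>T\<in>F. \<gamma> S * \<gamma> T * avg K (\<lambda>x. chi x S * chi x T))"
    by (simp add: avg_sum avg_cmult)
  also have "\<dots> = (\<Sum>S\<in>F. \<Sum>T\<in>F. if S = T then \<gamma> S * \<gamma> T else 0)"
    using assms by (intro sum.cong refl) (subst avg_chi_chi, auto)
  also have "\<dots> = (\<Sum>S\<in>F. (\<gamma> S)\<^sup>2)"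
    using fF by (simp add: power2_eq_square)
  finally show ?thesis .
qed

lemma wk_expand:
  assumes "finite K"
  shows "wk K c x y = (\<Sum>S\<in>Pow K. (-c) ^ card S * (chi x S * chi y S))"
proof -
  have "wk K c x y = (\<Prod>l\<in>K. (-c) * (sg x l * sg y l) + 1)"
    by (simp add: wk_def)
  also have "\<dots> = (\<Sum>S\<in>Pow K. (\<Prod>l\<in>S. (-c) * (sg x l * sg y l)) * (\<Prod>l\<in>K - S. 1))"
    by (rule prod_add[OF assms])
  also have "\<dots> = (\<Sum>S\<in>Pow K. (-c) ^ card S * (chi x S * chi y S))"
    by (simp only: prod.distrib prod_constant chi_def power_one mult_1_right)
  finally show ?thesis .
qed

lemma wk_commute: "wk K c x y = wk K c y x"
  by (simp add: wk_def mult.commute)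

lemma wk_nonneg: "0 \<le> c \<Longrightarrow> c \<le> 1 \<Longrightarrow> 0 \<le> wk K c x y"
  unfolding wk_def by (intro prod_nonneg) (auto simp: sg_def)

text \<open>Two noise steps of correlation \<open>-c\<close> compose to one of correlation c^2.
  Points with negative inner product thus share less kernel mass than the average value 1, which is
  the source of the small codegrees.\<close>

lemma avg_wk_wk:
  assumes "finite K"
  shows "avg K (\<lambda>z. wk K c x z * wk K c y z) = (\<Prod>l\<in>K. 1 + c\<^sup>2 * (sg x l * sg y l))"
proof -
  have "avg K (\<lambda>z. wk K c x z * wk K c y z)
     = avg K (\<lambda>z. \<Prod>l\<in>K. (1 - c * (sg x l * sg z l)) * (1 - c * (sg y l * sg z l)))"
    by (simp add: wk_def prod.distrib)
  also have "\<dots> = (\<Prod>l\<in>K. ((1 - c * (sg x l * (-1))) * (1 - c * (sg y l * (-1)))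
       + (1 - c * (sg x l * 1)) * (1 - c * (sg y l * 1))) / 2)"
    using assms by (rule avg_prod)
  also have "\<dots> = (\<Prod>l\<in>K. 1 + c\<^sup>2 * (sg x l * sg y l))"
    by (intro prod.cong refl) (simp add: field_simps power2_eq_square)
  finally show ?thesis .
qed

subsection \<open>Hypercontractivity\<close>

lemma Suc_times_binomial_Suc: "Suc k * (n choose Suc k) = (n - k) * (n choose k)"
proof (cases n)
  case 0 then show ?thesis by simp
next
  case (Suc m)
  then show ?thesis using binomial_absorption[of k n] binomial_absorb_comp[of n k] by simp
qed

text \<open>Ratios of consecutive terms: from j to j + 1 the left side grows by (q - j)(2q - 2j - 1)
  / ((j + 1)(2j + 1)) and the binomial on the right by (q - j) / (j + 1). The remaining quotient (2q
  - 2j - 1) / (2j + 1) is at most 2q - 1.\<close>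

lemma choose_double_le:
  assumes "j \<le> q"
  shows "real ((2 * q) choose (2 * j)) \<le> real (q choose j) * (2 * real q - 1) ^ j"
  using assms
proof (induction j)
  case 0 then show ?case by simp
next
  case (Suc j)
  let ?a = "real ((2*q) choose (2*j))" and ?b = "real ((2*q) choose (2*j+2))"
  let ?p = "real (q choose j)" and ?r = "real (q choose (Suc j))"
  have jq: "j < q" using Suc.prems by simp
  have e1: "real (2*j+1) * real ((2*q) choose (2*j+1)) = real (2*q - 2*j) * ?a"
    using Suc_times_binomial_Suc[of "2*j" "2*q"] by (metis Suc_eq_plus1 of_nat_mult)
  have e2: "real (2*j+2) * ?b = real (2*q - (2*j+1)) * real ((2*q) choose (2*j+1))"
    using Suc_times_binomial_Suc[of "2*j+1" "2*q"] by (metis Suc_eq_plus1 add_Suc_right of_nat_mult one_add_one plus_1_eq_Suc)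
  have e3: "real (Suc j) * ?r = real (q - j) * ?p"
    using Suc_times_binomial_Suc[of j q] by (metis of_nat_mult)
  have c1: "real (2*q - 2*j) = 2 * (real q - real j)" and c2: "real (2*q - (2*j+1)) = 2 * real q - 2 * real j - 1"
    and c3: "real (q - j) = real q - real j"
    using jq by (auto simp: of_nat_diff)
  have "real (2*j+1) * (real (Suc j) * ?b) = (2 * real q - 2 * real j - 1) * ((real q - real j) * ?a)"
  proof -
    have "real (2*j+1) * (real (2*j+2) * ?b) = (2 * real q - 2 * real j - 1) * (real (2*j+1) * real ((2*q) choose (2*j+1)))"
      unfolding e2 c2 by simp
    also have "\<dots> = (2 * real q - 2 * real j - 1) * (2 * (real q - real j) * ?a)"
      unfolding e1 c1 by simp
    finally show ?thesis by (simp add: algebra_simps)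
  qed
  also have "\<dots> \<le> (2 * real q - 1) * ((real q - real j) * (?p * (2 * real q - 1) ^ j))"
    using jq Suc.IH by (intro mult_mono mult_left_mono mult_nonneg_nonneg) auto
  also have "\<dots> = real (Suc j) * ?r * (2 * real q - 1) ^ Suc j"
    unfolding e3 c3 by (simp add: algebra_simps)
  also have "\<dots> \<le> real (2*j+1) * (real (Suc j) * (?r * (2 * real q - 1) ^ Suc j))"
  proof -
    have "0 \<le> real (Suc j) * (?r * (2 * real q - 1) ^ Suc j)" using jq by simp
    then have "1 * (real (Suc j) * (?r * (2 * real q - 1) ^ Suc j)) \<le> real (2*j+1) * (real (Suc j) * (?r * (2 * real q - 1) ^ Suc j))"
      by (intro mult_right_mono) auto
    then show ?thesis by (simp only: mult_ac mult_1)
  qed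
  finally have "?b \<le> ?r * (2 * real q - 1) ^ Suc j"
    by (simp only: mult_le_cancel_left_pos of_nat_0_less_iff zero_less_Suc add_gr_0 zero_less_one simp_thms)
  then show ?case by (simp add: numeral_2_eq_2)
qed

lemma sum_even_atMost: "(\<Sum>k\<le>2*(q::nat). if even k then f k else (0::real)) = (\<Sum>j\<le>q. f (2 * j))"
  by (induction q) auto

text \<open>The one-dimensional case of hypercontractivity, where 2q - 1 is the constant p - 1 for p
  = 2q. Odd powers of \<open>v\<close> cancel, and \<open>choose_double_le\<close> compares the even
  ones term by term.\<close>

lemma two_point_power:
  fixes u v :: real
  assumes "1 \<le> q"
  shows "(u + v) ^ (2*q) + (u - v) ^ (2*q) \<le> 2 * (u\<^sup>2 + (2 * real q - 1) * v\<^sup>2) ^ q"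
proof -
  have "(u + v) ^ (2*q) + (u - v) ^ (2*q) = (v + u) ^ (2*q) + (-v + u) ^ (2*q)"
    by (simp add: add.commute)
  also have "\<dots> = (\<Sum>k\<le>2*q. of_nat ((2*q) choose k) * v ^ k * u ^ (2*q - k))
      + (\<Sum>k\<le>2*q. of_nat ((2*q) choose k) * (-v) ^ k * u ^ (2*q - k))"
    by (simp only: binomial_ring)
  also have "\<dots> = (\<Sum>k\<le>2*q. if even k then 2 * (of_nat ((2*q) choose k) * v ^ k * u ^ (2*q - k)) else 0)"
    unfolding sum.distrib[symmetric] by (intro sum.cong refl) auto
  also have "\<dots> = 2 * (\<Sum>j\<le>q. of_nat ((2*q) choose (2*j)) * v ^ (2*j) * u ^ (2*q - 2*j))"
    unfolding sum_even_atMost by (simp add: sum_distrib_left)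
  also have "\<dots> \<le> 2 * (\<Sum>j\<le>q. of_nat (q choose j) * ((2 * real q - 1) * v\<^sup>2) ^ j * (u\<^sup>2) ^ (q - j))"
  proof (intro mult_left_mono sum_mono)
    fix j assume "j \<in> {..q}"
    then have j: "j \<le> q" by simp
    have "real ((2*q) choose (2*j)) * (v ^ (2*j) * u ^ (2*q - 2*j))
       \<le> real (q choose j) * (2 * real q - 1) ^ j * (v ^ (2*j) * u ^ (2*q - 2*j))"
      using j by (intro mult_right_mono choose_double_le) (auto simp: zero_le_even_power)
    moreover have "u ^ (2*q - 2*j) = (u\<^sup>2) ^ (q - j)" by (simp flip: power_mult add: diff_mult_distrib2)
    moreover have "v ^ (2*j) = (v\<^sup>2) ^ j" by (simp add: power_mult)
    ultimately show "of_nat ((2*q) choose (2*j)) * v ^ (2*j) * u ^ (2*q - 2*j)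
      \<le> of_nat (q choose j) * ((2 * real q - 1) * v\<^sup>2) ^ j * (u\<^sup>2) ^ (q - j)"
      by (simp add: power_mult_distrib mult_ac)
  qed simp
  also have "\<dots> = 2 * ((2 * real q - 1) * v\<^sup>2 + u\<^sup>2) ^ q"
    by (simp only: binomial_ring)
  finally show ?thesis by (simp add: add.commute)
qed

text \<open>Jensen for \<open>x ^ q\<close> with weights \<open>A / (A + B)\<close> and
  \<open>B / (A + B)\<close>. Averaged over the cube it yields the triangle inequality for the
  q-norm of two nonnegative functions of norms at most \<open>A\<close> and
  \<open>B\<close>.\<close>

lemma power_convex_combination:
  fixes a b A B :: real
  assumes "0 \<le> a" "0 \<le> b" "0 < A" "0 < B"
  shows "(a + b) ^ q \<le> (A + B) ^ q * (A / (A + B) * (a / A) ^ q + B / (A + B) * (b / B) ^ q)"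
proof -
  let ?t = "B / (A + B)"
  have t: "1 - ?t = A / (A + B)" using assms by (simp add: field_simps)
  have cv: "convex_on {0::real..} (\<lambda>x. x ^ q)"
    by (cases "even q") (auto intro: convex_power_odd convex_on_subset[OF convex_power_even])
  have "((1 - ?t) *\<^sub>R (a / A) + ?t *\<^sub>R (b / B)) ^ q \<le> (1 - ?t) * (a / A) ^ q + ?t * (b / B) ^ q"
    by (rule convex_onD[OF cv]) (use assms in auto)
  moreover have "(1 - ?t) *\<^sub>R (a / A) + ?t *\<^sub>R (b / B) = (a + b) / (A + B)"
    unfolding t using assms by (simp add: add_divide_distrib)
  ultimately have "((a + b) / (A + B)) ^ q \<le> A / (A + B) * (a / A) ^ q + B / (A + B) * (b / B) ^ q"
    using t by simp
  then have "(A + B) ^ q * ((a + b) / (A + B)) ^ q \<le> (A + B) ^ q * (A / (A + B) * (a / A) ^ q + B / (A + B) * (b / B) ^ q)"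
    using assms by (intro mult_left_mono) auto
  then show ?thesis using assms by (simp add: power_divide)
qed

lemma sum_Pow_insert:
  assumes "a \<notin> K" "finite K"
  shows "(\<Sum>x\<in>Pow (insert a K). f x) = (\<Sum>x\<in>Pow K. f x + f (insert a x))"
proof -
  have "inj_on (insert a) (Pow K)" using assms(1) by (auto simp: inj_on_def)
  moreover have "Pow K \<inter> insert a ` Pow K = {}" using assms(1) by auto
  ultimately show ?thesis
    using assms by (simp add: Pow_insert sum.union_disjoint sum.reindex sum.distrib)
qed

text \<open>Bonami's inequality by induction on the dimension. Splitting off coordinate
  \<open>a\<close> writes the smoothed polynomial as \<open>g \<beta> x\<close> plus or minus
  \<open>\<rho> * g \<beta>1 x\<close>. The two-point inequality handles that coordinate, and the
  triangle inequality in the q-norm combines the squares of the two parts.\<close>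

theorem hypercontractive:
  assumes "finite K" "1 \<le> q" "\<rho>\<^sup>2 * (2 * real q - 1) \<le> 1"
  shows "avg K (\<lambda>x. (\<Sum>T\<in>Pow K. \<rho> ^ card T * \<beta> T * chi x T) ^ (2*q)) \<le> (\<Sum>T\<in>Pow K. (\<beta> T)\<^sup>2) ^ q"
  using assms(1)
proof (induction K arbitrary: \<beta> rule: finite_induct)
  case empty
  then show ?case by (simp add: avg_def power_mult)
next
  case (insert a K)
  define g where "g \<beta> x = (\<Sum>T\<in>Pow K. \<rho> ^ card T * \<beta> T * chi x T)" for \<beta> x
  define \<beta>1 where "\<beta>1 T = \<beta> (insert a T)" for T
  define N where "N \<beta> = (\<Sum>T\<in>Pow K. (\<beta> T)\<^sup>2)" for \<beta> :: "'a set \<Rightarrow> real"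
  have IH: "(\<Sum>x\<in>Pow K. g \<beta> x ^ (2*q)) \<le> 2 ^ card K * N \<beta> ^ q" for \<beta>
    using insert.IH[of \<beta>] by (simp add: avg_def g_def N_def field_simps)
  have Nn: "0 \<le> N \<beta>" for \<beta> by (simp add: N_def sum_nonneg)
  have N0: "g \<beta> x = 0" if "N \<beta> = 0" for \<beta> x
  proof -
    have "\<forall>T\<in>Pow K. (\<beta> T)\<^sup>2 = 0"
      using that insert.hyps by (subst sum_nonneg_eq_0_iff[symmetric]) (auto simp: N_def)
    then show ?thesis by (simp add: g_def)
  qed
  have G: "(\<Sum>T\<in>Pow (insert a K). \<rho> ^ card T * \<beta> T * chi x T) = g \<beta> x + \<rho> * g \<beta>1 x"
          "(\<Sum>T\<in>Pow (insert a K). \<rho> ^ card T * \<beta> T * chi (insert a x) T) = g \<beta> x - \<rho> * g \<beta>1 x"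
    if "x \<in> Pow K" for x
  proof -
    have ch: "chi (insert a x) T = chi x T" "chi x (insert a T) = chi x T"
             "chi (insert a x) (insert a T) = - chi x T" "card (insert a T) = Suc (card T)" if "T \<in> Pow K" for T
    proof -
      have T: "a \<notin> T" "finite T" using that insert.hyps finite_subset by auto
      have x: "a \<notin> x" using \<open>x \<in> Pow K\<close> insert.hyps by auto
      show 1: "chi (insert a x) T = chi x T"
        unfolding chi_def using T by (intro prod.cong) (auto simp: sg_def)
      show "chi x (insert a T) = chi x T" using T x by (simp add: chi_def sg_def)
      show "chi (insert a x) (insert a T) = - chi x T" using T 1 by (simp add: chi_def sg_def)
      show "card (insert a T) = Suc (card T)" using T by simp
    qed
    show "(\<Sum>T\<in>Pow (insert a K). \<rho> ^ card T * \<beta> T * chi x T) = g \<beta> x + \<rho> * g \<beta>1 x"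
      by (subst sum_Pow_insert[OF insert.hyps(2,1)])
        (simp add: g_def \<beta>1_def sum.distrib sum_distrib_left ch mult_ac)
    show "(\<Sum>T\<in>Pow (insert a K). \<rho> ^ card T * \<beta> T * chi (insert a x) T) = g \<beta> x - \<rho> * g \<beta>1 x"
      by (subst sum_Pow_insert[OF insert.hyps(2,1)])
        (simp add: g_def \<beta>1_def sum.distrib sum_subtractf sum_negf sum_distrib_left ch mult_ac)
  qed
  have pt: "(g \<beta> x + \<rho> * g \<beta>1 x) ^ (2*q) + (g \<beta> x - \<rho> * g \<beta>1 x) ^ (2*q) \<le> 2 * ((g \<beta> x)\<^sup>2 + (g \<beta>1 x)\<^sup>2) ^ q" for x
  proof -
    have "(2 * real q - 1) * (\<rho> * g \<beta>1 x)\<^sup>2 = (\<rho>\<^sup>2 * (2 * real q - 1)) * (g \<beta>1 x)\<^sup>2"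
      by (simp add: power_mult_distrib)
    also have "\<dots> \<le> 1 * (g \<beta>1 x)\<^sup>2" using assms(3) by (intro mult_right_mono) auto
    finally have "((g \<beta> x)\<^sup>2 + (2 * real q - 1) * (\<rho> * g \<beta>1 x)\<^sup>2) ^ q \<le> ((g \<beta> x)\<^sup>2 + (g \<beta>1 x)\<^sup>2) ^ q"
      using assms(2) by (intro power_mono) (auto intro!: add_nonneg_nonneg mult_nonneg_nonneg)
    then show ?thesis using two_point_power[OF assms(2), of "g \<beta> x" "\<rho> * g \<beta>1 x"] by linarith
  qed
  have mink: "(\<Sum>x\<in>Pow K. ((g \<beta> x)\<^sup>2 + (g \<beta>1 x)\<^sup>2) ^ q) \<le> 2 ^ card K * (N \<beta> + N \<beta>1) ^ q"
  \<comment> \<open>The convexity bound divides by both norms; a part of norm 0 vanishes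
    identically.\<close>
  proof (cases "N \<beta> = 0 \<or> N \<beta>1 = 0")
    case True
    then show ?thesis
    proof
      assume "N \<beta> = 0" then show ?thesis using IH[of \<beta>1] N0[of \<beta>] by (simp add: power_mult)
    next
      assume "N \<beta>1 = 0" then show ?thesis using IH[of \<beta>] N0[of \<beta>1] by (simp add: power_mult)
    qed
  next
    case False
    let ?A = "N \<beta>" and ?B = "N \<beta>1"
    have pos: "0 < ?A" "0 < ?B" using False Nn[of \<beta>] Nn[of \<beta>1] by auto
    have "(\<Sum>x\<in>Pow K. ((g \<beta> x)\<^sup>2 + (g \<beta>1 x)\<^sup>2) ^ q)
      \<le> (\<Sum>x\<in>Pow K. (?A + ?B) ^ q * (?A / (?A + ?B) * ((g \<beta> x)\<^sup>2 / ?A) ^ q + ?B / (?A + ?B) * ((g \<beta>1 x)\<^sup>2 / ?B) ^ q))"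
      using pos by (intro sum_mono power_convex_combination) auto
    also have "\<dots> = (?A + ?B) ^ q * (?A / (?A + ?B) * ((\<Sum>x\<in>Pow K. g \<beta> x ^ (2*q)) / ?A ^ q)
        + ?B / (?A + ?B) * ((\<Sum>x\<in>Pow K. g \<beta>1 x ^ (2*q)) / ?B ^ q))"
      by (simp add: power_mult power_divide sum.distrib flip: sum_distrib_left sum_divide_distrib)
    also have "\<dots> \<le> (?A + ?B) ^ q * (?A / (?A + ?B) * 2 ^ card K + ?B / (?A + ?B) * 2 ^ card K)"
      using pos IH[of \<beta>] IH[of \<beta>1] by (intro mult_left_mono add_mono) (auto simp: pos_divide_le_eq)
    also have "\<dots> = (?A + ?B) ^ q * ((?A / (?A + ?B) + ?B / (?A + ?B)) * 2 ^ card K)"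
      by (simp only: distrib_right)
    also have "?A / (?A + ?B) + ?B / (?A + ?B) = 1"
      using pos by (simp flip: add_divide_distrib)
    also have "(?A + ?B) ^ q * (1 * 2 ^ card K) = 2 ^ card K * (?A + ?B) ^ q" by simp
    finally show ?thesis .
  qed
  have "(\<Sum>x\<in>Pow (insert a K). (\<Sum>T\<in>Pow (insert a K). \<rho> ^ card T * \<beta> T * chi x T) ^ (2*q))
     = (\<Sum>x\<in>Pow K. (g \<beta> x + \<rho> * g \<beta>1 x) ^ (2*q) + (g \<beta> x - \<rho> * g \<beta>1 x) ^ (2*q))"
    by (subst sum_Pow_insert[OF insert.hyps(2,1)]) (simp only: G cong: sum.cong)
  also have "\<dots> \<le> (\<Sum>x\<in>Pow K. 2 * ((g \<beta> x)\<^sup>2 + (g \<beta>1 x)\<^sup>2) ^ q)"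
    by (intro sum_mono pt)
  also have "\<dots> \<le> 2 * (2 ^ card K * (N \<beta> + N \<beta>1) ^ q)"
    using mink by (simp flip: sum_distrib_left)
  also have "N \<beta> + N \<beta>1 = (\<Sum>T\<in>Pow (insert a K). (\<beta> T)\<^sup>2)"
    by (subst sum_Pow_insert[OF insert.hyps(2,1)]) (simp add: N_def \<beta>1_def sum.distrib)
  finally show ?case
    using insert.hyps by (simp add: avg_def field_simps)
qed

subsection \<open>Pseudorandom samples\<close>

definition matched :: "nat \<Rightarrow> nat \<Rightarrow> (nat \<Rightarrow> nat) \<Rightarrow> (nat \<Rightarrow> nat) \<Rightarrow> bool" where
  "matched n m x y \<longleftrightarrow> inj_on x {..<m} \<and> inj_on y {..<m} \<and> x ` {..<m} \<inter> y ` {..<m} = {}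
     \<and> x ` {..<m} \<subseteq> {..<n} \<and> y ` {..<m} \<subseteq> {..<n}"

definition low :: "'a set \<Rightarrow> nat \<Rightarrow> 'a set set" where
  "low K d = {S. S \<subseteq> K \<and> card S \<le> d}"

definition wd :: "'a set \<Rightarrow> nat \<Rightarrow> real \<Rightarrow> 'a set \<Rightarrow> 'a set \<Rightarrow> real" where
  "wd K d c x y = (\<Sum>S\<in>low K d. (-c) ^ card S * (chi x S * chi y S))"

definition beta :: "'a set \<Rightarrow> nat \<Rightarrow> ('a set \<Rightarrow> 'a set \<Rightarrow> int) \<Rightarrow> 'a set \<Rightarrow> 'a set \<Rightarrow> real" where
  "beta K d b x T = (\<Sum>S\<in>low K d. real_of_int (b S T) * chi x S)"

text \<open>The bilinear form with coefficients \<open>b\<close>, smoothed by noise in the variable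
  \<open>y\<close> alone. For fixed \<open>x\<close> it is a polynomial in \<open>y\<close> with
  coefficients \<open>beta\<close>, so hypercontractivity bounds its 2q-th moment by
  \<open>nsq ^ q\<close>.\<close>

definition gpoly :: "'a set \<Rightarrow> nat \<Rightarrow> real \<Rightarrow> ('a set \<Rightarrow> 'a set \<Rightarrow> int) \<Rightarrow> 'a set \<Rightarrow> 'a set \<Rightarrow> real" where
  "gpoly K d c b x y = (\<Sum>T\<in>low K d. c ^ card T * beta K d b x T * chi y T)"

definition nsq :: "'a set \<Rightarrow> nat \<Rightarrow> ('a set \<Rightarrow> 'a set \<Rightarrow> int) \<Rightarrow> 'a set \<Rightarrow> real" where
  "nsq K d b x = (\<Sum>T\<in>low K d. (beta K d b x T)\<^sup>2)"

text \<open>The coefficients \<open>b\<close> are integers so that a union bound over all of them is possible.\<close>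

definition bad :: "'a set \<Rightarrow> nat \<Rightarrow> real \<Rightarrow> ('a set \<Rightarrow> 'a set \<Rightarrow> int) \<Rightarrow> 'a set \<Rightarrow> 'a set \<Rightarrow> bool" where
  "bad K d c b x y \<longleftrightarrow> 9 * nsq K d b x < (gpoly K d c b x y)\<^sup>2"

lemma finite_low: "finite K \<Longrightarrow> finite (low K d)"
  by (rule finite_subset[of _ "Pow K"]) (auto simp: low_def)

lemma empty_in_low [simp]: "{} \<in> low K d"
  by (simp add: low_def)

lemma nsq_nonneg: "0 \<le> nsq K d b x"
  by (simp add: nsq_def sum_nonneg)

text \<open>What is retained of the random points: low-degree characters are nearly orthogonal along
  the sample, and no integer array bounded by \<open>n\<close> has \<open>r0\<close> disjoint bad
  pairs. Being uniform over arrays and index choices, both apply to families chosen after the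
  sample.\<close>

locale cube_sample =
  fixes K :: "'a set" and d :: nat and c :: real and n r0 :: nat and z :: "nat \<Rightarrow> 'a set"
  assumes finK: "finite K" and c0: "0 < c" and c1: "c \<le> 1/20" and n1: "1 \<le> n"
    and gram: "\<And>S T. S \<in> low K d \<Longrightarrow> T \<in> low K d \<Longrightarrow> S \<noteq> T \<Longrightarrow>
        \<bar>\<Sum>v<n. chi (z v) S * chi (z v) T\<bar> \<le> real n / real (card (low K d))"
    and few_bad: "\<And>b x y J. (\<And>S T. \<bar>b S T\<bar> \<le> int n) \<Longrightarrow> inj_on x J \<Longrightarrow> inj_on y J \<Longrightarrow> x ` J \<inter> y ` J = {} \<Longrightarrow>
        x ` J \<subseteq> {..<n} \<Longrightarrow> y ` J \<subseteq> {..<n} \<Longrightarrow> finite (J::nat set) \<Longrightarrow>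
        (\<And>j. j \<in> J \<Longrightarrow> bad K d c b (z (x j)) (z (y j))) \<Longrightarrow> card J < r0"
begin

abbreviation SS where "SS \<equiv> low K d"
abbreviation D where "D \<equiv> real (card SS)"

lemma finSS: "finite SS" by (rule finite_low[OF finK])

lemma D_ge1: "1 \<le> D"
proof -
  have "card SS \<noteq> 0" using finSS empty_in_low[of K d] by (metis card_0_eq empty_iff)
  then show ?thesis by simp
qed

text \<open>The diagonal contributes exactly n times the squared norm. The threshold in
  \<open>gram\<close> is such that, after Cauchy-Schwarz over the \<open>D\<close> indices, the
  off-diagonal part contributes at most the same amount again.\<close>

lemma almost_bessel: "(\<Sum>v<n. (\<Sum>S\<in>SS. a S * chi (z v) S)\<^sup>2) \<le> 2 * real n * (\<Sum>S\<in>SS. (a S)\<^sup>2)"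
proof -
  let ?G = "\<lambda>S T. \<Sum>v<n. chi (z v) S * chi (z v) T"
  have "(\<Sum>v<n. (\<Sum>S\<in>SS. a S * chi (z v) S)\<^sup>2) = (\<Sum>v<n. \<Sum>S\<in>SS. \<Sum>T\<in>SS. a S * a T * (chi (z v) S * chi (z v) T))"
    unfolding power2_eq_square sum_product by (intro sum.cong refl) (simp only: mult_ac)
  also have "\<dots> = (\<Sum>S\<in>SS. \<Sum>v<n. \<Sum>T\<in>SS. a S * a T * (chi (z v) S * chi (z v) T))"
    by (rule sum.swap)
  also have "\<dots> = (\<Sum>S\<in>SS. \<Sum>T\<in>SS. a S * a T * ?G S T)"
    unfolding sum_distrib_left by (intro sum.cong refl sum.swap)
  also have "\<dots> \<le> (\<Sum>S\<in>SS. \<Sum>T\<in>SS. (if S = T then real n * (a S)\<^sup>2 else 0) + real n / D * (\<bar>a S\<bar> * \<bar>a T\<bar>))"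
  proof (intro sum_mono)
    fix S T assume ST: "S \<in> SS" "T \<in> SS"
    show "a S * a T * ?G S T \<le> (if S = T then real n * (a S)\<^sup>2 else 0) + real n / D * (\<bar>a S\<bar> * \<bar>a T\<bar>)"
    proof (cases "S = T")
      case True
      then show ?thesis by (simp add: power2_eq_square)
    next
      case False
      have "a S * a T * ?G S T \<le> \<bar>a S * a T * ?G S T\<bar>" by simp
      also have "\<dots> = \<bar>a S\<bar> * \<bar>a T\<bar> * \<bar>?G S T\<bar>" by (simp add: abs_mult)
      also have "\<dots> \<le> \<bar>a S\<bar> * \<bar>a T\<bar> * (real n / D)"
        using gram[OF ST False] by (intro mult_left_mono) auto
      finally show ?thesis using False by (simp add: mult_ac)
    qed
  qed
  also have "\<dots> = real n * (\<Sum>S\<in>SS. (a S)\<^sup>2) + real n / D * (\<Sum>S\<in>SS. \<bar>a S\<bar>)\<^sup>2"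
  proof -
    have "(\<Sum>S\<in>SS. \<Sum>T\<in>SS. if S = T then real n * (a S)\<^sup>2 else 0) = real n * (\<Sum>S\<in>SS. (a S)\<^sup>2)"
      using finSS by (simp add: sum_distrib_left)
    moreover have "(\<Sum>S\<in>SS. \<Sum>T\<in>SS. real n / D * (\<bar>a S\<bar> * \<bar>a T\<bar>)) = real n / D * (\<Sum>S\<in>SS. \<bar>a S\<bar>)\<^sup>2"
      unfolding power2_eq_square sum_product by (simp add: sum_distrib_left)
    ultimately show ?thesis by (simp only: sum.distrib)
  qed
  also have "(\<Sum>S\<in>SS. \<bar>a S\<bar>)\<^sup>2 \<le> (\<Sum>S\<in>SS. (\<bar>a S\<bar>)\<^sup>2) * D"
    by (rule sum_squared_le_sum_of_squares)
  finally show ?thesis using D_ge1 n1 by (simp add: divide_simps mult_ac)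
qed

end

locale matched_sample = cube_sample +
  fixes m :: nat and x y :: "nat \<Rightarrow> nat"
  assumes mat: "matched n m x y"
begin

text \<open>Unnormalised empirical Fourier coefficient of the matched pairs of points. The lower
  bound on the kernel sum rests on these not being large in weighted square mean.\<close>

definition F where "F S T = (\<Sum>i<m. chi (z (x i)) S * chi (z (y i)) T)"

lemma m_le_n: "m \<le> n"
  using mat card_inj_on_le[of x "{..<m}" "{..<n}"] by (auto simp: matched_def)

lemma abs_F_le: "\<bar>F S T\<bar> \<le> real m"
proof -
  have "\<bar>F S T\<bar> \<le> (\<Sum>i<m. \<bar>chi (z (x i)) S * chi (z (y i)) T\<bar>)" unfolding F_def by (rule sum_abs)
  then show ?thesis by (simp add: abs_mult)
qed

text \<open>Duality: the left-hand side is \<open>\<theta>\<^sup>2\<close>, where \<open>\<theta>\<close> pairs the array with its own normalisation \<open>a\<close>. Rounding \<open>a\<close>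
  to multiples of \<open>1/n\<close> turns \<open>\<theta>\<close> into a sum of values of \<open>gpoly\<close> at the matched pairs, only few of which are bad.\<close>

lemma weighted_F_bound:
  assumes sz: "(real r0 + 1) * D\<^sup>2 \<le> sqrt (real m * real n)" and Dn: "D \<le> real n"
  shows "(\<Sum>S\<in>SS. \<Sum>T\<in>SS. (c ^ card T * F S T)\<^sup>2) \<le> 100 * real m * real n"
proof -
  let ?f = "\<lambda>S T. c ^ card T * F S T"
  define Q where "Q = (\<Sum>S\<in>SS. \<Sum>T\<in>SS. (?f S T)\<^sup>2)"
  define \<theta> where "\<theta> = sqrt Q"
  have Q0: "0 \<le> Q" unfolding Q_def by (intro sum_nonneg) auto
  have cpow: "0 \<le> c ^ k" "c ^ k \<le> 1" for k using c0 c1 by (auto intro!: power_le_one)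
  show ?thesis
  proof (cases "Q = 0")
    case True
    then show ?thesis unfolding Q_def by simp
  next
    case False
    then have th: "0 < \<theta>" using Q0 by (simp add: \<theta>_def)
    have thsq: "\<theta>\<^sup>2 = Q" using Q0 by (simp add: \<theta>_def)
    define a where "a S T = (if S \<in> SS \<and> T \<in> SS then ?f S T / \<theta> else 0)" for S T
    have suma: "(\<Sum>S\<in>SS. \<Sum>T\<in>SS. (a S T)\<^sup>2) = 1"
    proof -
      have "(\<Sum>S\<in>SS. \<Sum>T\<in>SS. (a S T)\<^sup>2) = (\<Sum>S\<in>SS. \<Sum>T\<in>SS. (?f S T)\<^sup>2 / Q)"
        by (intro sum.cong refl) (simp add: a_def power_divide thsq)
      also have "\<dots> = Q / Q"
        unfolding Q_def by (simp only: sum_divide_distrib)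
      finally show ?thesis using False by simp
    qed
    have a1: "\<bar>a S T\<bar> \<le> 1" for S T
    proof (cases "S \<in> SS \<and> T \<in> SS")
      case True
      have "(a S T)\<^sup>2 \<le> (\<Sum>T\<in>SS. (a S T)\<^sup>2)"
        using True finSS by (intro member_le_sum) auto
      also have "\<dots> \<le> (\<Sum>S\<in>SS. \<Sum>T\<in>SS. (a S T)\<^sup>2)"
        using True finSS by (intro member_le_sum[of S SS "\<lambda>S. \<Sum>T\<in>SS. (a S T)\<^sup>2"]) (auto intro: sum_nonneg)
      finally show ?thesis unfolding suma by (simp add: abs_square_le_1)
    qed (auto simp: a_def)
    define b where "b S T = \<lfloor>real n * a S T\<rfloor>" for S T
    have b_le: "\<bar>b S T\<bar> \<le> int n" for S T
    proof -
      have "\<bar>real n * a S T\<bar> \<le> real n" using a1[of S T] by (simp add: abs_mult mult_left_le)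
      then have "- real n \<le> real n * a S T" "real n * a S T \<le> real n" by (auto simp: abs_le_iff)
      then have "- int n \<le> b S T" "b S T \<le> int n"
        unfolding b_def by (simp add: le_floor_iff, simp add: floor_le_iff)
      then show ?thesis by (simp add: abs_le_iff)
    qed
    have b_near: "\<bar>real n * a S T - of_int (b S T)\<bar> \<le> 1" for S T
      unfolding b_def by linarith
    \<comment> \<open>From (u - v)^2 \<le> 2 u^2 + 2 v^2 with a rounding error v of absolute value
      at most 1.\<close>
    have b_sq: "(real_of_int (b S T))\<^sup>2 \<le> 2 * (real n)\<^sup>2 * (a S T)\<^sup>2 + 2" for S T
    proof -
      have "(real_of_int (b S T))\<^sup>2 = (real n * a S T - (real n * a S T - of_int (b S T)))\<^sup>2" by simp
      also have "\<dots> \<le> 2 * (real n * a S T)\<^sup>2 + 2 * (real n * a S T - of_int (b S T))\<^sup>2"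
        using sum_squares_ge_zero[of "real n * a S T + (real n * a S T - of_int (b S T))" 0]
        by (simp add: power2_eq_square algebra_simps)
      also have "(real n * a S T - of_int (b S T))\<^sup>2 \<le> 1"
        using b_near[of S T] by (simp add: abs_square_le_1)
      finally show ?thesis by (simp add: power_mult_distrib)
    qed
    have sum_bsq: "(\<Sum>S\<in>SS. \<Sum>T\<in>SS. (real_of_int (b S T))\<^sup>2) \<le> 4 * (real n)\<^sup>2"
    proof -
      have "(\<Sum>S\<in>SS. \<Sum>T\<in>SS. (real_of_int (b S T))\<^sup>2) \<le> (\<Sum>S\<in>SS. \<Sum>T\<in>SS. 2 * (real n)\<^sup>2 * (a S T)\<^sup>2 + 2)"
        by (intro sum_mono b_sq)
      also have "\<dots> = 2 * (real n)\<^sup>2 * (\<Sum>S\<in>SS. \<Sum>T\<in>SS. (a S T)\<^sup>2) + 2 * D\<^sup>2"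
        by (simp add: sum.distrib power2_eq_square flip: sum_distrib_left)
      also have "\<dots> \<le> 4 * (real n)\<^sup>2"
        unfolding suma using Dn D_ge1 power_mono[of D "real n" 2] by simp
      finally show ?thesis .
    qed
    let ?g = "\<lambda>i. gpoly K d c b (z (x i)) (z (y i))"
    \<comment> \<open>Injectivity of \<open>x\<close> lets the sum run over the whole sample, where
      \<open>almost_bessel\<close> applies to the coefficients for each fixed \<open>T\<close>; 2n
      times 4n^2 gives the bound.\<close>
    have sum_nsq: "(\<Sum>i<m. nsq K d b (z (x i))) \<le> 8 * (real n) ^ 3"
    proof -
      have "(\<Sum>i<m. nsq K d b (z (x i))) = (\<Sum>v\<in>x ` {..<m}. nsq K d b (z v))"
        using mat by (simp add: matched_def sum.reindex)
      also have "\<dots> \<le> (\<Sum>v<n. nsq K d b (z v))"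
        using mat by (intro sum_mono2) (auto simp: matched_def nsq_nonneg)
      also have "\<dots> = (\<Sum>T\<in>SS. \<Sum>v<n. (beta K d b (z v) T)\<^sup>2)"
        unfolding nsq_def by (rule sum.swap)
      also have "\<dots> \<le> (\<Sum>T\<in>SS. 2 * real n * (\<Sum>S\<in>SS. (real_of_int (b S T))\<^sup>2))"
        unfolding beta_def by (intro sum_mono almost_bessel)
      also have "\<dots> = 2 * real n * (\<Sum>T\<in>SS. \<Sum>S\<in>SS. (real_of_int (b S T))\<^sup>2)"
        by (simp only: sum_distrib_left)
      also have "(\<Sum>T\<in>SS. \<Sum>S\<in>SS. (real_of_int (b S T))\<^sup>2) = (\<Sum>S\<in>SS. \<Sum>T\<in>SS. (real_of_int (b S T))\<^sup>2)"
        by (rule sum.swap)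
      also have "2 * real n * (\<Sum>S\<in>SS. \<Sum>T\<in>SS. (real_of_int (b S T))\<^sup>2) \<le> 2 * real n * (4 * (real n)\<^sup>2)"
        using sum_bsq by (intro mult_left_mono) auto
      finally show ?thesis by (simp add: power3_eq_cube power2_eq_square)
    qed
    \<comment> \<open>A trivial bound, spent only on the fewer than \<open>r0\<close> bad
      indices.\<close>
    have gbd: "\<bar>?g i\<bar> \<le> D\<^sup>2 * real n" for i
    proof -
      have bb: "\<bar>beta K d b (z (x i)) T\<bar> \<le> D * real n" for T
      proof -
        have "\<bar>beta K d b (z (x i)) T\<bar> \<le> (\<Sum>S\<in>SS. \<bar>real_of_int (b S T) * chi (z (x i)) S\<bar>)"
          unfolding beta_def by (rule sum_abs)
        also have "\<dots> \<le> (\<Sum>S\<in>SS. real n)"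
        proof (intro sum_mono)
          fix S
          have "\<bar>real_of_int (b S T)\<bar> \<le> real n" using b_le[of S T] by linarith
          then show "\<bar>real_of_int (b S T) * chi (z (x i)) S\<bar> \<le> real n" by (simp add: abs_mult)
        qed
        finally show ?thesis by simp
      qed
      have "\<bar>?g i\<bar> \<le> (\<Sum>T\<in>SS. \<bar>c ^ card T * beta K d b (z (x i)) T * chi (z (y i)) T\<bar>)"
        unfolding gpoly_def by (rule sum_abs)
      also have "\<dots> \<le> (\<Sum>T\<in>SS. 1 * (D * real n))"
      proof (intro sum_mono)
        fix T
        have "c ^ card T * \<bar>beta K d b (z (x i)) T\<bar> \<le> 1 * (D * real n)"
          using bb[of T] cpow[of "card T"] by (intro mult_mono) auto
        then show "\<bar>c ^ card T * beta K d b (z (x i)) T * chi (z (y i)) T\<bar> \<le> 1 * (D * real n)"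
          using cpow[of "card T"] by (simp add: abs_mult)
      qed
      finally show ?thesis by (simp add: power2_eq_square)
    qed
    define J where "J = {i. i < m \<and> bad K d c b (z (x i)) (z (y i))}"
    have J: "J \<subseteq> {..<m}" "finite J" by (auto simp: J_def)
    have cardJ: "card J < r0"
    proof (rule few_bad)
      show "inj_on x J" "inj_on y J" using mat J inj_on_subset by (auto simp: matched_def)
      have xJ: "x ` J \<subseteq> x ` {..<m}" and yJ: "y ` J \<subseteq> y ` {..<m}"
        by (rule image_mono[OF J(1)])+
      have mm: "x ` {..<m} \<inter> y ` {..<m} = {}" "x ` {..<m} \<subseteq> {..<n}" "y ` {..<m} \<subseteq> {..<n}"
        using mat by (simp_all only: matched_def)
      show "x ` J \<subseteq> {..<n}" by (rule order_trans[OF xJ mm(2)])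
      show "y ` J \<subseteq> {..<n}" by (rule order_trans[OF yJ mm(3)])
      show "x ` J \<inter> y ` J = {}" using Int_mono[OF xJ yJ] by (simp only: mm(1) subset_empty)
    qed (use b_le J in \<open>auto simp: J_def\<close>)
    have split: "(\<Sum>i<m. ?g i) = (\<Sum>i\<in>{..<m} - J. ?g i) + (\<Sum>i\<in>J. ?g i)"
      by (rule sum.subset_diff[OF J(1)]) simp
    have "(\<Sum>i\<in>J. ?g i) \<le> real (card J) * (D\<^sup>2 * real n)"
      using gbd by (intro sum_bounded_above) (rule abs_le_D1)
    also have "\<dots> \<le> real r0 * (D\<^sup>2 * real n)"
      using cardJ by (intro mult_right_mono) auto
    finally have badpart: "(\<Sum>i\<in>J. ?g i) \<le> real r0 * (D\<^sup>2 * real n)" .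
    have "(\<Sum>i\<in>{..<m} - J. ?g i) \<le> (\<Sum>i\<in>{..<m} - J. 3 * sqrt (nsq K d b (z (x i))))"
    proof (intro sum_mono)
      fix i assume "i \<in> {..<m} - J"
      then have "(?g i)\<^sup>2 \<le> 9 * nsq K d b (z (x i))" by (auto simp: J_def bad_def)
      then have "sqrt ((?g i)\<^sup>2) \<le> sqrt (9 * nsq K d b (z (x i)))" by (rule real_sqrt_le_mono)
      then have "\<bar>?g i\<bar> \<le> 3 * sqrt (nsq K d b (z (x i)))" by (simp add: real_sqrt_mult)
      then show "?g i \<le> 3 * sqrt (nsq K d b (z (x i)))" by (rule abs_le_D1)
    qed
    also have "\<dots> \<le> (\<Sum>i<m. 3 * sqrt (nsq K d b (z (x i))))"
      using J by (intro sum_mono2) (auto simp: nsq_nonneg)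
    also have "\<dots> \<le> 9 * real n * sqrt (real m * real n)"
    proof -
      have "(\<Sum>i<m. sqrt (nsq K d b (z (x i))))\<^sup>2 \<le> (\<Sum>i<m. (sqrt (nsq K d b (z (x i))))\<^sup>2) * real (card {..<m})"
        by (rule sum_squared_le_sum_of_squares)
      also have "\<dots> = (\<Sum>i<m. nsq K d b (z (x i))) * real m" by (simp add: nsq_nonneg)
      also have "\<dots> \<le> 8 * (real n) ^ 3 * real m" using sum_nsq by (intro mult_right_mono) auto
      \<comment> \<open>Here 8 is rounded up to 3^2. Together with the 3 that is the square root of
        the 9 in \<open>bad\<close>, this produces the factor 9 for the good indices.\<close>
      also have "\<dots> \<le> (3 * real n * sqrt (real m * real n))\<^sup>2"
      proof -
        have "(3 * real n * sqrt (real m * real n))\<^sup>2 = 9 * ((real n)\<^sup>2 * (real m * real n))"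
          by (simp add: power_mult_distrib)
        also have "\<dots> = 9 * ((real n)^3 * real m)" by (simp add: power2_eq_square power3_eq_cube)
        finally show ?thesis by simp
      qed
      finally have "(\<Sum>i<m. sqrt (nsq K d b (z (x i)))) \<le> 3 * real n * sqrt (real m * real n)"
        by (rule power2_le_imp_le) simp
      then show ?thesis by (simp flip: sum_distrib_left)
    qed
    finally have gsum: "(\<Sum>i<m. ?g i) \<le> real r0 * (D\<^sup>2 * real n) + 9 * real n * sqrt (real m * real n)"
      using split badpart by linarith
    have gsum_eq: "(\<Sum>i<m. ?g i) = (\<Sum>S\<in>SS. \<Sum>T\<in>SS. of_int (b S T) * ?f S T)"
    proof -
      have "(\<Sum>i<m. ?g i) = (\<Sum>i<m. \<Sum>T\<in>SS. \<Sum>S\<in>SS. of_int (b S T) * c ^ card T * (chi (z (x i)) S * chi (z (y i)) T))"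
        unfolding gpoly_def beta_def sum_distrib_left sum_distrib_right
        by (intro sum.cong refl) simp
      also have "\<dots> = (\<Sum>T\<in>SS. \<Sum>i<m. \<Sum>S\<in>SS. of_int (b S T) * c ^ card T * (chi (z (x i)) S * chi (z (y i)) T))"
        by (rule sum.swap)
      also have "\<dots> = (\<Sum>T\<in>SS. \<Sum>S\<in>SS. \<Sum>i<m. of_int (b S T) * c ^ card T * (chi (z (x i)) S * chi (z (y i)) T))"
        by (intro sum.cong refl sum.swap)
      also have "\<dots> = (\<Sum>S\<in>SS. \<Sum>T\<in>SS. \<Sum>i<m. of_int (b S T) * c ^ card T * (chi (z (x i)) S * chi (z (y i)) T))"
        by (rule sum.swap)
      also have "\<dots> = (\<Sum>S\<in>SS. \<Sum>T\<in>SS. of_int (b S T) * ?f S T)"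
        unfolding F_def sum_distrib_left by (intro sum.cong refl) (simp only: mult.assoc)
      finally show ?thesis .
    qed
    have "real n * \<theta> = (\<Sum>S\<in>SS. \<Sum>T\<in>SS. real n * a S T * ?f S T)"
    proof -
      have "(\<Sum>S\<in>SS. \<Sum>T\<in>SS. real n * a S T * ?f S T) = (\<Sum>S\<in>SS. \<Sum>T\<in>SS. real n / \<theta> * (?f S T)\<^sup>2)"
        by (intro sum.cong refl) (simp add: a_def power2_eq_square)
      also have "\<dots> = real n / \<theta> * Q"
        by (simp only: Q_def sum_distrib_left)
      also have "\<dots> = real n * \<theta>"
        using th by (simp flip: thsq add: power2_eq_square)
      finally show ?thesis by simp
    qed
    also have "\<dots> \<le> (\<Sum>S\<in>SS. \<Sum>T\<in>SS. of_int (b S T) * ?f S T + real m)"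
    proof (intro sum_mono)
      fix S T
      have "\<bar>?f S T\<bar> \<le> 1 * real m"
        unfolding abs_mult using cpow[of "card T"] abs_F_le[of S T] by (intro mult_mono) auto
      then have "\<bar>real n * a S T - of_int (b S T)\<bar> * \<bar>?f S T\<bar> \<le> 1 * real m"
        using b_near[of S T] by (intro mult_mono) auto
      then have "(real n * a S T - of_int (b S T)) * ?f S T \<le> real m"
        by (metis abs_ge_self abs_mult mult_1 order_trans)
      then show "real n * a S T * ?f S T \<le> of_int (b S T) * ?f S T + real m"
        by (simp add: algebra_simps)
    qed
    also have "\<dots> = (\<Sum>i<m. ?g i) + D\<^sup>2 * real m"
      by (simp add: gsum_eq sum.distrib power2_eq_square)
    \<comment> \<open>The good indices account for 9 of the 10. The bad ones and the rounding
      together cost at most (r0 + 1) D^2 n, which \<open>sz\<close> fits into the last unit.\<close>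
    also have "\<dots> \<le> real n * (10 * sqrt (real m * real n))"
    proof -
      have "D\<^sup>2 * real m \<le> D\<^sup>2 * real n" using m_le_n by (intro mult_left_mono) auto
      moreover have "real n * ((real r0 + 1) * D\<^sup>2) \<le> real n * sqrt (real m * real n)"
        using sz by (intro mult_left_mono) auto
      ultimately show ?thesis using gsum by (simp add: algebra_simps)
    qed
    finally have "\<theta> \<le> 10 * sqrt (real m * real n)" using n1 by simp
    then have "\<theta>\<^sup>2 \<le> (10 * sqrt (real m * real n))\<^sup>2" using th by (intro power_mono) auto
    then show ?thesis by (simp add: thsq Q_def power_mult_distrib)
  qed
qed

end

section \<open>Kernel sums over matched pairs: truncated, full and windowed\<close>

definition offd :: "nat \<Rightarrow> (nat \<times> nat) set" where
  "offd m = {p \<in> {..<m} \<times> {..<m}. fst p \<noteq> snd p}"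

lemma finite_offd [simp]: "finite (offd m)"
  by (simp add: offd_def)

lemma sum_offd: "(\<Sum>p\<in>offd m. h (fst p) (snd p)) = (\<Sum>i<m. \<Sum>j<m. h i j) - (\<Sum>i<m. (h i i :: real))"
proof -
  let ?D = "(\<lambda>i. (i, i)) ` {..<m}"
  have split: "{..<m} \<times> {..<m} = offd m \<union> ?D" and disj: "offd m \<inter> ?D = {}"
    by (auto simp: offd_def)
  have "(\<Sum>i<m. \<Sum>j<m. h i j) = (\<Sum>p\<in>{..<m} \<times> {..<m}. h (fst p) (snd p))"
    by (simp add: sum.cartesian_product case_prod_unfold)
  also have "\<dots> = (\<Sum>p\<in>offd m. h (fst p) (snd p)) + (\<Sum>p\<in>?D. h (fst p) (snd p))"
    unfolding split by (rule sum.union_disjoint) (use disj in auto)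
  also have "(\<Sum>p\<in>?D. h (fst p) (snd p)) = (\<Sum>i<m. h i i)"
    by (subst sum.reindex) (auto simp: inj_on_def)
  finally show ?thesis by simp
qed

lemma sum_offd_inj_le:
  fixes h :: "nat \<Rightarrow> nat \<Rightarrow> real"
  assumes "inj_on x {..<m}" "x ` {..<m} \<subseteq> {..<n}" "\<And>u v. 0 \<le> h u v"
  shows "(\<Sum>p\<in>offd m. h (x (fst p)) (x (snd p))) \<le> (\<Sum>p\<in>offd n. h (fst p) (snd p))"
proof -
  let ?f = "\<lambda>p. (x (fst p), x (snd p))"
  have inj: "inj_on ?f (offd m)"
    using assms(1) by (auto simp: inj_on_def offd_def)
  have "(\<Sum>p\<in>offd m. h (x (fst p)) (x (snd p))) = (\<Sum>p\<in>?f ` offd m. h (fst p) (snd p))"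
    by (simp add: sum.reindex[OF inj])
  also have "\<dots> \<le> (\<Sum>p\<in>offd n. h (fst p) (snd p))"
  proof (rule sum_mono2)
    show "?f ` offd m \<subseteq> offd n"
      using assms(1,2) by (auto simp: offd_def inj_on_def)
  qed (use assms(3) in auto)
  finally show ?thesis .
qed

lemma sum_mult_le_sqrt:
  fixes f g :: "'i \<Rightarrow> real"
  assumes "(\<Sum>i\<in>I. (f i)\<^sup>2) \<le> A" "(\<Sum>i\<in>I. (g i)\<^sup>2) \<le> B"
  shows "(\<Sum>i\<in>I. \<bar>f i\<bar> * \<bar>g i\<bar>) \<le> sqrt A * sqrt B"
proof -
  have "(\<Sum>i\<in>I. \<bar>f i\<bar> * \<bar>g i\<bar>)\<^sup>2 \<le> (\<Sum>i\<in>I. (\<bar>f i\<bar>)\<^sup>2) * (\<Sum>i\<in>I. (\<bar>g i\<bar>)\<^sup>2)"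
    by (rule Cauchy_Schwarz_ineq_sum)
  also have "\<dots> \<le> A * B"
    using assms by (intro mult_mono) (auto intro: sum_nonneg order_trans[OF sum_nonneg assms(1)])
  finally have "(\<Sum>i\<in>I. \<bar>f i\<bar> * \<bar>g i\<bar>) \<le> sqrt (A * B)"
    by (rule real_le_rsqrt)
  then show ?thesis by (simp add: real_sqrt_mult)
qed

definition ip :: "'a set \<Rightarrow> 'a set \<Rightarrow> 'a set \<Rightarrow> real" where
  "ip K x y = (\<Sum>l\<in>K. sg x l * sg y l)"

lemma ip_commute: "ip K x y = ip K y x"
  by (simp add: ip_def mult.commute)

text \<open>To second order the exact exponent would be - s/2 - 3/8 s^2. The constant 3/10 lies
  below 3/8, leaving room for the cubic terms and for replacing exp y by (1 + y/2)^2, and above the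
  1/4 that the window threshold will consume.\<close>

lemma one_minus_le_tilted:
  fixes s :: real
  assumes "\<bar>s\<bar> \<le> 1/20"
  shows "1 - s \<le> (1 - s/2) * exp (- s / 2 - 3/10 * s\<^sup>2)"
proof -
  let ?y = "- s / 2 - 3/10 * s\<^sup>2"
  have s2: "s\<^sup>2 \<le> 1/400" using power_mono[OF assms, of 2] by (simp add: power2_eq_square)
  have s1: "s \<le> 1/20" "-(1/20) \<le> s" using assms by (simp_all add: abs_le_iff)
  have "3/10 * s\<^sup>2 \<le> 1/40" using s2 by simp
  then have "0 \<le> 1 + ?y / 2" using s1 by argo
  then have "(1 + ?y / 2)\<^sup>2 \<le> (exp (?y / 2))\<^sup>2" by (intro power_mono exp_ge_add_one_self)
  also have "\<dots> = exp ?y" by (simp flip: exp_double)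
  finally have e: "(1 + ?y / 2)\<^sup>2 \<le> exp ?y" .
  have "1 - s \<le> (1 - s/2) * (1 + ?y / 2)\<^sup>2"
  proof -
    have "(1 - s/2) * (1 + ?y / 2)\<^sup>2 - (1 - s) = s\<^sup>2 * (1/80 + 31/160 * s - 3/200 * s\<^sup>2 - 9/800 * s * s\<^sup>2)"
      by (simp add: power2_eq_square) algebra
    moreover have "\<bar>s * s\<^sup>2\<bar> \<le> 1/20 * (1/400)"
      unfolding abs_mult using assms s2 by (intro mult_mono) auto
    then have "0 \<le> 1/80 + 31/160 * s - 3/200 * s\<^sup>2 - 9/800 * (s * s\<^sup>2)" using assms s2 by linarith
    ultimately show ?thesis
      by (smt (verit) mult.assoc zero_le_mult_iff zero_le_power2)
  qed
  also have "\<dots> \<le> (1 - s/2) * exp ?y"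
    using e assms by (intro mult_left_mono) (auto simp: abs_le_iff)
  finally show ?thesis .
qed

text \<open>Where the inner product exceeds \<open>- c k / 2\<close>, the exponential factor is at most \<open>exp (- c\<^sup>2 k / 20)\<close>; hence these
  pairs contribute little to the kernel with parameter \<open>c\<close>.\<close>

lemma wk_le_tilted:
  assumes "0 \<le> c" "c \<le> 1/20"
  shows "wk K c x y \<le> wk K (c/2) x y * exp (- c / 2 * ip K x y - 3/10 * c\<^sup>2 * real (card K))"
proof -
  have "wk K c x y \<le> (\<Prod>l\<in>K. (1 - c/2 * (sg x l * sg y l)) * exp (- c / 2 * (sg x l * sg y l) - 3/10 * c\<^sup>2))"
    unfolding wk_def
  proof (intro prod_mono conjI)
    fix l
    have s: "\<bar>c * (sg x l * sg y l)\<bar> = c" using assms by (simp add: abs_mult)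
    then show "0 \<le> 1 - c * (sg x l * sg y l)" using assms by linarith
    have "(c * (sg x l * sg y l))\<^sup>2 = c\<^sup>2" by (simp add: power_mult_distrib)
    then show "1 - c * (sg x l * sg y l) \<le> (1 - c/2 * (sg x l * sg y l)) * exp (- c / 2 * (sg x l * sg y l) - 3/10 * c\<^sup>2)"
      using one_minus_le_tilted[of "c * (sg x l * sg y l)"] s assms by simp
  qed
  also have "\<dots> = wk K (c/2) x y * exp (\<Sum>l\<in>K. - c / 2 * (sg x l * sg y l) - 3/10 * c\<^sup>2)"
    by (cases "finite K") (simp_all add: prod.distrib wk_def exp_sum)
  also have "(\<Sum>l\<in>K. - c / 2 * (sg x l * sg y l) - 3/10 * c\<^sup>2) = - c / 2 * ip K x y - 3/10 * c\<^sup>2 * real (card K)"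
    by (simp add: ip_def sum_subtractf sum_distrib_left)
  finally show ?thesis .
qed

context matched_sample
begin

lemma matched_swap: "matched n m y x"
  using mat by (auto simp: matched_def)

text \<open>Exchanging the two families transposes \<open>F\<close>, so the bound weighted by
  \<open>c ^ card T\<close> also holds with weight \<open>c ^ card S\<close>. The sum of both
  controls c to twice the smaller degree.\<close>

lemma sw: "matched_sample K d c n r0 z m y x"
  by unfold_locales (rule matched_swap)

lemma F_swap: "matched_sample.F z m y x S T = F T S"
  using matched_sample.F_def[OF sw] by (simp add: F_def mult.commute)

text \<open>Both kernels are diagonal in the characters, so the double sum over \<open>i\<close> and
  \<open>j\<close> factors into squares. Negative contributions can then come only from the signs of
  the weights.\<close>

lemma sum_wd_wd:
  "(\<Sum>i<m. \<Sum>j<m. wd K d c1 (z (x i)) (z (x j)) * wd K d c2 (z (y i)) (z (y j)))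
    = (\<Sum>S\<in>SS. \<Sum>T\<in>SS. (-c1) ^ card S * (-c2) ^ card T * (F S T)\<^sup>2)"
proof -
  let ?h = "\<lambda>i j S T. (-c1) ^ card S * (-c2) ^ card T * (chi (z (x i)) S * chi (z (y i)) T * (chi (z (x j)) S * chi (z (y j)) T))"
  have "(\<Sum>i<m. \<Sum>j<m. wd K d c1 (z (x i)) (z (x j)) * wd K d c2 (z (y i)) (z (y j)))
     = (\<Sum>i<m. \<Sum>j<m. \<Sum>S\<in>SS. \<Sum>T\<in>SS. ?h i j S T)"
    unfolding wd_def sum_product by (intro sum.cong refl) (simp only: mult_ac)
  also have "\<dots> = (\<Sum>i<m. \<Sum>S\<in>SS. \<Sum>j<m. \<Sum>T\<in>SS. ?h i j S T)"
    by (intro sum.cong refl sum.swap)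
  also have "\<dots> = (\<Sum>S\<in>SS. \<Sum>i<m. \<Sum>j<m. \<Sum>T\<in>SS. ?h i j S T)"
    by (rule sum.swap)
  also have "\<dots> = (\<Sum>S\<in>SS. \<Sum>i<m. \<Sum>T\<in>SS. \<Sum>j<m. ?h i j S T)"
    by (intro sum.cong refl sum.swap)
  also have "\<dots> = (\<Sum>S\<in>SS. \<Sum>T\<in>SS. \<Sum>i<m. \<Sum>j<m. ?h i j S T)"
    by (intro sum.cong refl sum.swap)
  also have "\<dots> = (\<Sum>S\<in>SS. \<Sum>T\<in>SS. (-c1) ^ card S * (-c2) ^ card T * (F S T)\<^sup>2)"
    by (simp only: F_def power2_eq_square sum_product) (simp only: sum_distrib_left)
  finally show ?thesis .
qed

lemma weighted_F_bound_swapped: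
  assumes sz: "(real r0 + 1) * D\<^sup>2 \<le> sqrt (real m * real n)" and Dn: "D \<le> real n"
  shows "(\<Sum>S\<in>SS. \<Sum>T\<in>SS. (c ^ (2 * card T) + c ^ (2 * card S)) * (F S T)\<^sup>2) \<le> 200 * real m * real n"
proof -
  have "(\<Sum>S\<in>SS. \<Sum>T\<in>SS. (c ^ card T * F T S)\<^sup>2) \<le> 100 * real m * real n"
    using matched_sample.weighted_F_bound[OF sw sz Dn] by (simp add: F_swap)
  then have "(\<Sum>S\<in>SS. \<Sum>T\<in>SS. (c ^ card S * F S T)\<^sup>2) \<le> 100 * real m * real n"
    by (subst sum.swap)
  moreover have "(\<Sum>S\<in>SS. \<Sum>T\<in>SS. (c ^ card T * F S T)\<^sup>2) \<le> 100 * real m * real n"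
    by (rule weighted_F_bound[OF sz Dn])
  moreover have "(\<Sum>S\<in>SS. \<Sum>T\<in>SS. (c ^ (2 * card T) + c ^ (2 * card S)) * (F S T)\<^sup>2)
     = (\<Sum>S\<in>SS. \<Sum>T\<in>SS. (c ^ card T * F S T)\<^sup>2) + (\<Sum>S\<in>SS. \<Sum>T\<in>SS. (c ^ card S * F S T)\<^sup>2)"
    unfolding sum.distrib[symmetric]
    by (intro sum.cong refl) (simp add: power_mult_distrib distrib_right power_even_eq)
  ultimately show ?thesis by linarith
qed

lemma F_empty: "F {} {} = real m"
  by (simp add: F_def)

text \<open>The term at \<open>({}, {})\<close> is m^2, and all terms of even total degree are
  nonnegative. In a term of odd total degree the two degrees differ, so its weight is at most
  \<open>c\<close> times \<open>c\<close> to twice the smaller degree; this spare factor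
  \<open>c\<close> makes the error small.\<close>

lemma sum_wd_lower:
  assumes sz: "(real r0 + 1) * D\<^sup>2 \<le> sqrt (real m * real n)" and Dn: "D \<le> real n"
  shows "(real m)\<^sup>2 - 200 * c * real m * real n
     \<le> (\<Sum>i<m. \<Sum>j<m. wd K d c (z (x i)) (z (x j)) * wd K d c (z (y i)) (z (y j)))"
proof -
  let ?e = "\<lambda>S T. if S = {} \<and> T = {} then (real m)\<^sup>2 else (0::real)"
  let ?w = "\<lambda>S T. (c ^ (2 * card T) + c ^ (2 * card S)) * (F S T)\<^sup>2"
  have "(\<Sum>S\<in>SS. \<Sum>T\<in>SS. ?e S T - c * ?w S T) \<le> (\<Sum>S\<in>SS. \<Sum>T\<in>SS. (-c) ^ card S * (-c) ^ card T * (F S T)\<^sup>2)"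
  proof (intro sum_mono)
    fix S T assume ST: "S \<in> SS" "T \<in> SS"
    have w0: "0 \<le> c * ?w S T" using c0 by (intro mult_nonneg_nonneg add_nonneg_nonneg) auto
    show "?e S T - c * ?w S T \<le> (-c) ^ card S * (-c) ^ card T * (F S T)\<^sup>2"
    proof (cases "even (card S + card T)")
      case True
      then have eq: "(-c) ^ card S * (-c) ^ card T = c ^ (card S + card T)"
        by (simp flip: power_add)
      show ?thesis
      proof (cases "S = {} \<and> T = {}")
        case True
        then show ?thesis using w0 by (simp add: F_empty)
      next
        case False
        have "0 \<le> c ^ (card S + card T) * (F S T)\<^sup>2" using c0 by simp
        then show ?thesis using False w0 unfolding eq by auto
      qed
    next
      case False
      then have eq: "(-c) ^ card S * (-c) ^ card T = - (c ^ (card S + card T))"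
        by (simp flip: power_add)
      have ne: "\<not> (S = {} \<and> T = {})" using False by auto
      have "c ^ (card S + card T) \<le> c * (c ^ (2 * card T) + c ^ (2 * card S))"
      proof (cases "card T < card S")
        case True
        then have "c ^ (card S + card T) \<le> c ^ Suc (2 * card T)" using c0 c1 by (intro power_decreasing) auto
        moreover have "0 \<le> c * c ^ (2 * card S)" using c0 by simp
        ultimately show ?thesis by (simp add: distrib_left)
      next
        case F2: False
        have "card S \<noteq> card T" using False by auto
        with F2 have "c ^ (card S + card T) \<le> c ^ Suc (2 * card S)" using c0 c1 by (intro power_decreasing) auto
        moreover have "0 \<le> c * c ^ (2 * card T)" using c0 by simp
        ultimately show ?thesis by (simp add: distrib_left)
      qed
      then have "c ^ (card S + card T) * (F S T)\<^sup>2 \<le> c * (c ^ (2 * card T) + c ^ (2 * card S)) * (F S T)\<^sup>2"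
        by (intro mult_right_mono) auto
      then show ?thesis using ne unfolding eq by (auto simp: mult.assoc)
    qed
  qed
  moreover have "(\<Sum>S\<in>SS. \<Sum>T\<in>SS. ?e S T - c * ?w S T) = (\<Sum>S\<in>SS. \<Sum>T\<in>SS. ?e S T) - c * (\<Sum>S\<in>SS. \<Sum>T\<in>SS. ?w S T)"
    by (simp only: sum_subtractf sum_distrib_left)
  moreover have "(\<Sum>S\<in>SS. \<Sum>T\<in>SS. ?e S T) = (real m)\<^sup>2"
  proof -
    have *: "(\<Sum>T\<in>SS. ?e S T) = (if S = {} then (real m)\<^sup>2 else 0)" for S
      using finSS by (cases "S = {}") auto
    show ?thesis unfolding * using finSS by simp
  qed
  moreover have "c * (\<Sum>S\<in>SS. \<Sum>T\<in>SS. ?w S T) \<le> c * (200 * real m * real n)"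
    using weighted_F_bound_swapped[OF sz Dn] c0 by (intro mult_left_mono) auto
  ultimately show ?thesis unfolding sum_wd_wd by (simp add: mult_ac)
qed

text \<open>Signs are dropped: the weight is at most \<open>c\<close> to the sum of the degrees,
  hence at most \<open>c\<close> to twice the smaller one. Unequal parameters occur when pairs
  outside the window are estimated.\<close>

lemma sum_wd_upper:
  assumes sz: "(real r0 + 1) * D\<^sup>2 \<le> sqrt (real m * real n)" and Dn: "D \<le> real n"
    and c12: "0 \<le> c1" "c1 \<le> c" "0 \<le> c2" "c2 \<le> c"
  shows "(\<Sum>i<m. \<Sum>j<m. wd K d c1 (z (x i)) (z (x j)) * wd K d c2 (z (y i)) (z (y j))) \<le> 200 * real m * real n"
proof -
  have "(\<Sum>S\<in>SS. \<Sum>T\<in>SS. (-c1) ^ card S * (-c2) ^ card T * (F S T)\<^sup>2)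
     \<le> (\<Sum>S\<in>SS. \<Sum>T\<in>SS. (c ^ (2 * card T) + c ^ (2 * card S)) * (F S T)\<^sup>2)"
  proof (intro sum_mono mult_right_mono)
    fix S T
    have "(-c1) ^ card S * (-c2) ^ card T \<le> \<bar>(-c1) ^ card S * (-c2) ^ card T\<bar>" by simp
    also have "\<dots> = c1 ^ card S * c2 ^ card T" using c12 by (simp add: abs_mult power_abs)
    also have "\<dots> \<le> c ^ card S * c ^ card T" using c12 c0 by (intro mult_mono power_mono) auto
    also have "\<dots> \<le> c ^ (2 * card T) + c ^ (2 * card S)"
    proof (cases "card T \<le> card S")
      case True
      then have "c ^ (card S + card T) \<le> c ^ (2 * card T)" using c0 c1 by (intro power_decreasing) auto
      moreover have "0 \<le> c ^ (2 * card S)" using c0 by simp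
      ultimately show ?thesis unfolding power_add[symmetric] by linarith
    next
      case False
      then have "c ^ (card S + card T) \<le> c ^ (2 * card S)" using c0 c1 by (intro power_decreasing) auto
      moreover have "0 \<le> c ^ (2 * card T)" using c0 by simp
      ultimately show ?thesis unfolding power_add[symmetric] by linarith
    qed
    finally show "(-c1) ^ card S * (-c2) ^ card T \<le> c ^ (2 * card T) + c ^ (2 * card S)" .
  qed auto
  then show ?thesis unfolding sum_wd_wd using weighted_F_bound_swapped[OF sz Dn] by linarith
qed

lemma abs_wd_diag:
  assumes "0 \<le> c'" "c' \<le> 1"
  shows "\<bar>wd K d c' u v\<bar> \<le> D"
proof -
  have "\<bar>wd K d c' u v\<bar> \<le> (\<Sum>S\<in>SS. \<bar>(-c') ^ card S * (chi u S * chi v S)\<bar>)"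
    unfolding wd_def by (rule sum_abs)
  also have "\<dots> \<le> (\<Sum>S\<in>SS. 1)"
    using assms by (intro sum_mono) (simp add: abs_mult power_abs power_le_one)
  finally show ?thesis by simp
qed

end

text \<open>The upper end of the window forces adjacent vertices to have markedly negative inner
  product, hence small codegree. The lower end caps the kernel by \<open>exp (c * T)\<close>, so
  that it can be scaled to a probability; in the samples used, no pair falls below it.\<close>

definition Wk :: "'a set \<Rightarrow> real \<Rightarrow> real \<Rightarrow> 'a set \<Rightarrow> 'a set \<Rightarrow> real" where
  "Wk K c T u v = (if - T \<le> ip K u v \<and> ip K u v \<le> - c * real (card K) / 2 then wk K c u v else 0)"

lemma Wk_commute: "Wk K c T u v = Wk K c T v u"
  by (simp add: Wk_def wk_commute[of K c u v] ip_commute[of K u v])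

lemma Wk_nonneg: "0 \<le> c \<Longrightarrow> c \<le> 1 \<Longrightarrow> 0 \<le> Wk K c T u v"
  by (simp add: Wk_def wk_nonneg)

context matched_sample
begin

definition Z where
  "Z c1 c2 = (\<Sum>p\<in>offd m. wk K c1 (z (x (fst p))) (z (x (snd p))) * wk K c2 (z (y (fst p))) (z (y (snd p))))"

definition Zd where
  "Zd c1 c2 = (\<Sum>p\<in>offd m. wd K d c1 (z (x (fst p))) (z (x (snd p))) * wd K d c2 (z (y (fst p))) (z (y (snd p))))"

text \<open>The error and norm bounds are square sums over all pairs of the sample, so injectivity
  transfers them to every choice of families. Expanding the difference of products leaves three
  terms for Cauchy-Schwarz; \<open>\<kappa>\<close> may be huge as long as
  \<open>\<eta> * \<kappa>\<close> is small.\<close>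

lemma Z_approx:
  assumes err: "\<And>c'. c' \<in> {c, c/2} \<Longrightarrow>
      (\<Sum>p\<in>offd n. (wk K c' (z (fst p)) (z (snd p)) - wd K d c' (z (fst p)) (z (snd p)))\<^sup>2) \<le> \<eta> * (real n)\<^sup>2"
    and nrm: "\<And>c'. c' \<in> {c, c/2} \<Longrightarrow> (\<Sum>p\<in>offd n. (wk K c' (z (fst p)) (z (snd p)))\<^sup>2) \<le> \<kappa> * (real n)\<^sup>2"
    and c12: "c1 \<in> {c, c/2}" "c2 \<in> {c, c/2}" and ek: "0 \<le> \<eta>" "0 \<le> \<kappa>"
  shows "\<bar>Z c1 c2 - Zd c1 c2\<bar> \<le> (2 * sqrt (\<eta> * \<kappa>) + \<eta>) * (real n)\<^sup>2"
proof -
  define f where "f p = wk K c1 (z (x (fst p))) (z (x (snd p)))" for p :: "nat \<times> nat"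
  define f' where "f' p = wd K d c1 (z (x (fst p))) (z (x (snd p)))" for p :: "nat \<times> nat"
  define g where "g p = wk K c2 (z (y (fst p))) (z (y (snd p)))" for p :: "nat \<times> nat"
  define g' where "g' p = wd K d c2 (z (y (fst p))) (z (y (snd p)))" for p :: "nat \<times> nat"
  have mx: "inj_on x {..<m}" "x ` {..<m} \<subseteq> {..<n}" and my: "inj_on y {..<m}" "y ` {..<m} \<subseteq> {..<n}"
    using mat by (simp_all only: matched_def)
  have f: "(\<Sum>p\<in>offd m. (f p)\<^sup>2) \<le> \<kappa> * (real n)\<^sup>2"
    using sum_offd_inj_le[OF mx, of "\<lambda>u v. (wk K c1 (z u) (z v))\<^sup>2"] nrm[OF c12(1)] by (simp add: f_def)
  have g: "(\<Sum>p\<in>offd m. (g p)\<^sup>2) \<le> \<kappa> * (real n)\<^sup>2"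
    using sum_offd_inj_le[OF my, of "\<lambda>u v. (wk K c2 (z u) (z v))\<^sup>2"] nrm[OF c12(2)] by (simp add: g_def)
  have ff: "(\<Sum>p\<in>offd m. (f p - f' p)\<^sup>2) \<le> \<eta> * (real n)\<^sup>2"
    using sum_offd_inj_le[OF mx, of "\<lambda>u v. (wk K c1 (z u) (z v) - wd K d c1 (z u) (z v))\<^sup>2"] err[OF c12(1)]
    by (simp add: f_def f'_def)
  have gg: "(\<Sum>p\<in>offd m. (g p - g' p)\<^sup>2) \<le> \<eta> * (real n)\<^sup>2"
    using sum_offd_inj_le[OF my, of "\<lambda>u v. (wk K c2 (z u) (z v) - wd K d c2 (z u) (z v))\<^sup>2"] err[OF c12(2)]
    by (simp add: g_def g'_def)
  have "\<bar>Z c1 c2 - Zd c1 c2\<bar> = \<bar>\<Sum>p\<in>offd m. f p * g p - f' p * g' p\<bar>"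
    by (simp add: Z_def Zd_def f_def f'_def g_def g'_def sum_subtractf)
  also have "\<dots> \<le> (\<Sum>p\<in>offd m. \<bar>f p * g p - f' p * g' p\<bar>)" by (rule sum_abs)
  also have "\<dots> \<le> (\<Sum>p\<in>offd m. \<bar>f p - f' p\<bar> * \<bar>g p\<bar> + \<bar>f p\<bar> * \<bar>g p - g' p\<bar> + \<bar>f p - f' p\<bar> * \<bar>g p - g' p\<bar>)"
  proof (intro sum_mono)
    fix p
    have "f p * g p - f' p * g' p = (f p - f' p) * g p + f p * (g p - g' p) - (f p - f' p) * (g p - g' p)"
      by algebra
    then show "\<bar>f p * g p - f' p * g' p\<bar> \<le> \<bar>f p - f' p\<bar> * \<bar>g p\<bar> + \<bar>f p\<bar> * \<bar>g p - g' p\<bar> + \<bar>f p - f' p\<bar> * \<bar>g p - g' p\<bar>"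
      unfolding abs_mult[symmetric] by linarith
  qed
  also have "\<dots> = (\<Sum>p\<in>offd m. \<bar>f p - f' p\<bar> * \<bar>g p\<bar>) + (\<Sum>p\<in>offd m. \<bar>f p\<bar> * \<bar>g p - g' p\<bar>)
     + (\<Sum>p\<in>offd m. \<bar>f p - f' p\<bar> * \<bar>g p - g' p\<bar>)"
    by (simp only: sum.distrib)
  also have "\<dots> \<le> sqrt (\<eta> * (real n)\<^sup>2) * sqrt (\<kappa> * (real n)\<^sup>2) + sqrt (\<kappa> * (real n)\<^sup>2) * sqrt (\<eta> * (real n)\<^sup>2)
      + sqrt (\<eta> * (real n)\<^sup>2) * sqrt (\<eta> * (real n)\<^sup>2)"
    by (intro add_mono sum_mult_le_sqrt f g ff gg)
  also have "\<dots> = (2 * sqrt (\<eta> * \<kappa>) + \<eta>) * (real n)\<^sup>2"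
    using ek by (simp add: real_sqrt_mult power2_eq_square algebra_simps)
  finally show ?thesis .
qed

text \<open>Origin of the losses: \<open>200 * c\<close> from odd degrees, \<open>\<epsilon>\<close>
  from truncation and from the diagonal, and the exponential term from pairs outside the
  window.\<close>

lemma sum_Wk_lower:
  assumes sz: "(real r0 + 1) * D\<^sup>2 \<le> sqrt (real m * real n)" and Dn: "D \<le> real n"
    and err: "\<And>c'. c' \<in> {c, c/2} \<Longrightarrow>
      (\<Sum>p\<in>offd n. (wk K c' (z (fst p)) (z (snd p)) - wd K d c' (z (fst p)) (z (snd p)))\<^sup>2) \<le> \<eta> * (real n)\<^sup>2"
    and nrm: "\<And>c'. c' \<in> {c, c/2} \<Longrightarrow> (\<Sum>p\<in>offd n. (wk K c' (z (fst p)) (z (snd p)))\<^sup>2) \<le> \<kappa> * (real n)\<^sup>2"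
    and ek: "0 \<le> \<eta>" "0 \<le> \<kappa>"
    and ipT: "\<And>u v. u < n \<Longrightarrow> v < n \<Longrightarrow> u \<noteq> v \<Longrightarrow> - T \<le> ip K (z u) (z v)"
  defines "\<epsilon> \<equiv> 2 * sqrt (\<eta> * \<kappa>) + \<eta> + D\<^sup>2 / real n"
  shows "(real m)\<^sup>2 - (200 * c + \<epsilon> + 2 * exp (- c\<^sup>2 * real (card K) / 20) * (200 + \<epsilon>)) * (real n)\<^sup>2
     \<le> (\<Sum>p\<in>offd m. Wk K c T (z (x (fst p))) (z (x (snd p))) * Wk K c T (z (y (fst p))) (z (y (snd p))))"
proof -
  let ?E = "2 * sqrt (\<eta> * \<kappa>) + \<eta>"
  let ?k = "real (card K)"
  have mx: "x i < n" "y i < n" if "i < m" for i using that mat by (auto simp: matched_def)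
  have inj: "x i \<noteq> x j" "y i \<noteq> y j" if "i < m" "j < m" "i \<noteq> j" for i j
    using that mat by (auto simp: matched_def inj_on_def)
  have diag: "\<bar>\<Sum>i<m. wd K d c1 (z (x i)) (z (x i)) * wd K d c2 (z (y i)) (z (y i))\<bar> \<le> D\<^sup>2 / real n * (real n)\<^sup>2"
    if "c1 \<in> {c, c/2}" "c2 \<in> {c, c/2}" for c1 c2
  proof -
    have "\<bar>\<Sum>i<m. wd K d c1 (z (x i)) (z (x i)) * wd K d c2 (z (y i)) (z (y i))\<bar>
       \<le> (\<Sum>i<m. \<bar>wd K d c1 (z (x i)) (z (x i)) * wd K d c2 (z (y i)) (z (y i))\<bar>)" by (rule sum_abs)
    also have "\<dots> \<le> (\<Sum>i<m. D * D)"
      unfolding abs_mult using that c0 c1 by (intro sum_mono mult_mono abs_wd_diag) auto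
    also have "\<dots> = real m * D\<^sup>2" by (simp add: power2_eq_square)
    also have "\<dots> \<le> real n * D\<^sup>2" using m_le_n by (intro mult_right_mono) auto
    also have "\<dots> = D\<^sup>2 / real n * (real n)\<^sup>2" using n1 by (simp add: power2_eq_square)
    finally show ?thesis .
  qed
  have Zd_eq: "Zd c1 c2 = (\<Sum>i<m. \<Sum>j<m. wd K d c1 (z (x i)) (z (x j)) * wd K d c2 (z (y i)) (z (y j)))
      - (\<Sum>i<m. wd K d c1 (z (x i)) (z (x i)) * wd K d c2 (z (y i)) (z (y i)))" for c1 c2
    unfolding Zd_def by (rule sum_offd)
  have mn: "real m * real n \<le> (real n)\<^sup>2" using m_le_n by (simp add: power2_eq_square mult_right_mono)
  have lower: "(real m)\<^sup>2 - (200 * c + \<epsilon>) * (real n)\<^sup>2 \<le> Z c c"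
  proof -
    have "200 * c * (real m * real n) \<le> 200 * c * (real n)\<^sup>2" using mn c0 by (intro mult_left_mono) auto
    then show ?thesis
      using sum_wd_lower[OF sz Dn] diag[of c c] Z_approx[OF err nrm _ _ ek, of c c] Zd_eq[of c c]
      by (simp add: \<epsilon>_def algebra_simps abs_le_iff)
  qed
  have upper: "Z c1 c2 \<le> (200 + \<epsilon>) * (real n)\<^sup>2" if "c1 \<in> {c, c/2}" "c2 \<in> {c, c/2}" for c1 c2
  proof -
    have "0 \<le> c1" "c1 \<le> c" "0 \<le> c2" "c2 \<le> c" using that c0 by auto
    then show ?thesis
      using sum_wd_upper[OF sz Dn, of c1 c2] diag[OF that] Z_approx[OF err nrm that ek] Zd_eq[of c1 c2] mn
      by (simp add: \<epsilon>_def algebra_simps abs_le_iff)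
  qed
  let ?q = "exp (- c\<^sup>2 * ?k / 20)"
  \<comment> \<open>Above the threshold - c k / 2 the tilting exponent is at most c^2 k / 4 - 3 c^2
    k / 10 = - c^2 k / 20.\<close>
  have tilt: "(if ip K a b \<le> - c * ?k / 2 then 0 else wk K c a b) \<le> ?q * wk K (c/2) a b" for a b
  proof (cases "ip K a b \<le> - c * ?k / 2")
    case True
    then show ?thesis using c0 c1 by (simp add: wk_nonneg)
  next
    case False
    have "wk K c a b \<le> wk K (c/2) a b * exp (- c / 2 * ip K a b - 3/10 * c\<^sup>2 * ?k)"
      using c0 c1 by (intro wk_le_tilted) auto
    also have "\<dots> \<le> wk K (c/2) a b * ?q"
    proof (intro mult_left_mono)
      have "c / 2 * (- c * ?k / 2) \<le> c / 2 * ip K a b" using False c0 by (intro mult_left_mono) auto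
      then have "- c / 2 * ip K a b - 3/10 * c\<^sup>2 * ?k \<le> - c\<^sup>2 * ?k / 20" by (simp add: power2_eq_square)
      then show "exp (- c / 2 * ip K a b - 3/10 * c\<^sup>2 * ?k) \<le> ?q" by simp
      show "0 \<le> wk K (c/2) a b" using c0 c1 by (intro wk_nonneg) auto
    qed
    finally show ?thesis using False by (simp add: mult.commute)
  qed
  \<comment> \<open>The two factors are windowed one after the other; each replacement leaves a
    mixed sum, \<open>Z (c/2) c\<close> or \<open>Z c (c/2)\<close>, with the small factor
    \<open>?q\<close>.\<close>
  have "Z c c \<le> (\<Sum>p\<in>offd m. Wk K c T (z (x (fst p))) (z (x (snd p))) * Wk K c T (z (y (fst p))) (z (y (snd p)))
      + ?q * (wk K (c/2) (z (x (fst p))) (z (x (snd p))) * wk K c (z (y (fst p))) (z (y (snd p))))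
      + ?q * (wk K c (z (x (fst p))) (z (x (snd p))) * wk K (c/2) (z (y (fst p))) (z (y (snd p)))))"
    unfolding Z_def
  proof (intro sum_mono)
    fix p assume p: "p \<in> offd m"
    then have p': "fst p < m" "snd p < m" "fst p \<noteq> snd p" by (auto simp: offd_def)
    let ?a = "z (x (fst p))" and ?b = "z (x (snd p))" and ?a' = "z (y (fst p))" and ?b' = "z (y (snd p))"
    have T: "- T \<le> ip K ?a ?b" "- T \<le> ip K ?a' ?b'"
      using p' mx inj by (intro ipT; blast)+
    have nn: "0 \<le> wk K c ?a ?b" "0 \<le> wk K c ?a' ?b'" "0 \<le> wk K (c/2) ?a ?b" "0 \<le> wk K (c/2) ?a' ?b'"
      using c0 c1 by (auto intro!: wk_nonneg)
    have 1: "wk K c ?a ?b \<le> Wk K c T ?a ?b + ?q * wk K (c/2) ?a ?b"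
      using tilt[of ?a ?b] T nn by (auto simp: Wk_def split: if_splits)
    have 2: "wk K c ?a' ?b' \<le> Wk K c T ?a' ?b' + ?q * wk K (c/2) ?a' ?b'"
      using tilt[of ?a' ?b'] T nn by (auto simp: Wk_def split: if_splits)
    have W: "0 \<le> Wk K c T ?a ?b" "Wk K c T ?a ?b \<le> wk K c ?a ?b"
      using nn by (auto simp: Wk_def)
    have "wk K c ?a ?b * wk K c ?a' ?b' \<le> (Wk K c T ?a ?b + ?q * wk K (c/2) ?a ?b) * wk K c ?a' ?b'"
      using 1 nn by (intro mult_right_mono) auto
    also have "\<dots> = Wk K c T ?a ?b * wk K c ?a' ?b' + ?q * (wk K (c/2) ?a ?b * wk K c ?a' ?b')"
      by (simp add: algebra_simps)
    also have "Wk K c T ?a ?b * wk K c ?a' ?b' \<le> Wk K c T ?a ?b * (Wk K c T ?a' ?b' + ?q * wk K (c/2) ?a' ?b')"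
      using 2 W by (intro mult_left_mono) auto
    also have "\<dots> = Wk K c T ?a ?b * Wk K c T ?a' ?b' + Wk K c T ?a ?b * (?q * wk K (c/2) ?a' ?b')"
      by (simp add: algebra_simps)
    also have "Wk K c T ?a ?b * (?q * wk K (c/2) ?a' ?b') \<le> wk K c ?a ?b * (?q * wk K (c/2) ?a' ?b')"
      using W nn by (intro mult_right_mono) auto
    finally show "wk K c ?a ?b * wk K c ?a' ?b' \<le> Wk K c T ?a ?b * Wk K c T ?a' ?b'
        + ?q * (wk K (c/2) ?a ?b * wk K c ?a' ?b') + ?q * (wk K c ?a ?b * wk K (c/2) ?a' ?b')"
      by (simp add: mult_ac)
  qed
  also have "\<dots> = (\<Sum>p\<in>offd m. Wk K c T (z (x (fst p))) (z (x (snd p))) * Wk K c T (z (y (fst p))) (z (y (snd p))))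
      + ?q * Z (c/2) c + ?q * Z c (c/2)"
    by (simp only: sum.distrib Z_def sum_distrib_left)
  finally have "Z c c \<le> (\<Sum>p\<in>offd m. Wk K c T (z (x (fst p))) (z (x (snd p))) * Wk K c T (z (y (fst p))) (z (y (snd p))))
      + ?q * Z (c/2) c + ?q * Z c (c/2)" .
  moreover have "?q * Z (c/2) c \<le> ?q * ((200 + \<epsilon>) * (real n)\<^sup>2)" "?q * Z c (c/2) \<le> ?q * ((200 + \<epsilon>) * (real n)\<^sup>2)"
    by (intro mult_left_mono upper; simp)+
  ultimately show ?thesis using lower by (simp add: algebra_simps)
qed

end

section \<open>Moment and tail estimates for the random points\<close>

context prod_prob
begin

text \<open>For fixed values at \<open>u\<close> and \<open>v\<close> the remaining coordinates are
  independent. With an exponential for \<open>h\<close> this bounds the moment generating function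
  of a codegree.\<close>

lemma E_prod_triples_le:
  assumes uv: "u \<in> A" "v \<in> A" and X: "finite X" "X \<subseteq> A - {u, v}"
    and h: "\<And>p q b. 0 \<le> h p q b" and \<beta>: "0 \<le> \<beta>"
    and bd: "\<And>a p q. a \<in> X \<Longrightarrow> p \<in> B \<Longrightarrow> q \<in> B \<Longrightarrow> (\<Sum>b\<in>B. \<mu> a b * h p q b) \<le> \<beta>"
  shows "E (\<lambda>z. \<Prod>a\<in>X. h (z u) (z v) (z a)) \<le> \<beta> ^ card X"
  using X bd
proof (induction X rule: finite_induct)
  case empty
  then show ?case by (simp add: E_const)
next
  case (insert a X)
  let ?\<Phi> = "\<lambda>z. \<Prod>a\<in>X. h (z u) (z v) (z a)"
  have IH: "E ?\<Phi> \<le> \<beta> ^ card X" using insert.prems by (intro insert.IH) auto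
  have "E (\<lambda>z. \<Prod>a\<in>insert a X. h (z u) (z v) (z a)) = E (\<lambda>z. ?\<Phi> z * h (z u) (z v) (z a))"
    using insert.hyps by (simp add: mult.commute)
  also have "\<dots> \<le> \<beta> * E ?\<Phi>"
  proof (rule E_pull_le[where i = a])
    show "a \<in> A" using insert.prems by auto
    fix z assume z: "z \<in> \<Omega>"
    show "0 \<le> ?\<Phi> z" using h by (intro prod_nonneg) auto
    have ne: "a \<noteq> u" "a \<noteq> v" using insert.prems by auto
    have "z u \<in> B" "z v \<in> B" using z uv by auto
    then show "(\<Sum>b\<in>B. \<mu> a b * h ((z(a := b)) u) ((z(a := b)) v) ((z(a := b)) a)) \<le> \<beta>"
      using insert.prems ne by simp
    fix b assume "b \<in> B"
    show "?\<Phi> (z(a := b)) = ?\<Phi> z"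
      using insert.hyps ne by (intro prod.cong refl) auto
  qed
  also have "\<dots> \<le> \<beta> * \<beta> ^ card X"
    using IH \<beta> by (intro mult_left_mono) auto
  finally show ?case using insert.hyps by simp
qed

end

lemma avg_alt: "avg K f = (\<Sum>b\<in>Pow K. 1 / 2 ^ card K * f b)"
  by (simp add: avg_def sum_divide_distrib)

lemma prod_prob_cube:
  assumes "finite K" "finite A"
  shows "prod_prob A (Pow K) (\<lambda>_ _. 1 / 2 ^ card K)"
  by unfold_locales (use assms in \<open>auto simp: card_Pow\<close>)

text \<open>Markov's inequality for the 2q-th moment. If \<open>nsq\<close> vanishes, so does
  \<open>gpoly\<close>, and the strict inequality in \<open>bad\<close> fails.\<close>

lemma avg_bad_le:
  assumes "finite K" "1 \<le> q" "c\<^sup>2 * (2 * real q - 1) \<le> 1"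
  shows "avg K (\<lambda>y. of_bool (bad K d c b x y)) \<le> (1/9) ^ q"
proof (cases "nsq K d b x = 0")
  case True
  have "\<forall>T\<in>low K d. (beta K d b x T)\<^sup>2 = 0"
    using True finite_low[OF assms(1)] unfolding nsq_def by (subst sum_nonneg_eq_0_iff[symmetric]) auto
  then have "gpoly K d c b x y = 0" for y by (simp add: gpoly_def)
  then show ?thesis using assms(1) by (simp add: bad_def True)
next
  case False
  then have N: "0 < nsq K d b x" using nsq_nonneg[of K d b x] by linarith
  let ?N = "nsq K d b x"
  let ?b = "\<lambda>T. if T \<in> low K d then beta K d b x T else 0"
  have lowP: "low K d \<subseteq> Pow K" by (auto simp: low_def)
  have finP: "finite (Pow K)" using assms(1) by simp
  have g: "gpoly K d c b x y = (\<Sum>T\<in>Pow K. c ^ card T * ?b T * chi y T)" for y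
    unfolding gpoly_def by (rule sum.mono_neutral_cong_left) (use lowP finP in auto)
  have n: "?N = (\<Sum>T\<in>Pow K. (?b T)\<^sup>2)"
    unfolding nsq_def by (rule sum.mono_neutral_cong_left) (use lowP finP in auto)
  have "avg K (\<lambda>y. gpoly K d c b x y ^ (2 * q)) \<le> ?N ^ q"
    unfolding g n by (rule hypercontractive[OF assms])
  moreover have "avg K (\<lambda>y. of_bool (bad K d c b x y)) \<le> avg K (\<lambda>y. 1 / (9 * ?N) ^ q * gpoly K d c b x y ^ (2 * q))"
  proof (rule avg_mono)
    fix y
    show "of_bool (bad K d c b x y) \<le> 1 / (9 * ?N) ^ q * gpoly K d c b x y ^ (2 * q)"
    proof (cases "bad K d c b x y")
      case True
      then have "(9 * ?N) ^ q \<le> ((gpoly K d c b x y)\<^sup>2) ^ q" using N by (intro power_mono) (auto simp: bad_def)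
      then show ?thesis using N True by (simp add: power_mult)
    qed (use N in \<open>simp add: power_mult\<close>)
  qed
  moreover have "avg K (\<lambda>y. 1 / (9 * ?N) ^ q * gpoly K d c b x y ^ (2 * q))
      = 1 / (9 * ?N) ^ q * avg K (\<lambda>y. gpoly K d c b x y ^ (2 * q))" by (rule avg_cmult)
  moreover have "1 / (9 * ?N) ^ q * avg K (\<lambda>y. gpoly K d c b x y ^ (2 * q)) \<le> 1 / (9 * ?N) ^ q * ?N ^ q"
    using calculation(1) N by (intro mult_left_mono) auto
  moreover have "1 / (9 * ?N) ^ q * ?N ^ q = (1/9) ^ q"
    using N by (simp add: power_mult_distrib power_divide)
  ultimately show ?thesis by linarith
qed

lemma avg_wk_sq:
  assumes "finite K" "F \<subseteq> Pow K"
  shows "avg K (\<lambda>y. (\<Sum>S\<in>F. (-c) ^ card S * (chi x S * chi y S))\<^sup>2) = (\<Sum>S\<in>F. c ^ (2 * card S))"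
proof -
  have "avg K (\<lambda>y. (\<Sum>S\<in>F. (-c) ^ card S * (chi x S * chi y S))\<^sup>2)
    = avg K (\<lambda>y. (\<Sum>S\<in>F. ((-c) ^ card S * chi x S) * chi y S)\<^sup>2)"
    by (simp add: mult.assoc)
  also have "\<dots> = (\<Sum>S\<in>F. ((-c) ^ card S * chi x S)\<^sup>2)"
    by (rule avg_parseval[OF assms])
  also have "\<dots> = (\<Sum>S\<in>F. c ^ (2 * card S))"
    by (intro sum.cong refl) (simp add: power_mult_distrib power2_eq_square[of "chi _ _"] power_even_eq[symmetric] mult.commute flip: power_mult)
  finally show ?thesis .
qed

lemma wk_minus_wd:
  assumes "finite K"
  shows "wk K c x y - wd K d c x y = (\<Sum>S\<in>Pow K - low K d. (-c) ^ card S * (chi x S * chi y S))"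
  unfolding wk_expand[OF assms] wd_def
  by (subst sum_diff) (use assms in \<open>auto simp: low_def\<close>)

lemma exp_minus_le: "0 \<le> (x::real) \<Longrightarrow> exp (- x) \<le> 1 - x + x\<^sup>2"
proof -
  assume x: "0 \<le> x"
  have "1 \<le> (1 + x) * (1 - x + x\<^sup>2)"
  proof -
    have "(1 + x) * (1 - x + x\<^sup>2) = 1 + x ^ 3" by (simp add: power2_eq_square power3_eq_cube algebra_simps)
    then show ?thesis using x by simp
  qed
  also have "\<dots> \<le> exp x * (1 - x + x\<^sup>2)"
  proof (intro mult_right_mono exp_ge_add_one_self)
    have "0 \<le> (x - 1/2)\<^sup>2 + 3/4" by simp
    then show "0 \<le> 1 - x + x\<^sup>2" by (simp add: power2_eq_square algebra_simps)
  qed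
  finally show ?thesis by (simp add: exp_minus field_simps)
qed

text \<open>Coordinatewise, (exp a + exp (- a)) / 2 is at most 1 + a^2 \<le> exp (a^2); by symmetry
  the sign \<open>sg x l\<close> does not matter.\<close>

lemma avg_exp_ip_le:
  assumes "finite K" "0 \<le> a" "a \<le> 1"
  shows "avg K (\<lambda>y. exp (- a * ip K x y)) \<le> exp (a\<^sup>2 * real (card K))"
proof -
  have "avg K (\<lambda>y. exp (- a * ip K x y)) = avg K (\<lambda>y. \<Prod>l\<in>K. exp (- a * (sg x l * sg y l)))"
    using assms(1) by (simp add: ip_def sum_distrib_left exp_sum sum_negf[symmetric])
  also have "\<dots> = (\<Prod>l\<in>K. (exp (- a * (sg x l * (-1))) + exp (- a * (sg x l * 1))) / 2)"
    by (rule avg_prod[OF assms(1)])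
  also have "\<dots> \<le> (\<Prod>l\<in>K. exp (a\<^sup>2))"
  proof (intro prod_mono conjI)
    fix l
    have "(exp a + exp (- a)) / 2 \<le> 1 + a\<^sup>2"
      using exp_bound[of a] exp_minus_le[of a] assms by simp
    also have "\<dots> \<le> exp (a\<^sup>2)" by (rule exp_ge_add_one_self)
    finally show "(exp (- a * (sg x l * (-1))) + exp (- a * (sg x l * 1))) / 2 \<le> exp (a\<^sup>2)"
      by (auto simp: sg_def add.commute)
  qed auto
  also have "\<dots> = exp (a\<^sup>2 * real (card K))"
    by (simp add: exp_of_nat_mult[symmetric] mult.commute)
  finally show ?thesis .
qed

lemma wk_le_exp: "finite K \<Longrightarrow> 0 \<le> c \<Longrightarrow> c \<le> 1 \<Longrightarrow> wk K c x y \<le> exp (- c * ip K x y)"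
proof -
  assume "finite K" "0 \<le> c" "c \<le> 1"
  have "wk K c x y \<le> (\<Prod>l\<in>K. exp (- c * (sg x l * sg y l)))"
    unfolding wk_def
  proof (intro prod_mono conjI)
    fix l
    show "0 \<le> 1 - c * (sg x l * sg y l)" using \<open>0 \<le> c\<close> \<open>c \<le> 1\<close> by (auto simp: sg_def)
    show "1 - c * (sg x l * sg y l) \<le> exp (- c * (sg x l * sg y l))"
      using exp_ge_add_one_self[of "- c * (sg x l * sg y l)"] by simp
  qed
  also have "\<dots> = exp (- c * ip K x y)"
    using \<open>finite K\<close> by (simp add: ip_def sum_distrib_left exp_sum sum_negf[symmetric])
  finally show ?thesis .
qed

lemma Wk_le_exp:
  assumes "finite K" "0 \<le> c" "c \<le> 1"
  shows "Wk K c T x y \<le> exp (c * T)"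
proof (cases "- T \<le> ip K x y")
  case True
  then have "c * (- T) \<le> c * ip K x y" using assms(2) by (intro mult_left_mono)
  then have "exp (- c * ip K x y) \<le> exp (c * T)" by simp
  then have "wk K c x y \<le> exp (c * T)" using wk_le_exp[OF assms, of x y] by (rule order_trans[rotated])
  then show ?thesis by (simp add: Wk_def)
qed (simp add: Wk_def)

lemma avg_wk_wk_le:
  assumes "finite K" "0 \<le> c" "c \<le> 1"
  shows "avg K (\<lambda>z. wk K c x z * wk K c y z) \<le> exp (c\<^sup>2 * ip K x y)"
proof -
  have "avg K (\<lambda>z. wk K c x z * wk K c y z) = (\<Prod>l\<in>K. 1 + c\<^sup>2 * (sg x l * sg y l))"
    by (rule avg_wk_wk[OF assms(1)])
  also have "\<dots> \<le> (\<Prod>l\<in>K. exp (c\<^sup>2 * (sg x l * sg y l)))"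
  proof (intro prod_mono conjI exp_ge_add_one_self)
    fix l
    have "c\<^sup>2 \<le> 1" "- 1 \<le> c\<^sup>2" using assms by (auto simp: power_le_one intro: order_trans[OF _ zero_le_power2])
    then show "0 \<le> 1 + c\<^sup>2 * (sg x l * sg y l)" by (auto simp: sg_def)
  qed
  also have "\<dots> = exp (c\<^sup>2 * ip K x y)"
    using assms(1) by (simp add: ip_def sum_distrib_left exp_sum)
  finally show ?thesis .
qed

definition codeg :: "'a set \<Rightarrow> real \<Rightarrow> real \<Rightarrow> nat \<Rightarrow> (nat \<Rightarrow> 'a set) \<Rightarrow> nat \<Rightarrow> nat \<Rightarrow> real" where
  "codeg K c T n z u v = (\<Sum>a\<in>{..<n} - {u, v}. Wk K c T (z u) (z a) * Wk K c T (z v) (z a))"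

text \<open>The condition on \<open>s\<close> keeps the exponent t at most 1, where exp t \<le> 1 +
  2 t. In the linear bound the window may be dropped, and composing the two kernels turns the inner
  product of \<open>x\<close> and \<open>y\<close> into the decay factor.\<close>

lemma avg_exp_Wk_le:
  assumes "finite K" "0 \<le> c" "c \<le> 1" "0 \<le> s" "s * (exp (c * T))\<^sup>2 \<le> 1"
    and ipxy: "ip K x y \<le> - c * real (card K) / 2"
  shows "avg K (\<lambda>b. exp (s * (Wk K c T x b * Wk K c T y b))) \<le> 1 + 2 * s * exp (- (c ^ 3) * real (card K) / 2)"
proof -
  have "avg K (\<lambda>b. exp (s * (Wk K c T x b * Wk K c T y b))) \<le> avg K (\<lambda>b. 1 + 2 * s * (wk K c x b * wk K c y b))"
  proof (rule avg_mono)
    fix b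
    have W: "0 \<le> Wk K c T x b" "0 \<le> Wk K c T y b" "Wk K c T x b \<le> exp (c * T)" "Wk K c T y b \<le> exp (c * T)"
      using assms by (auto intro: Wk_nonneg Wk_le_exp)
    let ?t = "s * (Wk K c T x b * Wk K c T y b)"
    have t0: "0 \<le> ?t" using W assms by simp
    have "Wk K c T x b * Wk K c T y b \<le> exp (c * T) * exp (c * T)" using W by (intro mult_mono) auto
    then have "?t \<le> s * (exp (c * T))\<^sup>2" using assms(4) by (simp add: power2_eq_square mult_left_mono)
    then have t1: "?t \<le> 1" using assms by linarith
    have "exp ?t \<le> 1 + ?t + ?t\<^sup>2" using t0 t1 by (intro exp_bound)
    also have "?t\<^sup>2 \<le> ?t" using t0 t1 by (simp add: power2_eq_square mult_left_le)
    finally have "exp ?t \<le> 1 + 2 * ?t" by simp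
    also have "?t \<le> s * (wk K c x b * wk K c y b)"
      using assms W by (intro mult_left_mono mult_mono) (auto simp: Wk_def wk_nonneg)
    finally show "exp ?t \<le> 1 + 2 * s * (wk K c x b * wk K c y b)" by simp
  qed
  also have "\<dots> = 1 + 2 * s * avg K (\<lambda>b. wk K c x b * wk K c y b)"
    using assms(1) by (simp add: avg_def sum.distrib add_divide_distrib card_Pow flip: sum_distrib_left)
  also have "\<dots> \<le> 1 + 2 * s * exp (c\<^sup>2 * ip K x y)"
    using assms avg_wk_wk_le[of K c x y] by (intro add_left_mono mult_left_mono) auto
  also have "\<dots> \<le> 1 + 2 * s * exp (- (c ^ 3) * real (card K) / 2)"
  proof -
    have "c\<^sup>2 * ip K x y \<le> c\<^sup>2 * (- c * real (card K) / 2)" using ipxy by (intro mult_left_mono) auto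
    then have "c\<^sup>2 * ip K x y \<le> - (c ^ 3) * real (card K) / 2" by (simp add: power2_eq_square power3_eq_cube mult_ac)
    then show ?thesis using assms(4) by (intro add_left_mono mult_left_mono) auto
  qed
  finally show ?thesis .
qed

lemma bad_cong:
  assumes "\<And>S T. S \<in> low K d \<Longrightarrow> T \<in> low K d \<Longrightarrow> b S T = b' S T"
  shows "bad K d c b x y = bad K d c b' x y"
proof -
  have "beta K d b x T = beta K d b' x T" if "T \<in> low K d" for T
    unfolding beta_def using assms that by (intro sum.cong) auto
  then show ?thesis by (simp add: bad_def nsq_def gpoly_def cong: sum.cong)
qed

subsection \<open>Existence of a pseudorandom sample\<close>

text \<open>Numerical budget: \<open>Dn\<close> pays for near-orthogonality, \<open>hyp\<close> and
  \<open>nq\<close> for the union bound over bad arrays, \<open>eta\<close> and \<open>kap\<close>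
  for truncation error and norm, \<open>lamT\<close> for the lower end \<open>- R\<close> of the
  inner products, and \<open>cod\<close> for the codegrees.\<close>

locale sample_params =
  fixes K :: "'a set" and d :: nat and c :: real and n q :: nat and \<eta>0 \<kappa>0 R lm :: real
  assumes finK: "finite K" and c0: "0 < c" and c1: "c \<le> 1/20" and n3: "3 \<le> n" and q1: "1 \<le> q"
    and hyp: "c\<^sup>2 * (2 * real q - 1) \<le> 1"
    and Dn: "8 * real (card (low K d)) ^ 4 \<le> real n"
    and nq: "real n ^ 4 \<le> 9 ^ q"
    and eta: "(\<Sum>S\<in>Pow K - low K d. c ^ (2 * card S)) \<le> \<eta>0" and eta0: "0 < \<eta>0"
    and kap: "(\<Sum>S\<in>Pow K. c ^ (2 * card S)) \<le> \<kappa>0"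
    and lam: "0 \<le> lm" "lm \<le> 1" and lamT: "8 * (real n)\<^sup>2 * exp (lm\<^sup>2 * real (card K) - lm * R) \<le> 1"
    and cod: "8 * (real n)\<^sup>2 * exp (- (real n * exp (- (c ^ 3) * real (card K) / 2) / (exp (c * R))\<^sup>2)) \<le> 1"
begin

abbreviation N where "N \<equiv> card (low K d)"
text \<open>Entropy against decay: at most n^(2 N^2) arrays and n^(2 r0) index sequences face a
  probability of at most n^(- 4 r0) each. Adding 2 to N^2 leaves a factor n^(- 4).\<close>

abbreviation r0 where "r0 \<equiv> N\<^sup>2 + 2"
abbreviation \<tau> where "\<tau> \<equiv> exp (- (c ^ 3) * real (card K) / 2)"
text \<open>Chernoff parameter for codegrees: the reciprocal of the bound on a product of two kernel
  values, so that exponents stay at most 1.\<close>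

abbreviation s where "s \<equiv> 1 / (exp (c * R))\<^sup>2"

sublocale pp: prod_prob "{..<n}" "Pow K" "\<lambda>_ _. 1 / 2 ^ card K"
  by (rule prod_prob_cube) (use finK in auto)

lemma N1: "1 \<le> N"
proof -
  have "N \<noteq> 0" using finite_low[OF finK, of d] empty_in_low[of K d] by (metis card_0_eq empty_iff)
  then show ?thesis by simp
qed

lemma Epair: "u < n \<Longrightarrow> v < n \<Longrightarrow> u \<noteq> v \<Longrightarrow> pp.E (\<lambda>z. f (z u) (z v)) = avg K (\<lambda>a. avg K (f a))"
  by (subst pp.E_pair) (auto simp: avg_alt sum_distrib_left mult.assoc)

lemma Epair_le:
  assumes "u < n" "v < n" "u \<noteq> v" "\<And>a. a \<subseteq> K \<Longrightarrow> avg K (f a) \<le> \<beta>"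
  shows "pp.E (\<lambda>z. f (z u) (z v)) \<le> \<beta>"
proof -
  have "avg K (\<lambda>a. avg K (f a)) \<le> avg K (\<lambda>_. \<beta>)" by (intro avg_mono assms(4))
  then show ?thesis using assms finK by (simp add: Epair)
qed

text \<open>Each of the five statistics below has mean at most \<open>1/8\<close>, and a value below \<open>1\<close> enforces one of the regularity
  properties required of the sample.\<close>

definition gram_excess where "gram_excess z = (\<Sum>(S,T)\<in>{p\<in>low K d \<times> low K d. fst p \<noteq> snd p}.
    (real N)\<^sup>2 / (real n)\<^sup>2 * (\<Sum>v<n. chi (z v) S * chi (z v) T)\<^sup>2)"

text \<open>A sum of n independent signs of mean zero has second moment n; at most N^2 pairs with
  weight N^2 / n^2 then give N^4 / n.\<close>

lemma E_gram_excess: "pp.E gram_excess \<le> 1/8"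
proof -
  have one: "pp.E (\<lambda>z. (\<Sum>v<n. chi (z v) S * chi (z v) T)\<^sup>2) = real n"
    if "S \<in> low K d" "T \<in> low K d" "S \<noteq> T" for S T
  proof -
    let ?g = "\<lambda>b. chi b S * chi b T"
    have g0: "avg K ?g = 0" using that finK by (subst avg_chi_chi) (auto simp: low_def)
    have gg: "?g b * ?g b = 1" for b
      by (metis (no_types, opaque_lifting) chi_sq mult.assoc mult.commute mult_1)
    have "pp.E (\<lambda>z. (\<Sum>v<n. ?g (z v))\<^sup>2) = (\<Sum>u<n. \<Sum>v<n. pp.E (\<lambda>z. ?g (z u) * ?g (z v)))"
      unfolding power2_eq_square sum_product by (simp only: pp.E_sum)
    also have "\<dots> = (\<Sum>u<n. \<Sum>v<n. if u = v then 1 else 0)"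
    proof (intro sum.cong refl)
      fix u v assume "u \<in> {..<n}" "v \<in> {..<n}"
      then show "pp.E (\<lambda>z. ?g (z u) * ?g (z v)) = (if u = v then 1 else 0)"
        by (cases "u = v") (simp_all add: gg pp.E_const Epair[of u v "\<lambda>a b. ?g a * ?g b"] avg_cmult g0 avg_const[OF finK])
    qed
    also have "\<dots> = real n" by simp
    finally show ?thesis .
  qed
  let ?P = "{p\<in>low K d \<times> low K d. fst p \<noteq> snd p}"
  have cP: "card ?P \<le> N\<^sup>2"
    using card_mono[of "low K d \<times> low K d" ?P] finite_low[OF finK, of d] by (auto simp: card_cartesian_product power2_eq_square)
  have "pp.E gram_excess = (\<Sum>(S,T)\<in>?P. (real N)\<^sup>2 / (real n)\<^sup>2 * pp.E (\<lambda>z. (\<Sum>v<n. chi (z v) S * chi (z v) T)\<^sup>2))"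
    unfolding gram_excess_def by (simp only: pp.E_sum case_prod_unfold pp.E_cmult)
  also have "\<dots> = (\<Sum>(S,T)\<in>?P. (real N)\<^sup>2 / (real n)\<^sup>2 * real n)"
  proof (intro sum.cong refl)
    fix p assume "p \<in> ?P"
    then show "(case p of (S, T) \<Rightarrow> (real N)\<^sup>2 / (real n)\<^sup>2 * pp.E (\<lambda>z. (\<Sum>v<n. chi (z v) S * chi (z v) T)\<^sup>2))
      = (case p of (S, T) \<Rightarrow> (real N)\<^sup>2 / (real n)\<^sup>2 * real n)"
      by (cases p) (use one in \<open>simp del: power_divide\<close>)
  qed
  also have "\<dots> = real (card ?P) * ((real N)\<^sup>2 / real n)"
    by (simp only: case_prod_unfold sum_constant) (simp add: power2_eq_square)
  also have "\<dots> \<le> real (N\<^sup>2) * ((real N)\<^sup>2 / real n)"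
    using cP by (intro mult_right_mono) auto
  also have "\<dots> = real N ^ 4 / real n" by (simp add: power2_eq_square power4_eq_xxxx)
  also have "\<dots> \<le> 1/8" using Dn n3 by (simp add: field_simps)
  finally show ?thesis .
qed

lemma gram_excess_gram:
  assumes "gram_excess z < 1" "S \<in> low K d" "T \<in> low K d" "S \<noteq> T"
  shows "\<bar>\<Sum>v<n. chi (z v) S * chi (z v) T\<bar> \<le> real n / real N"
proof -
  let ?G = "\<Sum>v<n. chi (z v) S * chi (z v) T"
  let ?f = "\<lambda>(S,T). (real N)\<^sup>2 / (real n)\<^sup>2 * (\<Sum>v<n. chi (z v) S * chi (z v) T)\<^sup>2"
  have "?f (S, T) \<le> gram_excess z"
    unfolding gram_excess_def
    using assms finite_low[OF finK, of d]
    by (intro member_le_sum) auto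
  then have "(real N)\<^sup>2 / (real n)\<^sup>2 * ?G\<^sup>2 \<le> gram_excess z" by simp
  then have "(real N)\<^sup>2 / (real n)\<^sup>2 * ?G\<^sup>2 \<le> 1" using assms(1) by linarith
  then have "(real N * ?G)\<^sup>2 \<le> (real n)\<^sup>2"
    using n3 by (simp add: power_mult_distrib field_simps)
  then have "\<bar>real N * ?G\<bar> \<le> real n" by (metis abs_le_square_iff abs_of_nat)
  then show ?thesis using N1 by (simp add: abs_mult field_simps)
qed

definition Bs where "Bs = PiE (low K d) (\<lambda>_. PiE (low K d) (\<lambda>_. {- int n..int n}))"

text \<open>In the expectation bound \<open>y\<close> supplies the coordinates that are integrated
  out, hence injectivity is imposed on \<open>y\<close>. Length exactly \<open>r0\<close> suffices
  because larger bad families contain such ones.\<close>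

definition seqs :: "((nat \<Rightarrow> nat) \<times> (nat \<Rightarrow> nat)) set" where
  "seqs = {(x, y). x \<in> PiE {..<r0} (\<lambda>_. {..<n}) \<and> y \<in> PiE {..<r0} (\<lambda>_. {..<n}) \<and> inj_on y {..<r0} \<and> x ` {..<r0} \<inter> y ` {..<r0} = {}}"

definition bad_count :: "(nat \<Rightarrow> 'a set) \<Rightarrow> real" where
  "bad_count z = (\<Sum>b\<in>Bs. \<Sum>(x,y)\<in>seqs. \<Prod>j<r0. of_bool (bad K d c b (z (x j)) (z (y j))))"

lemma finBs: "finite Bs"
  unfolding Bs_def by (intro finite_PiE finite_low finK) auto

lemma seqs_sub: "seqs \<subseteq> PiE {..<r0} (\<lambda>_. {..<n}) \<times> PiE {..<r0} (\<lambda>_. {..<n})"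
  by (auto simp: seqs_def)

lemma finseqs: "finite seqs"
  by (rule finite_subset[OF seqs_sub]) (intro finite_cartesian_product finite_PiE; simp)

lemma E_bad_count: "pp.E bad_count \<le> 1/8"
proof -
  have one: "pp.E (\<lambda>z. \<Prod>j<r0. of_bool (bad K d c b (z (x j)) (z (y j)))) \<le> ((1/9) ^ q) ^ r0"
    if "(x, y) \<in> seqs" for x y b
  proof -
    have "pp.E (\<lambda>z. \<Prod>j<r0. (\<lambda>j a b'. of_bool (bad K d c b a b')) j (z (x j)) (z (y j))) \<le> (\<Prod>j<r0. (1/9) ^ q)"
    proof (rule pp.E_prod_pairs_le)
      fix j a assume "j \<in> {..<r0}" "a \<in> Pow K"
      show "(\<Sum>b'\<in>Pow K. 1 / 2 ^ card K * of_bool (bad K d c b a b')) \<le> (1/9::real) ^ q"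
        using avg_bad_le[OF finK q1 hyp, of d b a] by (simp only: avg_alt)
    qed (use that in \<open>auto simp: seqs_def\<close>)
    then show ?thesis by simp
  qed
  have cB: "card Bs = ((2 * n + 1) ^ N) ^ N"
  proof -
    have "nat (2 * int n + 1) = 2 * n + 1" by linarith
    then show ?thesis unfolding Bs_def using finite_low[OF finK, of d] by (simp add: card_PiE)
  qed
  have cS: "card seqs \<le> n ^ r0 * n ^ r0"
    using card_mono[OF _ seqs_sub] by (simp add: card_cartesian_product card_PiE finite_PiE)
  have "pp.E bad_count = (\<Sum>b\<in>Bs. \<Sum>(x,y)\<in>seqs. pp.E (\<lambda>z. \<Prod>j<r0. of_bool (bad K d c b (z (x j)) (z (y j)))))"
    unfolding bad_count_def by (simp only: pp.E_sum case_prod_unfold)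
  also have "\<dots> \<le> (\<Sum>b\<in>Bs. \<Sum>(x,y)\<in>seqs. ((1/9) ^ q) ^ r0)"
  proof (intro sum_mono)
    fix b p assume "p \<in> seqs"
    then show "(case p of (x, y) \<Rightarrow> pp.E (\<lambda>z. \<Prod>j<r0. of_bool (bad K d c b (z (x j)) (z (y j)))))
      \<le> (case p of (x, y) \<Rightarrow> ((1/9) ^ q) ^ r0)"
      by (cases p) (simp only: prod.case one)
  qed
  also have "\<dots> = real (card Bs) * (real (card seqs) * ((1/9) ^ q) ^ r0)"
    by simp
  also have "\<dots> \<le> (real n ^ 2) ^ N\<^sup>2 * (real n ^ (2 * r0) * ((1 / real n ^ 4) ^ r0))"
  proof (intro mult_mono)
    have "3 * n \<le> n * n" using n3 by (intro mult_right_mono) auto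
    then have "2 * n + 1 \<le> n ^ 2" using n3 unfolding power2_eq_square by linarith
    then have "(2 * n + 1) ^ (N\<^sup>2) \<le> (n ^ 2) ^ N\<^sup>2" by (intro power_mono) auto
    then have "card Bs \<le> (n ^ 2) ^ N\<^sup>2" unfolding cB by (simp add: power2_eq_square power_mult)
    then show "real (card Bs) \<le> (real n ^ 2) ^ N\<^sup>2" by (metis of_nat_le_iff of_nat_power)
    show "real (card seqs) \<le> real n ^ (2 * r0)"
      using cS by (metis mult_2 of_nat_le_iff of_nat_power power_add)
    have "(1/9::real) ^ q \<le> 1 / real n ^ 4"
      using nq n3 by (simp add: power_one_over frac_le)
    then show "((1/9::real) ^ q) ^ r0 \<le> (1 / real n ^ 4) ^ r0" by (intro power_mono) auto
  qed auto
  also have "\<dots> = 1 / real n ^ 4"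
  proof -
    have n0: "real n \<noteq> 0" using n3 by simp
    have e: "(real n ^ 4) ^ r0 = (real n ^ 2) ^ N\<^sup>2 * real n ^ (2 * r0) * real n ^ 4"
    proof -
      have "4 * r0 = 2 * N\<^sup>2 + 2 * r0 + 4" by simp
      then have "real n ^ (4 * r0) = real n ^ (2 * N\<^sup>2) * real n ^ (2 * r0) * real n ^ 4"
        by (simp only: power_add)
      then show ?thesis by (simp only: power_mult)
    qed
    show ?thesis unfolding power_one_over e using n0 by simp
  qed
  also have "\<dots> \<le> 1/8"
  proof -
    have "(3::real) ^ 4 \<le> real n ^ 4" using n3 by (intro power_mono) auto
    then show ?thesis using n3 by (intro divide_left_mono) auto
  qed
  finally show ?thesis .
qed

text \<open>An array with \<open>r0\<close> bad pairs would, after restriction to the finite index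
  sets of \<open>bad_count\<close>, produce a summand equal to 1.\<close>

lemma bad_count_few:
  assumes bad_count: "bad_count z < 1"
    and b: "\<And>S T. \<bar>b S T\<bar> \<le> int n" and inj: "inj_on x J" "inj_on y J" and dis: "x ` J \<inter> y ` J = {}"
    and sub: "x ` J \<subseteq> {..<n}" "y ` J \<subseteq> {..<n}" and J: "finite (J::nat set)"
    and bd: "\<And>j. j \<in> J \<Longrightarrow> bad K d c b (z (x j)) (z (y j))"
  shows "card J < r0"
proof (rule ccontr)
  assume "\<not> card J < r0"
  then obtain J' where J': "J' \<subseteq> J" "card J' = r0" "finite J'"
    by (metis not_less obtain_subset_with_card_n)
  then obtain g where g: "bij_betw g {..<r0} J'"
    by (metis atLeast0LessThan ex_bij_betw_nat_finite)
  have gJ: "g j \<in> J" if "j < r0" for j using g J' that by (auto simp: bij_betw_def)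
  define x' where "x' = restrict (x \<circ> g) {..<r0}"
  define y' where "y' = restrict (y \<circ> g) {..<r0}"
  define b' where "b' = restrict (\<lambda>S. restrict (b S) (low K d)) (low K d)"
  have b'B: "b' \<in> Bs"
  proof -
    have "- int n \<le> b S T" "b S T \<le> int n" for S T using b[of S T] by (simp_all add: abs_le_iff)
    then show ?thesis by (auto simp: b'_def Bs_def)
  qed
  have injg: "inj_on g {..<r0}" using g by (simp add: bij_betw_def)
  have xy: "(x', y') \<in> seqs"
  proof -
    have "x' \<in> PiE {..<r0} (\<lambda>_. {..<n})" "y' \<in> PiE {..<r0} (\<lambda>_. {..<n})"
      using sub gJ by (auto simp: x'_def y'_def image_subset_iff)
    moreover have "inj_on y' {..<r0}"
      using inj(2) injg gJ by (auto simp: y'_def inj_on_def)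
    moreover have "x' i \<noteq> y' j" if "i < r0" "j < r0" for i j
      using dis gJ[OF that(1)] gJ[OF that(2)] that by (auto simp: x'_def y'_def)
    ultimately show ?thesis unfolding seqs_def by blast
  qed
  let ?f = "\<lambda>b p. \<Prod>j<r0. of_bool (bad K d c b (z (fst p j)) (z (snd p j))) :: real"
  have "?f b' (x', y') = 1"
  proof -
    have "bad K d c b' (z (x' j)) (z (y' j))" if "j < r0" for j
    proof -
      have "bad K d c b (z (x (g j))) (z (y (g j)))" using gJ[OF that] by (rule bd)
      then show ?thesis using that by (subst bad_cong[of _ _ b' b]) (auto simp: b'_def x'_def y'_def)
    qed
    then show ?thesis by simp
  qed
  moreover have "?f b' (x', y') \<le> (\<Sum>p\<in>seqs. ?f b' p)"
    using xy finseqs by (intro member_le_sum) (auto intro: prod_nonneg)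
  moreover have "(\<Sum>p\<in>seqs. ?f b' p) \<le> (\<Sum>b\<in>Bs. \<Sum>p\<in>seqs. ?f b p)"
    using b'B finBs by (intro member_le_sum[of b' Bs "\<lambda>b. \<Sum>p\<in>seqs. ?f b p"]) (auto intro!: sum_nonneg prod_nonneg)
  ultimately show False using bad_count by (simp add: bad_count_def case_prod_unfold)
qed

definition err2 where "err2 c' z = (\<Sum>p\<in>offd n. (wk K c' (z (fst p)) (z (snd p)) - wd K d c' (z (fst p)) (z (snd p)))\<^sup>2)"
definition nrm2 where "nrm2 c' z = (\<Sum>p\<in>offd n. (wk K c' (z (fst p)) (z (snd p)))\<^sup>2)"

text \<open>Two kernels, each with an error and a norm, give four terms of mean at most
  1/32.\<close>

definition norm_excess where "norm_excess z = (\<Sum>c'\<in>{c, c/2}. 1 / (32 * \<eta>0 * (real n)\<^sup>2) * err2 c' z + 1 / (32 * \<kappa>0 * (real n)\<^sup>2) * nrm2 c' z)"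

lemma kap0: "0 < \<kappa>0"
proof -
  have "1 \<le> (\<Sum>S\<in>Pow K. c ^ (2 * card S))"
    using finK c0 member_le_sum[of "{}" "Pow K" "\<lambda>S. c ^ (2 * card S)"] by auto
  then show ?thesis using kap by linarith
qed

lemma card_offd_le: "real (card (offd n)) \<le> (real n)\<^sup>2"
proof -
  have "card (offd n) \<le> card ({..<n} \<times> {..<n})" by (intro card_mono) (auto simp: offd_def)
  then show ?thesis by (simp add: power2_eq_square card_cartesian_product flip: of_nat_mult)
qed

lemma E_offd_le:
  assumes "\<And>u v. u < n \<Longrightarrow> v < n \<Longrightarrow> u \<noteq> v \<Longrightarrow> pp.E (\<lambda>z. f u v z) \<le> \<beta>" "0 \<le> \<beta>"
  shows "pp.E (\<lambda>z. \<Sum>p\<in>offd n. f (fst p) (snd p) z) \<le> \<beta> * (real n)\<^sup>2"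
proof -
  have "pp.E (\<lambda>z. \<Sum>p\<in>offd n. f (fst p) (snd p) z) = (\<Sum>p\<in>offd n. pp.E (\<lambda>z. f (fst p) (snd p) z))"
    by (rule pp.E_sum)
  also have "\<dots> \<le> (\<Sum>p\<in>offd n. \<beta>)"
    by (intro sum_mono assms(1)) (auto simp: offd_def)
  also have "\<dots> \<le> (real n)\<^sup>2 * \<beta>"
    using card_offd_le assms(2) by (simp add: mult_right_mono)
  finally show ?thesis by (simp add: mult.commute)
qed

lemma c'_pow_le: "c' \<in> {c, c/2} \<Longrightarrow> (\<Sum>S\<in>F. c' ^ (2 * card S)) \<le> (\<Sum>S\<in>F. c ^ (2 * card S))"
  using c0 by (intro sum_mono power_mono) auto

lemma E_err2: "c' \<in> {c, c/2} \<Longrightarrow> pp.E (err2 c') \<le> \<eta>0 * (real n)\<^sup>2"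
  unfolding err2_def
proof (rule E_offd_le[where f = "\<lambda>u v z. (wk K c' (z u) (z v) - wd K d c' (z u) (z v))\<^sup>2"])
  assume c': "c' \<in> {c, c/2}"
  fix u v assume uv: "u < n" "v < n" "u \<noteq> v"
  show "pp.E (\<lambda>z. (wk K c' (z u) (z v) - wd K d c' (z u) (z v))\<^sup>2) \<le> \<eta>0"
  proof (rule Epair_le[OF uv, where f = "\<lambda>a b. (wk K c' a b - wd K d c' a b)\<^sup>2"])
    fix a
    have "avg K (\<lambda>b. (wk K c' a b - wd K d c' a b)\<^sup>2) = (\<Sum>S\<in>Pow K - low K d. c' ^ (2 * card S))"
      unfolding wk_minus_wd[OF finK] by (rule avg_wk_sq[OF finK]) auto
    then show "avg K (\<lambda>b. (wk K c' a b - wd K d c' a b)\<^sup>2) \<le> \<eta>0"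
      using c'_pow_le[OF c', of "Pow K - low K d"] eta by linarith
  qed
qed (use eta0 in auto)

lemma E_nrm2: "c' \<in> {c, c/2} \<Longrightarrow> pp.E (nrm2 c') \<le> \<kappa>0 * (real n)\<^sup>2"
  unfolding nrm2_def
proof (rule E_offd_le[where f = "\<lambda>u v z. (wk K c' (z u) (z v))\<^sup>2"])
  assume c': "c' \<in> {c, c/2}"
  fix u v assume uv: "u < n" "v < n" "u \<noteq> v"
  show "pp.E (\<lambda>z. (wk K c' (z u) (z v))\<^sup>2) \<le> \<kappa>0"
  proof (rule Epair_le[OF uv, where f = "\<lambda>a b. (wk K c' a b)\<^sup>2"])
    fix a
    have "avg K (\<lambda>b. (wk K c' a b)\<^sup>2) = (\<Sum>S\<in>Pow K. c' ^ (2 * card S))"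
      unfolding wk_expand[OF finK] by (rule avg_wk_sq[OF finK]) auto
    then show "avg K (\<lambda>b. (wk K c' a b)\<^sup>2) \<le> \<kappa>0"
      using c'_pow_le[OF c', of "Pow K"] kap by linarith
  qed
qed (use kap0 in auto)

lemma E_norm_excess: "pp.E norm_excess \<le> 1/8"
proof -
  have n0: "0 < (real n)\<^sup>2" using n3 by simp
  have "pp.E norm_excess = (\<Sum>c'\<in>{c, c/2}. 1 / (32 * \<eta>0 * (real n)\<^sup>2) * pp.E (err2 c') + 1 / (32 * \<kappa>0 * (real n)\<^sup>2) * pp.E (nrm2 c'))"
    unfolding norm_excess_def by (simp only: pp.E_sum pp.E_add pp.E_cmult)
  also have "\<dots> \<le> (\<Sum>c'\<in>{c, c/2}. 1 / (32 * \<eta>0 * (real n)\<^sup>2) * (\<eta>0 * (real n)\<^sup>2) + 1 / (32 * \<kappa>0 * (real n)\<^sup>2) * (\<kappa>0 * (real n)\<^sup>2))"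
    using eta0 kap0 by (intro sum_mono add_mono mult_left_mono E_err2 E_nrm2) auto
  also have "\<dots> = (\<Sum>c'\<in>{c, c/2}. 1/16)"
    using eta0 kap0 n0 by (intro sum.cong refl) (simp add: field_simps)
  also have "\<dots> \<le> 1/8" using c0 by simp
  finally show ?thesis .
qed

lemma norm_excess_bounds:
  assumes "norm_excess z < 1" "c' \<in> {c, c/2}"
  shows "err2 c' z \<le> 32 * \<eta>0 * (real n)\<^sup>2" "nrm2 c' z \<le> 32 * \<kappa>0 * (real n)\<^sup>2"
proof -
  have n0: "0 < (real n)\<^sup>2" using n3 by simp
  have nn: "0 \<le> err2 c z" "0 \<le> nrm2 c z" for c by (auto simp: err2_def nrm2_def sum_nonneg)
  let ?f = "\<lambda>c'. 1 / (32 * \<eta>0 * (real n)\<^sup>2) * err2 c' z + 1 / (32 * \<kappa>0 * (real n)\<^sup>2) * nrm2 c' z"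
  have "?f c' \<le> norm_excess z"
    unfolding norm_excess_def using assms(2) eta0 kap0 nn by (intro member_le_sum) auto
  moreover have "0 \<le> 1 / (32 * \<eta>0 * (real n)\<^sup>2) * err2 c' z" "0 \<le> 1 / (32 * \<kappa>0 * (real n)\<^sup>2) * nrm2 c' z"
    using nn[of c'] eta0 kap0 by auto
  ultimately have "1 / (32 * \<eta>0 * (real n)\<^sup>2) * err2 c' z \<le> 1" "1 / (32 * \<kappa>0 * (real n)\<^sup>2) * nrm2 c' z \<le> 1"
    using assms(1) by linarith+
  then show "err2 c' z \<le> 32 * \<eta>0 * (real n)\<^sup>2" "nrm2 c' z \<le> 32 * \<kappa>0 * (real n)\<^sup>2"
    using eta0 kap0 n0 by (simp_all add: divide_le_eq)
qed

definition low_ip_count :: "(nat \<Rightarrow> 'a set) \<Rightarrow> real" where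
  "low_ip_count z = (\<Sum>p\<in>offd n. of_bool (ip K (z (fst p)) (z (snd p)) < - R))"

lemma E_low_ip_count: "pp.E low_ip_count \<le> 1/8"
proof -
  let ?\<beta> = "exp (lm\<^sup>2 * real (card K) - lm * R)"
  have "pp.E low_ip_count \<le> ?\<beta> * (real n)\<^sup>2"
    unfolding low_ip_count_def
  proof (rule E_offd_le[where f = "\<lambda>u v z. of_bool (ip K (z u) (z v) < - R)"])
    fix u v assume uv: "u < n" "v < n" "u \<noteq> v"
    show "pp.E (\<lambda>z. of_bool (ip K (z u) (z v) < - R)) \<le> ?\<beta>"
    proof (rule Epair_le[OF uv, where f = "\<lambda>a b. of_bool (ip K a b < - R)"])
      fix a
      have "avg K (\<lambda>b. of_bool (ip K a b < - R)) \<le> avg K (\<lambda>b. exp (- lm * R) * exp (- lm * ip K a b))"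
      proof (rule avg_mono)
        fix b
        show "of_bool (ip K a b < - R) \<le> exp (- lm * R) * exp (- lm * ip K a b)"
        proof (cases "ip K a b < - R")
          case True
          then have "lm * (R + ip K a b) \<le> 0" using lam(1) by (intro mult_nonneg_nonpos) auto
          then have "0 \<le> - lm * R + - lm * ip K a b" by (simp add: distrib_left)
          then show ?thesis using True by (simp flip: exp_add)
        qed simp
      qed
      also have "\<dots> = exp (- lm * R) * avg K (\<lambda>b. exp (- lm * ip K a b))" by (rule avg_cmult)
      also have "\<dots> \<le> exp (- lm * R) * exp (lm\<^sup>2 * real (card K))"
        by (intro mult_left_mono avg_exp_ip_le finK lam) auto
      also have "\<dots> = ?\<beta>" by (simp flip: exp_add)
      finally show "avg K (\<lambda>b. of_bool (ip K a b < - R)) \<le> ?\<beta>" .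
    qed
  qed simp
  then show ?thesis using lamT by (simp add: mult_ac)
qed

lemma low_ip_count_ip:
  assumes "low_ip_count z < 1" "u < n" "v < n" "u \<noteq> v"
  shows "- R \<le> ip K (z u) (z v)"
proof (rule ccontr)
  assume "\<not> ?thesis"
  then have "(1::real) = of_bool (ip K (z (fst (u,v))) (z (snd (u,v))) < - R)" by simp
  also have "\<dots> \<le> low_ip_count z"
    unfolding low_ip_count_def using assms by (intro member_le_sum) (auto simp: offd_def)
  finally show False using assms(1) by simp
qed

text \<open>Exponential Markov for the codegrees of negatively correlated pairs. The logarithm of
  the moment generating function is at most 2 s n \<tau>, the 2 stemming from exp t \<le> 1 + 2 t;
  cutting at 3 s n \<tau> leaves the gain exp (- s n \<tau>) that \<open>cod\<close> sets against
  n^2.\<close>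

definition codeg_excess where "codeg_excess z = (\<Sum>p\<in>offd n.
   of_bool (ip K (z (fst p)) (z (snd p)) \<le> - c * real (card K) / 2) *
   exp (s * codeg K c R n z (fst p) (snd p)) * exp (- (3 * s * real n * \<tau>)))"

lemma E_codeg_excess: "pp.E codeg_excess \<le> 1/8"
proof -
  have c1': "c \<le> 1" "0 \<le> c" using c1 c0 by auto
  let ?e = "exp (- (3 * s * real n * \<tau>))"
  let ?\<beta> = "1 + 2 * s * \<tau>"
  have s0: "0 \<le> s" by simp
  have "pp.E codeg_excess \<le> (exp (2 * s * \<tau> * real n) * ?e) * (real n)\<^sup>2"
    unfolding codeg_excess_def
  proof (rule E_offd_le[where f = "\<lambda>u v z. of_bool (ip K (z u) (z v) \<le> - c * real (card K) / 2) *
     exp (s * codeg K c R n z u v) * ?e"])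
    fix u v assume uv: "u < n" "v < n" "u \<noteq> v"
    let ?X = "{..<n} - {u, v}"
    \<comment> \<open>The value 1 for larger inner products makes the bound \<open>?\<beta>\<close>
      valid for all positions of \<open>u\<close> and \<open>v\<close>.\<close>
    let ?h = "\<lambda>p q b. if ip K p q \<le> - c * real (card K) / 2 then exp (s * (Wk K c R p b * Wk K c R q b)) else 1"
    have "pp.E (\<lambda>z. of_bool (ip K (z u) (z v) \<le> - c * real (card K) / 2) * exp (s * codeg K c R n z u v) * ?e)
       \<le> pp.E (\<lambda>z. ?e * (\<Prod>a\<in>?X. ?h (z u) (z v) (z a)))"
    proof (rule pp.E_mono)
      fix z
      show "of_bool (ip K (z u) (z v) \<le> - c * real (card K) / 2) * exp (s * codeg K c R n z u v) * ?e
        \<le> ?e * (\<Prod>a\<in>?X. ?h (z u) (z v) (z a))"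
        by (simp add: codeg_def sum_distrib_left exp_sum)
    qed
    also have "\<dots> = ?e * pp.E (\<lambda>z. \<Prod>a\<in>?X. ?h (z u) (z v) (z a))" by (rule pp.E_cmult)
    also have "pp.E (\<lambda>z. \<Prod>a\<in>?X. ?h (z u) (z v) (z a)) \<le> ?\<beta> ^ card ?X"
    proof (rule pp.E_prod_triples_le)
      fix p q
      have "avg K (?h p q) \<le> ?\<beta>"
      proof (cases "ip K p q \<le> - c * real (card K) / 2")
        case True
        have "avg K (\<lambda>b. exp (s * (Wk K c R p b * Wk K c R q b))) \<le> 1 + 2 * s * \<tau>"
          by (rule avg_exp_Wk_le[OF finK c1'(2,1) s0 _ True]) simp
        then show ?thesis using True by simp
      next
        case False
        then show ?thesis using finK by simp
      qed
      then show "(\<Sum>b\<in>Pow K. 1 / 2 ^ card K * ?h p q b) \<le> ?\<beta>" by (simp only: avg_alt)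
    qed (use uv in auto)
    also have "?\<beta> ^ card ?X \<le> exp (2 * s * \<tau> * real n)"
    proof -
      have "?\<beta> ^ card ?X \<le> ?\<beta> ^ n"
        by (intro power_increasing) (auto intro: order_trans[OF card_Diff_subset_Int[THEN eq_refl]] simp: card_Diff_insert)
      also have "\<dots> \<le> exp (2 * s * \<tau>) ^ n" by (intro power_mono exp_ge_add_one_self) auto
      also have "\<dots> = exp (2 * s * \<tau> * real n)" by (simp add: mult.commute flip: exp_of_nat_mult)
      finally show ?thesis .
    qed
    finally show "pp.E (\<lambda>z. of_bool (ip K (z u) (z v) \<le> - c * real (card K) / 2) * exp (s * codeg K c R n z u v) * ?e)
       \<le> exp (2 * s * \<tau> * real n) * ?e" by (simp add: mult.commute)
  qed simp
  also have "exp (2 * s * \<tau> * real n) * ?e = exp (- (real n * \<tau> / (exp (c * R))\<^sup>2))"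
    by (simp flip: exp_add)
  finally show ?thesis using cod by (simp add: mult_ac)
qed

lemma exp_tilt_less:
  fixes s' a b t :: real
  assumes "0 < s'" "exp (s' * a) * exp (- (3 * s' * b * t)) < 1"
  shows "a \<le> 3 * b * t"
proof -
  have "exp (s' * (a - 3 * b * t)) < exp 0"
    using assms(2) by (simp add: algebra_simps flip: exp_add)
  then have "s' * (a - 3 * b * t) < 0" by (simp only: exp_less_cancel_iff)
  then show ?thesis using assms(1) by (simp add: mult_less_0_iff)
qed

lemma codeg_excess_codeg:
  assumes "codeg_excess z < 1" "u < n" "v < n" "u \<noteq> v" "ip K (z u) (z v) \<le> - c * real (card K) / 2"
  shows "codeg K c R n z u v \<le> 3 * real n * \<tau>"
proof -
  let ?f = "\<lambda>p. of_bool (ip K (z (fst p)) (z (snd p)) \<le> - c * real (card K) / 2) *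
     exp (s * codeg K c R n z (fst p) (snd p)) * exp (- (3 * s * real n * \<tau>))"
  have "?f (u, v) \<le> codeg_excess z"
    unfolding codeg_excess_def using assms by (intro member_le_sum) (auto simp: offd_def)
  moreover have "?f (u, v) = exp (s * codeg K c R n z u v) * exp (- (3 * s * real n * \<tau>))"
    using assms(5) by simp
  ultimately have "exp (s * codeg K c R n z u v) * exp (- (3 * s * real n * \<tau>)) < 1"
    using assms(1) by linarith
  then show ?thesis by (rule exp_tilt_less[rotated]) simp
qed

theorem exists_sample:
  obtains z where "cube_sample K d c n r0 z"
    "\<And>v. v < n \<Longrightarrow> z v \<subseteq> K"
    "\<And>c'. c' \<in> {c, c/2} \<Longrightarrow> (\<Sum>p\<in>offd n. (wk K c' (z (fst p)) (z (snd p)) - wd K d c' (z (fst p)) (z (snd p)))\<^sup>2) \<le> (32 * \<eta>0) * (real n)\<^sup>2"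
    "\<And>c'. c' \<in> {c, c/2} \<Longrightarrow> (\<Sum>p\<in>offd n. (wk K c' (z (fst p)) (z (snd p)))\<^sup>2) \<le> (32 * \<kappa>0) * (real n)\<^sup>2"
    "\<And>u v. u < n \<Longrightarrow> v < n \<Longrightarrow> u \<noteq> v \<Longrightarrow> - R \<le> ip K (z u) (z v)"
    "\<And>u v. u < n \<Longrightarrow> v < n \<Longrightarrow> u \<noteq> v \<Longrightarrow> ip K (z u) (z v) \<le> - c * real (card K) / 2 \<Longrightarrow> codeg K c R n z u v \<le> 3 * real n * \<tau>"
proof -
  have "pp.E (\<lambda>z. gram_excess z + (bad_count z + (norm_excess z + (low_ip_count z + codeg_excess z)))) < 1"
    unfolding pp.E_add using E_gram_excess E_bad_count E_norm_excess E_low_ip_count E_codeg_excess by simp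
  then obtain z where z: "z \<in> pp.\<Omega>" and X: "gram_excess z + (bad_count z + (norm_excess z + (low_ip_count z + codeg_excess z))) < 1"
    using pp.E_less_exists by blast
  have nn: "0 \<le> gram_excess z" "0 \<le> bad_count z" "0 \<le> norm_excess z" "0 \<le> low_ip_count z" "0 \<le> codeg_excess z"
    unfolding gram_excess_def bad_count_def norm_excess_def low_ip_count_def codeg_excess_def err2_def nrm2_def using eta0 kap0
    by (auto intro!: sum_nonneg prod_nonneg mult_nonneg_nonneg add_nonneg_nonneg divide_nonneg_nonneg simp: case_prod_unfold simp del: prod.lessThan_Suc)
  then have lt: "gram_excess z < 1" "bad_count z < 1" "norm_excess z < 1" "low_ip_count z < 1" "codeg_excess z < 1" using X by linarith+
  show thesis
  proof (rule that[of z])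
    show "cube_sample K d c n r0 z"
    proof
      show "finite K" "0 < c" "c \<le> 1/20" "1 \<le> n" using finK c0 c1 n3 by auto
      show "\<bar>\<Sum>v<n. chi (z v) S * chi (z v) T\<bar> \<le> real n / real N" if "S \<in> low K d" "T \<in> low K d" "S \<noteq> T" for S T
        using gram_excess_gram[OF lt(1) that] .
    qed (rule bad_count_few[OF lt(2)])
    show "z v \<subseteq> K" if "v < n" for v using z that by auto
    fix c' assume c': "c' \<in> {c, c/2}"
    show "(\<Sum>p\<in>offd n. (wk K c' (z (fst p)) (z (snd p)) - wd K d c' (z (fst p)) (z (snd p)))\<^sup>2) \<le> (32 * \<eta>0) * (real n)\<^sup>2"
      using norm_excess_bounds(1)[OF lt(3) c'] by (simp add: err2_def)
    show "(\<Sum>p\<in>offd n. (wk K c' (z (fst p)) (z (snd p)))\<^sup>2) \<le> (32 * \<kappa>0) * (real n)\<^sup>2"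
      using norm_excess_bounds(2)[OF lt(3) c'] by (simp add: nrm2_def)
  next
    fix u v assume "u < n" "v < n" "u \<noteq> v"
    then show "- R \<le> ip K (z u) (z v)" by (rule low_ip_count_ip[OF lt(4)])
    assume "ip K (z u) (z v) \<le> - c * real (card K) / 2"
    with \<open>u < n\<close> \<open>v < n\<close> \<open>u \<noteq> v\<close> show "codeg K c R n z u v \<le> 3 * real n * \<tau>" by (rule codeg_excess_codeg[OF lt(5)])
  qed
qed

end

context prod_prob
begin

lemma E_pull_single:
  assumes i: "i \<in> A" and "\<And>z b. z \<in> \<Omega> \<Longrightarrow> b \<in> B \<Longrightarrow> \<Phi> (z(i := b)) = \<Phi> z"
  shows "E (\<lambda>z. \<Phi> z * h (z i)) = (\<Sum>b\<in>B. \<mu> i b * h b) * E \<Phi>"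
proof -
  have "E (\<lambda>z. \<Phi> z * h (z i)) = E (\<lambda>z. \<Sum>b\<in>B. \<mu> i b * (\<Phi> (z(i := b)) * h b))"
    by (subst E_resample[OF i]) simp
  also have "\<dots> = E (\<lambda>z. (\<Sum>b\<in>B. \<mu> i b * h b) * \<Phi> z)"
    by (intro E_cong) (simp add: assms(2) sum_distrib_left sum_distrib_right mult_ac)
  finally show ?thesis by (simp add: E_cmult)
qed

text \<open>All coordinates involved are distinct, so the factors are independent and the bound of
  \<open>E_prod_pairs_le\<close> becomes an identity.\<close>

lemma E_prod_pairs:
  assumes "finite J" "\<And>j. j \<in> J \<Longrightarrow> u j \<in> A" "\<And>j. j \<in> J \<Longrightarrow> v j \<in> A"
    and "inj_on u J" "inj_on v J" and "\<And>j j'. j \<in> J \<Longrightarrow> j' \<in> J \<Longrightarrow> u j \<noteq> v j'"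
  shows "E (\<lambda>z. \<Prod>j\<in>J. h j (z (u j)) (z (v j))) = (\<Prod>j\<in>J. \<Sum>a\<in>B. \<Sum>b\<in>B. \<mu> (u j) a * \<mu> (v j) b * h j a b)"
  using assms
proof (induction J rule: finite_induct)
  case empty
  then show ?case by (simp add: E_const)
next
  case (insert j J)
  let ?\<Phi> = "\<lambda>z. \<Prod>j\<in>J. h j (z (u j)) (z (v j))"
  have IH: "E ?\<Phi> = (\<Prod>j\<in>J. \<Sum>a\<in>B. \<Sum>b\<in>B. \<mu> (u j) a * \<mu> (v j) b * h j a b)"
    using insert.prems by (intro insert.IH) auto
  have uv: "u j \<in> A" "v j \<in> A" "u j \<noteq> v j" using insert.prems by auto
  have inv: "?\<Phi> (z(v j := b)) = ?\<Phi> z" "?\<Phi> (z(u j := b)) = ?\<Phi> z" for z b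
  proof -
    have ne: "u l \<noteq> v j" "v l \<noteq> v j" "u l \<noteq> u j" "v l \<noteq> u j" if "l \<in> J" for l
      using insert.prems insert.hyps that by (auto simp: inj_on_def) metis+
    show "?\<Phi> (z(v j := b)) = ?\<Phi> z" by (intro prod.cong refl) (use ne in auto)
    show "?\<Phi> (z(u j := b)) = ?\<Phi> z" by (intro prod.cong refl) (use ne in auto)
  qed
  have "E (\<lambda>z. \<Prod>j\<in>insert j J. h j (z (u j)) (z (v j))) = E (\<lambda>z. ?\<Phi> z * h j (z (u j)) (z (v j)))"
    using insert.hyps by (simp add: mult.commute)
  also have "\<dots> = E (\<lambda>z. \<Sum>b\<in>B. \<mu> (v j) b * (?\<Phi> (z(v j := b)) * h j (z (u j)) b))"
    by (subst E_resample[OF uv(2)]) (use uv(3) in simp)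
  also have "\<dots> = E (\<lambda>z. \<Sum>b\<in>B. \<mu> (v j) b * (?\<Phi> z * h j (z (u j)) b))"
    by (simp only: inv(1))
  also have "\<dots> = E (\<lambda>z. ?\<Phi> z * (\<lambda>a. \<Sum>b\<in>B. \<mu> (v j) b * h j a b) (z (u j)))"
    by (simp add: sum_distrib_left mult_ac)
  also have "\<dots> = (\<Sum>a\<in>B. \<mu> (u j) a * (\<Sum>b\<in>B. \<mu> (v j) b * h j a b)) * E ?\<Phi>"
    by (rule E_pull_single[OF uv(1)]) (rule inv(2))
  finally show ?case using insert.hyps IH by (simp add: sum_distrib_left mult.assoc)
qed

end

subsection \<open>Random edges and deletion of triangles\<close>

text \<open>For a largest disjoint subfamily, every set meets the union of the selected ones. That
  union has at most \<open>4 * card R\<close> points, and each point lies in at most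
  \<open>k\<close> sets.\<close>

lemma exists_disjoint_subfamily:
  assumes P: "finite P" and C: "\<And>\<pi>. \<pi> \<in> P \<Longrightarrow> finite (C \<pi>) \<and> C \<pi> \<noteq> {} \<and> card (C \<pi>) \<le> 4"
    and K: "\<And>g. card {\<pi> \<in> P. g \<in> C \<pi>} \<le> k"
  obtains R where "R \<subseteq> P" "\<And>\<pi> \<pi>'. \<pi> \<in> R \<Longrightarrow> \<pi>' \<in> R \<Longrightarrow> \<pi> \<noteq> \<pi>' \<Longrightarrow> C \<pi> \<inter> C \<pi>' = {}"
    "card P \<le> 4 * k * card R"
proof -
  let ?dis = "\<lambda>R. \<forall>\<pi>\<in>R. \<forall>\<pi>'\<in>R. \<pi> \<noteq> \<pi>' \<longrightarrow> C \<pi> \<inter> C \<pi>' = {}"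
  let ?F = "{R. R \<subseteq> P \<and> ?dis R}"
  have finF: "finite ?F" using P by simp
  have neF: "{} \<in> ?F" by simp
  have "Max (card ` ?F) \<in> card ` ?F" using finF neF by (intro Max_in finite_imageI) blast+
  then obtain R where R: "R \<in> ?F" and Rmax: "Max (card ` ?F) = card R" by (rule imageE)
  have max: "card S \<le> card R" if "S \<in> ?F" for S
    unfolding Rmax[symmetric] using finF that by (intro Max_ge finite_imageI imageI)
  have finR: "finite R" using R P finite_subset by auto
  let ?G = "\<Union>\<pi>\<in>R. C \<pi>"
  have finG: "finite ?G" using R C finR by auto
  have "P \<subseteq> (\<Union>g\<in>?G. {\<pi> \<in> P. g \<in> C \<pi>})"
  proof
    fix \<pi> assume \<pi>: "\<pi> \<in> P"
    have "C \<pi> \<inter> ?G \<noteq> {}"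
    proof (cases "\<pi> \<in> R")
      case True
      then show ?thesis using C[OF \<pi>] by auto
    next
      case False
      show ?thesis
      proof
        assume e: "C \<pi> \<inter> ?G = {}"
        then have "insert \<pi> R \<in> ?F" using R \<pi> by auto
        then have "card (insert \<pi> R) \<le> card R" by (rule max)
        then show False using False finR by simp
      qed
    qed
    then show "\<pi> \<in> (\<Union>g\<in>?G. {\<pi> \<in> P. g \<in> C \<pi>})" using \<pi> by auto
  qed
  then have "card P \<le> card (\<Union>g\<in>?G. {\<pi> \<in> P. g \<in> C \<pi>})"
    by (intro card_mono finite_UN_I[OF finG]) (use P in auto)
  also have "\<dots> \<le> (\<Sum>g\<in>?G. card {\<pi> \<in> P. g \<in> C \<pi>})" by (rule card_UN_le[OF finG])
  also have "\<dots> \<le> card ?G * k" using sum_bounded_above[of ?G "\<lambda>g. card {\<pi> \<in> P. g \<in> C \<pi>}" k] K by simp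
  finally have 1: "card P \<le> card ?G * k" .
  have "card ?G \<le> (\<Sum>\<pi>\<in>R. card (C \<pi>))" by (rule card_UN_le[OF finR])
  also have "\<dots> \<le> card R * 4"
  proof -
    have "card (C \<pi>) \<le> 4" if "\<pi> \<in> R" for \<pi> using that R C by auto
    then show ?thesis using sum_bounded_above[of R "\<lambda>\<pi>. card (C \<pi>)" 4] by simp
  qed
  finally have 2: "card ?G * k \<le> card R * 4 * k" by (rule mult_right_mono) simp
  have "card P \<le> 4 * k * card R" using order_trans[OF 1 2] by (simp only: mult_ac)
  then show thesis using that R by auto
qed

text \<open>Normal form of an unordered pair: the coordinates of the edge measure are indexed by
  pairs with the smaller entry first.\<close>

definition ed :: "nat \<Rightarrow> nat \<Rightarrow> nat \<times> nat" where
  "ed u v = (min u v, max u v)"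

lemma ed_commute: "ed u v = ed v u"
  by (simp add: ed_def min.commute max.commute)

lemma ed_eq_iff: "ed u v = ed a b \<longleftrightarrow> (u = a \<and> v = b) \<or> (u = b \<and> v = a)"
  by (auto simp: ed_def min_def max_def split: if_splits)

definition upairs :: "nat \<Rightarrow> (nat \<times> nat) set" where
  "upairs m = {p \<in> {..<m} \<times> {..<m}. fst p < snd p}"

lemma finite_upairs [simp]: "finite (upairs m)"
  by (simp add: upairs_def)

lemma sum_offd_upairs:
  fixes h :: "nat \<Rightarrow> nat \<Rightarrow> real"
  assumes "\<And>i j. h i j = h j i"
  shows "(\<Sum>p\<in>offd m. h (fst p) (snd p)) = 2 * (\<Sum>p\<in>upairs m. h (fst p) (snd p))"
proof -
  have "offd m = upairs m \<union> prod.swap ` upairs m"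
    by (auto simp: offd_def upairs_def image_iff)
  moreover have "upairs m \<inter> prod.swap ` upairs m = {}"
    by (auto simp: upairs_def)
  ultimately have "(\<Sum>p\<in>offd m. h (fst p) (snd p)) = (\<Sum>p\<in>upairs m. h (fst p) (snd p)) + (\<Sum>p\<in>prod.swap ` upairs m. h (fst p) (snd p))"
    by (simp add: sum.union_disjoint)
  also have "(\<Sum>p\<in>prod.swap ` upairs m. h (fst p) (snd p)) = (\<Sum>p\<in>upairs m. h (fst p) (snd p))"
    by (subst sum.reindex) (auto intro!: sum.cong simp: assms)
  finally show ?thesis by simp
qed

text \<open>\<open>\<zeta>\<close> bounds the expected codegree of a pair that can be an edge,
  \<open>\<mu>0\<close> bounds from below the expected number of index pairs kept on both sides, and
  \<open>Dg\<close> will cap the actual codegrees. \<open>n1\<close> pays for that cap over all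
  vertex pairs, \<open>n2\<close> and \<open>n3\<close> for the union over all matched
  families.\<close>

locale edge_sample =
  fixes n m Dg :: nat and W :: "nat \<Rightarrow> nat \<Rightarrow> real" and p0 \<zeta> \<mu>0 :: real
  assumes W_sym: "\<And>u v. W u v = W v u" and W_nonneg: "\<And>u v. 0 \<le> W u v"
    and p0: "0 \<le> p0" and pW: "\<And>u v. u < n \<Longrightarrow> v < n \<Longrightarrow> u \<noteq> v \<Longrightarrow> p0 * W u v \<le> 1"
    and zeta0: "0 < \<zeta>"
    and cod: "\<And>u v. u < n \<Longrightarrow> v < n \<Longrightarrow> u \<noteq> v \<Longrightarrow> 0 < W u v \<Longrightarrow>
      (\<Sum>a\<in>{..<n} - {u, v}. (p0 * W u a) * (p0 * W v a)) \<le> \<zeta>"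
    and mass: "\<And>x y. matched n m x y \<Longrightarrow>
      2 * \<mu>0 \<le> (\<Sum>p\<in>offd m. (p0 * W (x (fst p)) (x (snd p))) * (p0 * W (y (fst p)) (y (snd p))))"
    and zD: "288 * (real Dg + 1) * \<zeta> \<le> 1"
    and n1: "4 * (real n)\<^sup>2 * (3 * \<zeta> ^ Dg) \<le> 1"
    and n2: "4 * real n ^ (2 * m) * exp (- (\<mu>0 / 8)) \<le> 1"
    and n3: "4 * real n ^ (2 * m) * exp (- (\<mu>0 / (16 * (real Dg + 1)))) \<le> 1"
begin

text \<open>Pairs of weight 0 carry no coordinate, so the codegree bound \<open>cod\<close> is
  available for every member of \<open>U\<close>.\<close>

definition U where "U = {e \<in> upairs n. 0 < W (fst e) (snd e)}"
definition pr where "pr e = p0 * W (fst e) (snd e)"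

lemma finU: "finite U" by (simp add: U_def)

lemma pr_ed: "pr (ed u v) = p0 * W u v"
  using W_sym by (cases "u \<le> v") (auto simp: pr_def ed_def min_def max_def)

lemma pr_nonneg: "0 \<le> pr e"
  using p0 W_nonneg by (simp add: pr_def)

lemma pr_le1: "e \<in> U \<Longrightarrow> pr e \<le> 1"
  unfolding pr_def by (intro pW) (auto simp: U_def upairs_def)

lemma ed_in_U: "ed u v \<in> U \<longleftrightarrow> u < n \<and> v < n \<and> u \<noteq> v \<and> 0 < W u v"
  using W_sym[of u v] by (auto simp: U_def upairs_def ed_def min_def max_def)

sublocale pp: prod_prob U "UNIV :: bool set" "\<lambda>e b. if b then pr e else 1 - pr e"
  by unfold_locales (use finU pr_nonneg pr_le1 in \<open>auto simp: UNIV_bool\<close>)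

definition adj where "adj z u v \<longleftrightarrow> ed u v \<in> U \<and> z (ed u v)"

lemma adj_commute: "adj z u v = adj z v u"
  by (simp add: adj_def ed_commute)

lemma adj_less: "adj z u v \<Longrightarrow> u < n \<and> v < n \<and> u \<noteq> v"
  by (simp add: adj_def ed_in_U)

definition cn where "cn z u v = {a. adj z u a \<and> adj z v a}"

lemma finite_cn: "finite (cn z u v)"
  by (rule finite_subset[of _ "{..<n}"]) (auto simp: cn_def dest: adj_less)

definition codeg_count :: "((nat \<times> nat) \<Rightarrow> bool) \<Rightarrow> real" where
  "codeg_count z = (\<Sum>p\<in>offd n. of_bool (ed (fst p) (snd p) \<in> U \<and> Dg \<le> card (cn z (fst p) (snd p))))"

lemma sum_bool_two:
  "(\<Sum>a\<in>UNIV. \<Sum>b\<in>UNIV. (if a then P else 1 - P) * (if b then Q else 1 - Q) * (if a \<and> b then t else 1)) = 1 + (t - 1) * (P * Q :: real)"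
  by (simp add: UNIV_bool algebra_simps)

text \<open>Exponential Markov with base 1 / \<zeta>: as the expected codegree is at most \<zeta>,
  the mean of this base to the power of the codegree is at most exp 1 \<le> 3. Edges at
  \<open>u\<close> and edges at \<open>v\<close> are distinct, so the factors are
  independent.\<close>

lemma E_cn:
  assumes "u < n" "v < n" "u \<noteq> v" "ed u v \<in> U"
  shows "pp.E (\<lambda>z. of_bool (Dg \<le> card (cn z u v))) \<le> 3 * \<zeta> ^ Dg"
proof -
  let ?C = "{a. a < n \<and> ed u a \<in> U \<and> ed v a \<in> U}"
  let ?t = "1 / \<zeta>"
  have "288 * \<zeta> \<le> 288 * (real Dg + 1) * \<zeta>" using zeta0 by simp
  then have z1: "\<zeta> \<le> 1" using zD by linarith
  then have t1: "1 \<le> ?t" using zeta0 by simp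
  have uv: "a \<noteq> u" "a \<noteq> v" if "a \<in> ?C" for a using that by (auto simp: ed_in_U)
  have pow: "?t ^ card (cn z u v) = (\<Prod>a\<in>?C. if z (ed u a) \<and> z (ed v a) then ?t else 1)" for z
  proof -
    have "cn z u v = {a \<in> ?C. z (ed u a) \<and> z (ed v a)}"
      by (auto simp: cn_def adj_def ed_in_U)
    then show ?thesis by (simp add: prod.If_cases Int_def)
  qed
  have "pp.E (\<lambda>z. of_bool (Dg \<le> card (cn z u v))) \<le> pp.E (\<lambda>z. \<zeta> ^ Dg * ?t ^ card (cn z u v))"
  proof (rule pp.E_mono)
    fix z
    show "of_bool (Dg \<le> card (cn z u v)) \<le> \<zeta> ^ Dg * ?t ^ card (cn z u v)"
    proof (cases "Dg \<le> card (cn z u v)")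
      case True
      have "\<zeta> ^ Dg * ?t ^ Dg \<le> \<zeta> ^ Dg * ?t ^ card (cn z u v)"
        using True t1 zeta0 by (intro mult_left_mono power_increasing) auto
      moreover have "\<zeta> ^ Dg * ?t ^ Dg = 1" using zeta0 by (simp flip: power_mult_distrib)
      ultimately show ?thesis by simp
    qed (use zeta0 in simp)
  qed
  also have "\<dots> = \<zeta> ^ Dg * pp.E (\<lambda>z. \<Prod>a\<in>?C. if z (ed u a) \<and> z (ed v a) then ?t else 1)"
    by (simp add: pp.E_cmult pow)
  also have "pp.E (\<lambda>z. \<Prod>a\<in>?C. if z (ed u a) \<and> z (ed v a) then ?t else 1)
     = (\<Prod>a\<in>?C. 1 + (?t - 1) * (pr (ed u a) * pr (ed v a)))"
  proof -
    have "pp.E (\<lambda>z. \<Prod>a\<in>?C. (\<lambda>j a b. if a \<and> b then ?t else 1) a (z (ed u a)) (z (ed v a)))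
       = (\<Prod>a\<in>?C. \<Sum>s\<in>UNIV. \<Sum>b\<in>UNIV. (if s then pr (ed u a) else 1 - pr (ed u a)) *
          (if b then pr (ed v a) else 1 - pr (ed v a)) * (\<lambda>j a b. if a \<and> b then ?t else 1) a s b)"
    proof (rule pp.E_prod_pairs)
      show "ed u j \<noteq> ed v j'" if "j \<in> ?C" "j' \<in> ?C" for j j'
        using uv[OF that(1)] uv[OF that(2)] assms(3) by (auto simp: ed_eq_iff)
    qed (auto simp: inj_on_def ed_eq_iff)
    then show ?thesis by (simp only: sum_bool_two)
  qed
  also have "\<dots> \<le> (\<Prod>a\<in>?C. exp (?t * (pr (ed u a) * pr (ed v a))))"
  proof (intro prod_mono conjI)
    fix a
    have pp: "0 \<le> pr (ed u a) * pr (ed v a)" using pr_nonneg by simp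
    then show "0 \<le> 1 + (?t - 1) * (pr (ed u a) * pr (ed v a))" using t1 by simp
    have "1 + (?t - 1) * (pr (ed u a) * pr (ed v a)) \<le> 1 + ?t * (pr (ed u a) * pr (ed v a))"
      using pp by (intro add_left_mono mult_right_mono) auto
    also have "\<dots> \<le> exp (?t * (pr (ed u a) * pr (ed v a)))" by (rule exp_ge_add_one_self)
    finally show "1 + (?t - 1) * (pr (ed u a) * pr (ed v a)) \<le> exp (?t * (pr (ed u a) * pr (ed v a)))" .
  qed
  also have "\<dots> = exp (?t * (\<Sum>a\<in>?C. pr (ed u a) * pr (ed v a)))"
    by (simp add: exp_sum sum_distrib_left)
  also have "\<dots> \<le> exp 1"
  proof -
    have "(\<Sum>a\<in>?C. pr (ed u a) * pr (ed v a)) \<le> (\<Sum>a\<in>{..<n} - {u, v}. pr (ed u a) * pr (ed v a))"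
      using uv pr_nonneg by (intro sum_mono2) auto
    also have "\<dots> \<le> \<zeta>"
      unfolding pr_ed using assms by (intro cod) (auto simp: ed_in_U)
    finally show ?thesis using zeta0 by simp
  qed
  also have "exp 1 \<le> (3::real)" by (rule exp_le)
  finally show ?thesis using zeta0 by (simp add: mult.commute)
qed

lemma E_codeg_count: "pp.E codeg_count \<le> 1/4"
proof -
  have "pp.E codeg_count = (\<Sum>p\<in>offd n. pp.E (\<lambda>z. of_bool (ed (fst p) (snd p) \<in> U \<and> Dg \<le> card (cn z (fst p) (snd p)))))"
    unfolding codeg_count_def by (rule pp.E_sum)
  also have "\<dots> \<le> (\<Sum>p\<in>offd n. 3 * \<zeta> ^ Dg)"
  proof (intro sum_mono)
    fix p assume p: "p \<in> offd n"
    show "pp.E (\<lambda>z. of_bool (ed (fst p) (snd p) \<in> U \<and> Dg \<le> card (cn z (fst p) (snd p)))) \<le> 3 * \<zeta> ^ Dg"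
    proof (cases "ed (fst p) (snd p) \<in> U")
      case True
      then show ?thesis using p E_cn[of "fst p" "snd p"] by (auto simp: offd_def)
    next
      case False
      then show ?thesis using zeta0 by (simp add: pp.E_const)
    qed
  qed
  also have "\<dots> = real (card (offd n)) * (3 * \<zeta> ^ Dg)" by simp
  also have "\<dots> \<le> (real n)\<^sup>2 * (3 * \<zeta> ^ Dg)"
  proof (intro mult_right_mono)
    have "card (offd n) \<le> card ({..<n} \<times> {..<n})" by (intro card_mono) (auto simp: offd_def)
    then show "real (card (offd n)) \<le> (real n)\<^sup>2"
      by (simp add: power2_eq_square card_cartesian_product flip: of_nat_mult)
  qed (use zeta0 in simp)
  finally show ?thesis using n1 by simp
qed

definition ex where "ex x p = ed (x (fst p)) (x (snd p))"
text \<open>Expected size of \<open>PH x y\<close>, that is, before triangles are deleted.\<close>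

definition mu where "mu x y = (\<Sum>p\<in>upairs m. pr (ex x p) * pr (ex y p))"
definition PH where "PH x y z = {p \<in> upairs m. adj z (x (fst p)) (x (snd p)) \<and> adj z (y (fst p)) (y (snd p))}"

lemma mu_ge:
  assumes "matched n m x y" shows "\<mu>0 \<le> mu x y"
proof -
  have "2 * \<mu>0 \<le> (\<Sum>p\<in>offd m. (p0 * W (x (fst p)) (x (snd p))) * (p0 * W (y (fst p)) (y (snd p))))"
    by (rule mass[OF assms])
  also have "\<dots> = 2 * mu x y"
    unfolding mu_def ex_def pr_ed
    by (rule sum_offd_upairs[where h = "\<lambda>i j. (p0 * W (x i) (x j)) * (p0 * W (y i) (y j))"])
      (metis W_sym)
  finally show ?thesis by simp
qed

lemma mu_nonneg: "0 \<le> mu x y"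
  unfolding mu_def by (intro sum_nonneg mult_nonneg_nonneg pr_nonneg)

text \<open>This distinctness makes the edge indicators of all index pairs, on both sides,
  independent.\<close>

lemma matched_ex:
  assumes "matched n m x y"
  shows "inj_on (ex x) (upairs m)" "inj_on (ex y) (upairs m)"
    "\<And>p p'. p \<in> upairs m \<Longrightarrow> p' \<in> upairs m \<Longrightarrow> ex x p \<noteq> ex y p'"
proof -
  have *: "inj_on (ex w) (upairs m)" if "inj_on w {..<m}" for w
  proof (rule inj_onI)
    fix p p' assume "p \<in> upairs m" "p' \<in> upairs m" "ex w p = ex w p'"
    then have "fst p < m" "snd p < m" "fst p < snd p" "fst p' < m" "snd p' < m" "fst p' < snd p'"
      and "(w (fst p) = w (fst p') \<and> w (snd p) = w (snd p')) \<or> (w (fst p) = w (snd p') \<and> w (snd p) = w (fst p'))"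
      by (auto simp: upairs_def ex_def ed_eq_iff simp del: split_paired_All)
    then have "fst p = fst p' \<and> snd p = snd p'" using that
      by (metis inj_onD lessThan_iff less_asym)
    then show "p = p'" by (simp add: prod_eqI)
  qed
  show "inj_on (ex x) (upairs m)" "inj_on (ex y) (upairs m)"
    using assms by (auto simp: matched_def intro: *)
  show "ex x p \<noteq> ex y p'" if "p \<in> upairs m" "p' \<in> upairs m" for p p'
  proof -
    have "x i \<noteq> y j" if "i < m" "j < m" for i j using assms that by (auto simp: matched_def)
    then show ?thesis using that by (auto simp: upairs_def ex_def ed_eq_iff)
  qed
qed

lemma pr_zero: "ed u v \<notin> U \<Longrightarrow> u < n \<Longrightarrow> v < n \<Longrightarrow> u \<noteq> v \<Longrightarrow> pr (ed u v) = 0"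
  using W_nonneg[of u v] by (auto simp: ed_in_U pr_ed)

lemma matched_less:
  assumes "matched n m x y" "p \<in> upairs m"
  shows "x (fst p) < n" "x (snd p) < n" "x (fst p) \<noteq> x (snd p)" "y (fst p) < n" "y (snd p) < n" "y (fst p) \<noteq> y (snd p)"
proof -
  have "fst p < m" "snd p < m" "fst p \<noteq> snd p" using assms(2) by (auto simp: upairs_def)
  then show "x (fst p) < n" "x (snd p) < n" "x (fst p) \<noteq> x (snd p)" "y (fst p) < n" "y (snd p) < n" "y (fst p) \<noteq> y (snd p)"
    using assms(1) by (auto simp: matched_def inj_on_def)
qed

text \<open>Lower tail at half the mean, through the bound exp (- mu / 2) on the mean of (1/2) to
  the power of the count. With ln 2 \<le> 3/4 the exponent (ln 2 - 1) mu / 2 is at most - mu /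
  8.\<close>

lemma E_few_preserved:
  assumes mt: "matched n m x y"
  shows "pp.E (\<lambda>z. of_bool (real (card (PH x y z)) < mu x y / 2)) \<le> exp (- (\<mu>0 / 8))"
proof -
  let ?C = "{p \<in> upairs m. ex x p \<in> U \<and> ex y p \<in> U}"
  have subC: "?C \<subseteq> upairs m" by auto
  have pow: "(1/2) ^ card (PH x y z) = (\<Prod>p\<in>?C. if z (ex x p) \<and> z (ex y p) then 1/2 else 1::real)" for z
  proof -
    have "PH x y z = {p \<in> ?C. z (ex x p) \<and> z (ex y p)}"
      by (auto simp: PH_def adj_def ex_def)
    then show ?thesis by (simp add: prod.If_cases Int_def)
  qed
  have "pp.E (\<lambda>z. of_bool (real (card (PH x y z)) < mu x y / 2)) \<le> pp.E (\<lambda>z. exp (ln 2 * (mu x y / 2)) * (1/2) ^ card (PH x y z))"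
  proof (rule pp.E_mono)
    fix z
    show "of_bool (real (card (PH x y z)) < mu x y / 2) \<le> exp (ln 2 * (mu x y / 2)) * (1/2) ^ card (PH x y z)"
    proof (cases "real (card (PH x y z)) < mu x y / 2")
      case True
      have "(1/2) ^ card (PH x y z) = exp (- ln 2 * real (card (PH x y z)))"
        by (metis exp_ln exp_minus exp_of_nat2_mult inverse_eq_divide zero_less_numeral)
      moreover have "ln 2 * real (card (PH x y z)) \<le> ln 2 * (mu x y / 2)"
        using True by (intro mult_left_mono) auto
      ultimately show ?thesis using True by (simp flip: exp_add)
    qed simp
  qed
  also have "\<dots> = exp (ln 2 * (mu x y / 2)) * pp.E (\<lambda>z. \<Prod>p\<in>?C. if z (ex x p) \<and> z (ex y p) then 1/2 else 1)"
    by (simp add: pp.E_cmult pow)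
  also have "pp.E (\<lambda>z. \<Prod>p\<in>?C. if z (ex x p) \<and> z (ex y p) then 1/2 else 1)
     = (\<Prod>p\<in>?C. 1 + (1/2 - 1) * (pr (ex x p) * pr (ex y p)))"
  proof -
    have "pp.E (\<lambda>z. \<Prod>p\<in>?C. (\<lambda>j a b. if a \<and> b then 1/2 else 1) p (z (ex x p)) (z (ex y p)))
       = (\<Prod>p\<in>?C. \<Sum>s\<in>UNIV. \<Sum>b\<in>UNIV. (if s then pr (ex x p) else 1 - pr (ex x p)) *
          (if b then pr (ex y p) else 1 - pr (ex y p)) * (\<lambda>j a b. if a \<and> b then 1/2 else 1) p s b)"
    proof (rule pp.E_prod_pairs)
      show "inj_on (ex x) ?C" "inj_on (ex y) ?C"
        using matched_ex(1,2)[OF mt] subC inj_on_subset by blast+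
    qed (use matched_ex(3)[OF mt] in auto)
    then show ?thesis by (simp only: sum_bool_two)
  qed
  also have "\<dots> \<le> (\<Prod>p\<in>?C. exp (- (1/2) * (pr (ex x p) * pr (ex y p))))"
  proof (intro prod_mono conjI)
    fix p assume "p \<in> ?C"
    then have "pr (ex x p) * pr (ex y p) \<le> 1 * 1" using pr_nonneg pr_le1 by (intro mult_mono) auto
    then show "0 \<le> 1 + (1/2 - 1) * (pr (ex x p) * pr (ex y p))" by simp
    show "1 + (1/2 - 1) * (pr (ex x p) * pr (ex y p)) \<le> exp (- (1/2) * (pr (ex x p) * pr (ex y p)))"
      using exp_ge_add_one_self[of "- (1/2) * (pr (ex x p) * pr (ex y p))"] by simp
  qed
  also have "\<dots> = exp (- (1/2) * mu x y)"
  proof -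
    have "mu x y = (\<Sum>p\<in>?C. pr (ex x p) * pr (ex y p))"
      unfolding mu_def
    proof (rule sum.mono_neutral_right)
      show "\<forall>p\<in>upairs m - ?C. pr (ex x p) * pr (ex y p) = 0"
      proof
        fix p assume p: "p \<in> upairs m - ?C"
        then have pm: "p \<in> upairs m" by simp
        from p have "ex x p \<notin> U \<or> ex y p \<notin> U" by auto
        then have "pr (ex x p) = 0 \<or> pr (ex y p) = 0"
          unfolding ex_def using pr_zero matched_less[OF mt pm] by blast
        then show "pr (ex x p) * pr (ex y p) = 0" by auto
      qed
    qed auto
    then show ?thesis by (simp add: exp_sum[symmetric] sum_distrib_left sum_negf)
  qed
  finally have "pp.E (\<lambda>z. of_bool (real (card (PH x y z)) < mu x y / 2)) \<le> exp (ln 2 * (mu x y / 2) - mu x y / 2)"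
    by (simp flip: exp_add)
  also have "ln 2 * (mu x y / 2) - mu x y / 2 \<le> - (\<mu>0 / 8)"
  proof -
    have "ln 2 \<le> (3/4::real)"
    proof -
      have "2 \<le> exp (3/4::real)"
        using exp_lower_Taylor_quadratic[of "3/4::real"] by (simp add: power2_eq_square)
      then have "ln 2 \<le> ln (exp (3/4::real))" by (subst ln_le_cancel_iff) auto
      then show ?thesis by simp
    qed
    then have "ln 2 * (mu x y / 2) \<le> 3/4 * (mu x y / 2)" using mu_nonneg by (intro mult_right_mono) auto
    then show ?thesis using mu_ge[OF mt] by simp
  qed
  finally show ?thesis by simp
qed

end

section \<open>Bounding the number of pairs destroyed by triangles\<close>

context edge_sample
begin

text \<open>A witness \<open>w = (b, a)\<close> for a pair \<open>p\<close> certifies that deleting triangles destroys \<open>p\<close>: the vertex \<open>a\<close> forms a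
  triangle with the \<open>x\<close>-edge of \<open>p\<close> if \<open>b\<close> holds, and with its \<open>y\<close>-edge otherwise.\<close>

definition sd where "sd x y b = (if b then x else (y :: nat \<Rightarrow> nat))"

definition wedges where
  "wedges x y p w = {ed (sd x y (fst w) (fst p)) (snd w), ed (sd x y (fst w) (snd p)) (snd w)}"

definition wvalid where
  "wvalid x y p w \<longleftrightarrow> snd w < n \<and> snd w \<noteq> sd x y (fst w) (fst p) \<and> snd w \<noteq> sd x y (fst w) (snd p) \<and> wedges x y p w \<subseteq> U"

definition cfg where "cfg x y p w = {ex x p, ex y p} \<union> wedges x y p w"

definition Wit :: "(bool \<times> nat) set" where "Wit = UNIV \<times> {..<n}"

text \<open>Disjointness is required of the edge sets only; this already makes the presence of the
  configurations independent.\<close>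

definition goodfam where
  "goodfam x y R \<omega> \<longleftrightarrow> (\<forall>p\<in>R. wvalid x y p (\<omega> p) \<and> ex x p \<in> U \<and> ex y p \<in> U) \<and>
     (\<forall>p\<in>R. \<forall>p'\<in>R. p \<noteq> p' \<longrightarrow> cfg x y p (\<omega> p) \<inter> cfg x y p' (\<omega> p') = {})"

text \<open>Size reached by a disjoint family if every sampled pair is destroyed: there are at least
  mu / 2 of them, each edge lies in at most 2 Dg + 1 configurations, and each configuration has at
  most 4 edges, so a packing has at least mu / (8 (2 Dg + 1)) members.\<close>

definition rr where "rr x y = nat \<lceil>mu x y / (16 * (real Dg + 1))\<rceil>"

lemma rr_ge: "mu x y / (16 * (real Dg + 1)) \<le> real (rr x y)"
  unfolding rr_def by (rule real_nat_ceiling_ge)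

text \<open>Destroyed pairs are dependent, so their number has no direct exponential tail bound.
  Counting edge-disjoint families instead gives an expectation of product form.\<close>

definition spoiled_count :: "(nat \<Rightarrow> nat) \<Rightarrow> (nat \<Rightarrow> nat) \<Rightarrow> (nat \<times> nat \<Rightarrow> bool) \<Rightarrow> real" where
  "spoiled_count x y z = (\<Sum>R\<in>{R\<in>Pow (upairs m). rr x y \<le> card R}. \<Sum>\<omega>\<in>PiE R (\<lambda>_. Wit).
     of_bool (goodfam x y R \<omega>) * (\<Prod>e\<in>(\<Union>p\<in>R. cfg x y p (\<omega> p)). of_bool (z e)))"

lemma finWit: "finite Wit" by (simp add: Wit_def)

lemma E_all_true:
  assumes "F \<subseteq> U"
  shows "pp.E (\<lambda>z. \<Prod>e\<in>F. of_bool (z e)) = (\<Prod>e\<in>F. pr e)"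
proof -
  have "pp.E (\<lambda>z. \<Prod>e\<in>F. of_bool (z e)) = pp.E (\<lambda>z. \<Prod>e\<in>U. (\<lambda>e b. if e \<in> F then of_bool b else 1) e (z e))"
    using assms finU by (intro pp.E_cong) (simp add: prod.If_cases Int_absorb1)
  also have "\<dots> = (\<Prod>e\<in>U. if e \<in> F then pr e else 1)"
    by (subst pp.E_prod) (auto simp: UNIV_bool intro!: prod.cong)
  also have "\<dots> = (\<Prod>e\<in>F. pr e)"
    using assms finU by (simp add: prod.If_cases Int_absorb1)
  finally show ?thesis .
qed

lemma matched_sd:
  assumes "matched n m x y"
  shows "inj_on (sd x y b) {..<m}" "\<And>i. i < m \<Longrightarrow> sd x y b i < n"
    "\<And>i j b'. i < m \<Longrightarrow> j < m \<Longrightarrow> b \<noteq> b' \<Longrightarrow> sd x y b i \<noteq> sd x y b' j"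
  using assms by (auto simp: matched_def sd_def)

text \<open>The four edges are distinct: compared with the matched edge of its own side, a wedge
  edge contains the additional vertex \<open>snd w\<close>; compared with that of the other side, it
  contains a vertex of the opposite family.\<close>

lemma prod_cfg:
  assumes mt: "matched n m x y" and p: "p \<in> upairs m" and v: "wvalid x y p w"
  shows "(\<Prod>e\<in>cfg x y p w. pr e) = pr (ex x p) * pr (ex y p) * (\<Prod>e\<in>wedges x y p w. pr e)"
    and "(\<Prod>e\<in>wedges x y p w. pr e) = pr (ed (sd x y (fst w) (fst p)) (snd w)) * pr (ed (sd x y (fst w) (snd p)) (snd w))"
    and "finite (cfg x y p w)" "card (cfg x y p w) \<le> 4"
proof -
  have lt: "fst p < m" "snd p < m" "fst p \<noteq> snd p" using p by (auto simp: upairs_def)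
  have ne: "sd x y (fst w) (fst p) \<noteq> sd x y (fst w) (snd p)"
    using matched_sd(1)[OF mt, of "fst w"] lt by (auto simp: inj_on_def)
  have xy: "ex x p \<noteq> ex y p" using matched_ex(3)[OF mt p p] .
  have xe: "ex x p = ed (sd x y True (fst p)) (sd x y True (snd p))"
    and ye: "ex y p = ed (sd x y False (fst p)) (sd x y False (snd p))" by (simp_all add: ex_def sd_def)
  have d: "{ex x p, ex y p} \<inter> wedges x y p w = {}"
  proof -
    have "ed (sd x y b (fst p)) (sd x y b (snd p)) \<notin> wedges x y p w" for b
    proof (cases "b = fst w")
      case True
      then show ?thesis using v ne by (auto simp: wvalid_def wedges_def ed_eq_iff)
    next
      case False
      then show ?thesis using matched_sd(3)[OF mt lt(1) lt(1) False] matched_sd(3)[OF mt lt(1) lt(2) False]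
          matched_sd(3)[OF mt lt(2) lt(1) False] matched_sd(3)[OF mt lt(2) lt(2) False]
        by (auto simp: wedges_def ed_eq_iff)
    qed
    then show ?thesis unfolding xe ye by blast
  qed
  show "(\<Prod>e\<in>cfg x y p w. pr e) = pr (ex x p) * pr (ex y p) * (\<Prod>e\<in>wedges x y p w. pr e)"
    unfolding cfg_def by (subst prod.union_disjoint) (use d xy in \<open>auto simp: wedges_def\<close>)
  show "(\<Prod>e\<in>wedges x y p w. pr e) = pr (ed (sd x y (fst w) (fst p)) (snd w)) * pr (ed (sd x y (fst w) (snd p)) (snd w))"
    unfolding wedges_def using ne v by (subst prod.insert) (auto simp: ed_eq_iff wvalid_def)
  show "finite (cfg x y p w)" by (simp add: cfg_def wedges_def)
  have "card (cfg x y p w) \<le> card {ex x p, ex y p} + card (wedges x y p w)"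
    unfolding cfg_def by (rule card_Un_le)
  also have "\<dots> \<le> 2 + 2"
    by (intro add_mono) (auto simp: wedges_def card_insert_if)
  finally show "card (cfg x y p w) \<le> 4" by simp
qed

text \<open>Generating function over families: those of size at least \<open>rr\<close> contribute
  at most t^(- rr) times the product of the factors 1 + 2 t \<zeta> g(p). The choice of
  \<open>t\<close> turns this product into at most exp (\<nu> mu) \<le> exp rr, and t \<ge> 9 \<ge>
  exp 2 supplies exp (- 2 rr).\<close>

lemma E_spoiled_count:
  assumes mt: "matched n m x y"
  shows "pp.E (spoiled_count x y) \<le> exp (- (\<mu>0 / (16 * (real Dg + 1))))"
proof -
  define \<nu> where "\<nu> = 1 / (16 * (real Dg + 1))"
  define t where "t = \<nu> / (2 * \<zeta>)"
  define g where "g p = pr (ex x p) * pr (ex y p)" for p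
  define q where "q p w = g p * (if wvalid x y p w \<and> ex x p \<in> U \<and> ex y p \<in> U then (\<Prod>e\<in>wedges x y p w. pr e) else 0)" for p w
  have g0: "0 \<le> g p" for p by (simp add: g_def pr_nonneg)
  have q0: "0 \<le> q p w" for p w using g0[of p] by (simp add: q_def prod_nonneg pr_nonneg)
  have nu0: "0 < \<nu>" by (simp add: \<nu>_def)
  \<comment> \<open>The constant 288 of \<open>zD\<close> is 9 * 32.\<close>
  have t9: "9 \<le> t"
  proof -
    have "0 < 32 * (real Dg + 1) * \<zeta>" using zeta0 by simp
    moreover have "9 * (32 * (real Dg + 1) * \<zeta>) \<le> 1" using zD by (simp add: algebra_simps)
    ultimately have "9 \<le> 1 / (32 * (real Dg + 1) * \<zeta>)" by (simp only: le_divide_eq if_True)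
    moreover have "t = 1 / (32 * (real Dg + 1) * \<zeta>)" by (simp add: t_def \<nu>_def mult_ac)
    ultimately show ?thesis by simp
  qed
  \<comment> \<open>Summed over the third vertex, the two wedge edges give the expected codegree of
    the matched edge, at most \<zeta>; the factor 2 counts the sides.\<close>
  have sumq: "(\<Sum>w\<in>Wit. q p w) \<le> 2 * \<zeta> * g p" if p: "p \<in> upairs m" for p
  proof (cases "ex x p \<in> U \<and> ex y p \<in> U")
    case False
    then have "q p w = 0" for w unfolding q_def by auto
    then show ?thesis using g0[of p] zeta0 by simp
  next
    case True
    have lt: "fst p < m" "snd p < m" "fst p \<noteq> snd p" using p by (auto simp: upairs_def)
    have one: "(\<Sum>a<n. q p (b, a)) \<le> g p * \<zeta>" for b
    proof -
      let ?u = "sd x y b (fst p)" and ?v = "sd x y b (snd p)"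
      have uv: "?u < n" "?v < n" "?u \<noteq> ?v" "0 < W ?u ?v"
      proof -
        show "?u < n" "?v < n" using matched_sd(2)[OF mt] lt by auto
        show "?u \<noteq> ?v" using inj_onD[OF matched_sd(1)[OF mt, of b], of "fst p" "snd p"] lt by auto
        show "0 < W ?u ?v" using True by (cases b) (auto simp: ex_def ed_in_U sd_def)
      qed
      have "(\<Sum>a<n. q p (b, a)) \<le> (\<Sum>a<n. if a \<in> {..<n} - {?u, ?v} then g p * ((p0 * W ?u a) * (p0 * W ?v a)) else 0)"
      proof (intro sum_mono)
        fix a assume "a \<in> {..<n}"
        show "q p (b, a) \<le> (if a \<in> {..<n} - {?u, ?v} then g p * ((p0 * W ?u a) * (p0 * W ?v a)) else 0)"
        proof (cases "wvalid x y p (b, a)")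
          case w: True
          then have "a \<in> {..<n} - {?u, ?v}" by (simp add: wvalid_def)
          moreover have "q p (b, a) = g p * ((p0 * W ?u a) * (p0 * W ?v a))"
            using prod_cfg(2)[OF mt p w] True w by (simp add: q_def pr_ed)
          ultimately show ?thesis by simp
        next
          case False
          then have "q p (b, a) = 0" by (simp add: q_def)
          moreover have "0 \<le> g p * ((p0 * W ?u a) * (p0 * W ?v a))"
            using g0[of p] p0 W_nonneg by (intro mult_nonneg_nonneg)
          ultimately show ?thesis by simp
        qed
      qed
      also have "\<dots> = g p * (\<Sum>a\<in>{..<n} - {?u, ?v}. (p0 * W ?u a) * (p0 * W ?v a))"
      proof -
        have "(\<Sum>a<n. if a \<in> {..<n} - {?u, ?v} then g p * ((p0 * W ?u a) * (p0 * W ?v a)) else 0)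
          = (\<Sum>a\<in>{..<n} \<inter> ({..<n} - {?u, ?v}). g p * ((p0 * W ?u a) * (p0 * W ?v a)))"
          by (rule sum.inter_restrict[symmetric]) simp
        also have "{..<n} \<inter> ({..<n} - {?u, ?v}) = {..<n} - {?u, ?v}" by blast
        finally show ?thesis by (simp only: sum_distrib_left)
      qed
      also have "\<dots> \<le> g p * \<zeta>" by (rule mult_left_mono[OF cod[OF uv] g0])
      finally show ?thesis .
    qed
    have "(\<Sum>w\<in>Wit. q p w) = (\<Sum>b\<in>UNIV. \<Sum>a<n. q p (b, a))"
      by (simp add: Wit_def sum.cartesian_product)
    also have "\<dots> \<le> g p * \<zeta> + g p * \<zeta>"
      using one[of True] one[of False] by (simp add: UNIV_bool mult.commute)
    finally show ?thesis by (simp add: mult_ac)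
  qed
  have E1: "pp.E (\<lambda>z. of_bool (goodfam x y R \<omega>) * (\<Prod>e\<in>(\<Union>p\<in>R. cfg x y p (\<omega> p)). of_bool (z e))) \<le> (\<Prod>p\<in>R. q p (\<omega> p))"
    if R: "R \<subseteq> upairs m" for R \<omega>
  proof (cases "goodfam x y R \<omega>")
    case False
    then show ?thesis by (auto simp: pp.E_const intro!: prod_nonneg q0)
  next
    case True
    have sub: "(\<Union>p\<in>R. cfg x y p (\<omega> p)) \<subseteq> U"
      using True by (auto simp: goodfam_def cfg_def wvalid_def)
    have v: "wvalid x y p (\<omega> p)" if "p \<in> R" for p using True that by (simp add: goodfam_def)
    have "pp.E (\<lambda>z. of_bool (goodfam x y R \<omega>) * (\<Prod>e\<in>(\<Union>p\<in>R. cfg x y p (\<omega> p)). of_bool (z e)))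
       = (\<Prod>e\<in>(\<Union>p\<in>R. cfg x y p (\<omega> p)). pr e)"
      using True E_all_true[OF sub] by simp
    also have "\<dots> = (\<Prod>p\<in>R. \<Prod>e\<in>cfg x y p (\<omega> p). pr e)"
    proof (rule prod.UNION_disjoint)
      show "finite R" by (rule finite_subset[OF R]) simp
      show "\<forall>p\<in>R. finite (cfg x y p (\<omega> p))" by (simp add: cfg_def wedges_def)
      show "\<forall>p\<in>R. \<forall>p'\<in>R. p \<noteq> p' \<longrightarrow> cfg x y p (\<omega> p) \<inter> cfg x y p' (\<omega> p') = {}"
        using True by (simp add: goodfam_def)
    qed
    also have "\<dots> = (\<Prod>p\<in>R. q p (\<omega> p))"
    proof (intro prod.cong refl)
      fix p assume p: "p \<in> R"
      then show "(\<Prod>e\<in>cfg x y p (\<omega> p). pr e) = q p (\<omega> p)"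
        using True v[OF p] R prod_cfg(1)[OF mt _ v[OF p]] by (auto simp: q_def g_def goodfam_def)
    qed
    finally show ?thesis by simp
  qed
  let ?Rs = "{R\<in>Pow (upairs m). rr x y \<le> card R}"
  have finRs: "finite ?Rs" by simp
  have "pp.E (spoiled_count x y) = (\<Sum>R\<in>?Rs. \<Sum>\<omega>\<in>PiE R (\<lambda>_. Wit).
     pp.E (\<lambda>z. of_bool (goodfam x y R \<omega>) * (\<Prod>e\<in>(\<Union>p\<in>R. cfg x y p (\<omega> p)). of_bool (z e))))"
    unfolding spoiled_count_def by (simp only: pp.E_sum)
  also have "\<dots> \<le> (\<Sum>R\<in>?Rs. \<Sum>\<omega>\<in>PiE R (\<lambda>_. Wit). \<Prod>p\<in>R. q p (\<omega> p))"
    by (intro sum_mono E1) auto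
  also have "\<dots> = (\<Sum>R\<in>?Rs. \<Prod>p\<in>R. \<Sum>w\<in>Wit. q p w)"
  proof (intro sum.cong refl)
    fix R assume "R \<in> ?Rs"
    then have "finite R" by (auto intro: finite_subset[of R "upairs m"])
    then show "(\<Sum>\<omega>\<in>PiE R (\<lambda>_. Wit). \<Prod>p\<in>R. q p (\<omega> p)) = (\<Prod>p\<in>R. \<Sum>w\<in>Wit. q p w)"
      by (subst prod_sum_PiE) (auto simp: finWit)
  qed
  also have "\<dots> \<le> (\<Sum>R\<in>?Rs. (1/t) ^ rr x y * (\<Prod>p\<in>R. t * (2 * \<zeta> * g p)))"
  proof (intro sum_mono)
    fix R assume R: "R \<in> ?Rs"
    have "(\<Prod>p\<in>R. \<Sum>w\<in>Wit. q p w) \<le> (\<Prod>p\<in>R. 2 * \<zeta> * g p)"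
      using R sumq by (intro prod_mono conjI sum_nonneg q0) auto
    also have "\<dots> = (1/t) ^ rr x y * (t ^ rr x y * (\<Prod>p\<in>R. 2 * \<zeta> * g p))"
      using t9 by (simp add: power_one_over)
    also have "\<dots> \<le> (1/t) ^ rr x y * (t ^ card R * (\<Prod>p\<in>R. 2 * \<zeta> * g p))"
      using R t9 g0 zeta0 by (intro mult_left_mono mult_right_mono power_increasing prod_nonneg) auto
    also have "t ^ card R * (\<Prod>p\<in>R. 2 * \<zeta> * g p) = (\<Prod>p\<in>R. t * (2 * \<zeta> * g p))"
      by (simp add: prod.distrib)
    finally show "(\<Prod>p\<in>R. \<Sum>w\<in>Wit. q p w) \<le> (1/t) ^ rr x y * (\<Prod>p\<in>R. t * (2 * \<zeta> * g p))" .
  qed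
  also have "\<dots> \<le> (\<Sum>R\<in>Pow (upairs m). (1/t) ^ rr x y * (\<Prod>p\<in>R. t * (2 * \<zeta> * g p)))"
    using t9 g0 zeta0 by (intro sum_mono2) (auto intro!: mult_nonneg_nonneg prod_nonneg)
  also have "\<dots> = (1/t) ^ rr x y * (\<Prod>p\<in>upairs m. t * (2 * \<zeta> * g p) + 1)"
    by (subst prod_add) (auto simp: sum_distrib_left)
  also have "\<dots> \<le> (1/t) ^ rr x y * (\<Prod>p\<in>upairs m. exp (\<nu> * g p))"
  proof (intro mult_left_mono prod_mono conjI)
    fix p
    have eq: "t * (2 * \<zeta> * g p) = \<nu> * g p" using zeta0 by (simp add: t_def)
    show "t * (2 * \<zeta> * g p) + 1 \<le> exp (\<nu> * g p)" unfolding eq using exp_ge_add_one_self[of "\<nu> * g p"] by linarith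
    have "0 \<le> \<nu> * g p" using nu0 g0[of p] by (intro mult_nonneg_nonneg) auto
    then show "0 \<le> t * (2 * \<zeta> * g p) + 1" unfolding eq by linarith
  qed (use t9 in simp)
  also have "\<dots> = (1/t) ^ rr x y * exp (\<nu> * mu x y)"
    by (simp add: exp_sum mu_def g_def sum_distrib_left)
  also have "\<dots> \<le> exp (- 2 * real (rr x y)) * exp (real (rr x y))"
  proof (intro mult_mono)
    have "exp (2::real) \<le> t"
    proof -
      have "exp (2::real) = exp 1 * exp 1" by (simp flip: exp_add)
      also have "\<dots> \<le> 3 * 3" by (intro mult_mono exp_le) auto
      finally show ?thesis using t9 by simp
    qed
    then have "(1/t) ^ rr x y \<le> (1 / exp 2) ^ rr x y" using t9 by (intro power_mono divide_left_mono) auto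
    also have "\<dots> = exp (- 2 * real (rr x y))"
    proof -
      have "(1 / exp (2::real)) ^ rr x y = exp (- 2) ^ rr x y" by (simp add: exp_minus inverse_eq_divide)
      also have "\<dots> = exp (- 2 * real (rr x y))" by (simp only: exp_of_nat_mult[symmetric] mult.commute)
      finally show ?thesis .
    qed
    finally show "(1/t) ^ rr x y \<le> exp (- 2 * real (rr x y))" .
    have "\<nu> * mu x y \<le> real (rr x y)" using rr_ge[of x y] by (simp add: \<nu>_def)
    then show "exp (\<nu> * mu x y) \<le> exp (real (rr x y))" by simp
  qed auto
  also have "\<dots> = exp (- real (rr x y))" by (simp flip: exp_add)
  also have "\<dots> \<le> exp (- (\<mu>0 / (16 * (real Dg + 1))))"
  proof -
    have "\<mu>0 / (16 * (real Dg + 1)) \<le> mu x y / (16 * (real Dg + 1))"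
      using mu_ge[OF mt] by (intro divide_right_mono) auto
    also have "\<dots> \<le> real (rr x y)" by (rule rr_ge)
    finally show ?thesis by simp
  qed
  finally show ?thesis .
qed

definition good where "good z u v \<longleftrightarrow> adj z u v \<and> cn z u v = {}"

text \<open>If every sampled index pair lost an edge to a triangle, each would have a witness.
  Bounded codegrees limit how many configurations share an edge, so a disjoint family of size at
  least \<open>rr\<close> exists, and it adds 1 to \<open>spoiled_count\<close>.\<close>

lemma good_pair_exists:
  assumes mt: "matched n m x y"
    and codeg_count: "codeg_count z < 1" and Y2: "mu x y / 2 \<le> real (card (PH x y z))" and spoiled_count: "spoiled_count x y z < 1"
  shows "\<exists>p\<in>upairs m. good z (x (fst p)) (x (snd p)) \<and> good z (y (fst p)) (y (snd p))"
proof (rule ccontr)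
  assume no: "\<not> ?thesis"
  have cn_lt: "card (cn z u v) < Dg" if "ed u v \<in> U" for u v
  proof (rule ccontr)
    assume "\<not> card (cn z u v) < Dg"
    then have "(1::real) = of_bool (ed (fst (u, v)) (snd (u, v)) \<in> U \<and> Dg \<le> card (cn z (fst (u, v)) (snd (u, v))))"
      using that by simp
    also have "\<dots> \<le> codeg_count z"
      unfolding codeg_count_def using that by (intro member_le_sum) (auto simp: offd_def ed_in_U)
    finally show False using codeg_count by simp
  qed
  have "\<exists>w. fst p < m \<and> adj z (sd x y (fst w) (fst p)) (snd w) \<and> adj z (sd x y (fst w) (snd p)) (snd w)" if p: "p \<in> PH x y z" for p
  proof -
    have "cn z (x (fst p)) (x (snd p)) \<noteq> {} \<or> cn z (y (fst p)) (y (snd p)) \<noteq> {}"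
      using no p by (auto simp: PH_def good_def)
    then show ?thesis
    proof
      assume "cn z (x (fst p)) (x (snd p)) \<noteq> {}"
      then obtain a where "a \<in> cn z (x (fst p)) (x (snd p))" by auto
      then show ?thesis using p by (intro exI[of _ "(True, a)"]) (auto simp: cn_def sd_def PH_def upairs_def)
    next
      assume "cn z (y (fst p)) (y (snd p)) \<noteq> {}"
      then obtain a where "a \<in> cn z (y (fst p)) (y (snd p))" by auto
      then show ?thesis using p by (intro exI[of _ "(False, a)"]) (auto simp: cn_def sd_def PH_def upairs_def)
    qed
  qed
  then obtain w where w: "\<And>p. p \<in> PH x y z \<Longrightarrow> adj z (sd x y (fst (w p)) (fst p)) (snd (w p)) \<and> adj z (sd x y (fst (w p)) (snd p)) (snd (w p))"
    by metis
  have PHm: "p \<in> upairs m" if "p \<in> PH x y z" for p using that by (simp add: PH_def)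
  have finPH: "finite (PH x y z)" by (rule finite_subset[of _ "upairs m"]) (auto simp: PH_def)
  have valid: "wvalid x y p (w p)" if "p \<in> PH x y z" for p
    using w[OF that] by (auto simp: wvalid_def wedges_def adj_def ed_in_U)
  have true: "e \<in> U \<and> z e" if "p \<in> PH x y z" "e \<in> cfg x y p (w p)" for p e
    using w[OF that(1)] that by (auto simp: cfg_def wedges_def PH_def adj_def ex_def)
  have sdadj: "adj z (sd x y b (fst p)) (sd x y b (snd p))" if "p \<in> PH x y z" for p b
    using that by (auto simp: PH_def sd_def)
  define Q where "Q s t = {p \<in> upairs m. ex x p = ed s t \<or> ex y p = ed s t}" for s t
  have cQ: "card (Q s t) \<le> 1" for s t
  proof -
    have "p = p'" if "p \<in> Q s t" "p' \<in> Q s t" for p p'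
    proof -
      have m: "p \<in> upairs m" "p' \<in> upairs m" using that by (auto simp: Q_def)
      have "ex x p = ex x p' \<or> ex y p = ex y p' \<or> ex x p = ex y p' \<or> ex x p' = ex y p"
        using that unfolding Q_def by auto
      then show ?thesis
        using inj_onD[OF matched_ex(1)[OF mt] _ m] inj_onD[OF matched_ex(2)[OF mt] _ m]
          matched_ex(3)[OF mt m] matched_ex(3)[OF mt m(2) m(1)] by argo
    qed
    then have "\<forall>p\<in>Q s t. \<forall>p'\<in>Q s t. p = p'" by blast
    moreover have "finite (Q s t)" by (simp add: Q_def)
    ultimately show ?thesis by (simp only: One_nat_def card_le_Suc0_iff_eq)
  qed
  \<comment> \<open>An edge \<open>g\<close> is the matched edge of at most one index pair. If it is
    a wedge edge, the third vertex \<open>t\<close> of the triangle is a common neighbour of its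
    ends, and the matched edge joins \<open>t\<close> to one of them; fewer than \<open>Dg\<close>
    such \<open>t\<close> give at most 2 Dg further index pairs.\<close>
  have count: "card {p \<in> PH x y z. g \<in> cfg x y p (w p)} \<le> 2 * Dg + 1" for g
  proof (cases "g \<in> U")
    case False
    then have "{p \<in> PH x y z. g \<in> cfg x y p (w p)} = {}" using true by blast
    then show ?thesis by (simp only: card.empty)
  next
    case gU: True
    define g1 g2 where "g1 = fst g" and "g2 = snd g"
    have g: "g = ed g1 g2" using gU by (cases g) (auto simp: U_def upairs_def ed_def g1_def g2_def)
    have "{p \<in> PH x y z. g \<in> cfg x y p (w p)} \<subseteq> Q g1 g2 \<union> (\<Union>t\<in>cn z g1 g2. Q t g1 \<union> Q t g2)"
    proof
      fix p assume "p \<in> {p \<in> PH x y z. g \<in> cfg x y p (w p)}"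
      then have p: "p \<in> PH x y z" and gc: "g \<in> cfg x y p (w p)" by auto
      let ?s = "sd x y (fst (w p)) (fst p)" and ?s' = "sd x y (fst (w p)) (snd p)" and ?a = "snd (w p)"
      note adjs = w[OF p] sdadj[OF p, of "fst (w p)"]
      have Qs: "p \<in> Q ?s ?s'" "p \<in> Q ?s' ?s"
        using PHm[OF p] by (auto simp: Q_def ex_def sd_def ed_commute)
      from gc consider "g = ex x p \<or> g = ex y p" | "g = ed ?s ?a" | "g = ed ?s' ?a"
        by (auto simp: cfg_def wedges_def)
      then show "p \<in> Q g1 g2 \<union> (\<Union>t\<in>cn z g1 g2. Q t g1 \<union> Q t g2)"
      proof cases
        case 1
        then show ?thesis using PHm[OF p] g by (auto simp: Q_def)
      next
        case 2
        then have "(g1 = ?s \<and> g2 = ?a) \<or> (g1 = ?a \<and> g2 = ?s)" using g by (metis ed_eq_iff)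
        moreover have "?s' \<in> cn z ?s ?a" "?s' \<in> cn z ?a ?s" using adjs by (auto simp: cn_def adj_commute)
        ultimately show ?thesis using Qs by blast
      next
        case 3
        then have "(g1 = ?s' \<and> g2 = ?a) \<or> (g1 = ?a \<and> g2 = ?s')" using g by (metis ed_eq_iff)
        moreover have "?s \<in> cn z ?s' ?a" "?s \<in> cn z ?a ?s'" using adjs by (auto simp: cn_def adj_commute)
        ultimately show ?thesis using Qs by blast
      qed
    qed
    then have "card {p \<in> PH x y z. g \<in> cfg x y p (w p)} \<le> card (Q g1 g2 \<union> (\<Union>t\<in>cn z g1 g2. Q t g1 \<union> Q t g2))"
      by (intro card_mono) (auto simp: Q_def finite_cn)
    also have "\<dots> \<le> card (Q g1 g2) + card (\<Union>t\<in>cn z g1 g2. Q t g1 \<union> Q t g2)" by (rule card_Un_le)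
    also have "\<dots> \<le> 1 + (\<Sum>t\<in>cn z g1 g2. card (Q t g1 \<union> Q t g2))"
      by (intro add_mono cQ card_UN_le finite_cn)
    also have "(\<Sum>t\<in>cn z g1 g2. card (Q t g1 \<union> Q t g2)) \<le> (\<Sum>t\<in>cn z g1 g2. 2)"
    proof (intro sum_mono)
      fix t show "card (Q t g1 \<union> Q t g2) \<le> 2"
        using card_Un_le[of "Q t g1" "Q t g2"] cQ[of t g1] cQ[of t g2] by linarith
    qed
    also have "\<dots> \<le> 2 * Dg" using cn_lt[of g1 g2] gU g by simp
    finally show ?thesis by simp
  qed
  obtain R where R: "R \<subseteq> PH x y z" and dis: "\<And>p p'. p \<in> R \<Longrightarrow> p' \<in> R \<Longrightarrow> p \<noteq> p' \<Longrightarrow> cfg x y p (w p) \<inter> cfg x y p' (w p') = {}"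
    and cR: "card (PH x y z) \<le> 4 * (2 * Dg + 1) * card R"
  proof (rule exists_disjoint_subfamily[of "PH x y z" "\<lambda>p. cfg x y p (w p)" "2 * Dg + 1"])
    show "finite (cfg x y p (w p)) \<and> cfg x y p (w p) \<noteq> {} \<and> card (cfg x y p (w p)) \<le> 4" if "p \<in> PH x y z" for p
      using prod_cfg(3,4)[OF mt PHm[OF that] valid[OF that]] by (auto simp: cfg_def)
  qed (use finPH count in auto)
  have "mu x y \<le> 16 * (real Dg + 1) * real (card R)"
  proof -
    have "mu x y / 2 \<le> real (4 * (2 * Dg + 1) * card R)" using Y2 cR by linarith
    also have "\<dots> \<le> 8 * (real Dg + 1) * real (card R)" by (simp add: mult_right_mono)
    finally show ?thesis by (simp add: algebra_simps)
  qed
  then have "mu x y / (16 * (real Dg + 1)) \<le> real (card R)" by (simp add: divide_le_eq mult.commute)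
  then have rR: "rr x y \<le> card R" unfolding rr_def by linarith
  let ?\<omega> = "restrict w R"
  let ?f = "\<lambda>R \<omega>. of_bool (goodfam x y R \<omega>) * (\<Prod>e\<in>(\<Union>p\<in>R. cfg x y p (\<omega> p)). of_bool (z e)) :: real"
  have "?f R ?\<omega> = 1"
  proof -
    have "goodfam x y R ?\<omega>"
      using R dis valid by (auto simp: goodfam_def PH_def ex_def adj_def)
    moreover have "z e" if "e \<in> (\<Union>p\<in>R. cfg x y p (?\<omega> p))" for e
    proof -
      from that obtain p where p: "p \<in> R" "e \<in> cfg x y p (?\<omega> p)" by blast
      then have "p \<in> PH x y z" using R by blast
      with p show ?thesis using true[of p e] by simp
    qed
    ultimately show ?thesis by simp
  qed
  moreover have "?f R ?\<omega> \<le> (\<Sum>\<omega>\<in>PiE R (\<lambda>_. Wit). ?f R \<omega>)"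
  proof (rule member_le_sum)
    have "w p \<in> Wit" if "p \<in> R" for p
      using valid[of p] that R by (auto simp: wvalid_def Wit_def mem_Times_iff)
    then show "?\<omega> \<in> PiE R (\<lambda>_. Wit)" by auto
    show "finite (PiE R (\<lambda>_. Wit))" by (intro finite_PiE finite_subset[OF R finPH] finWit)
  qed (auto intro!: mult_nonneg_nonneg prod_nonneg)
  moreover have "(\<Sum>\<omega>\<in>PiE R (\<lambda>_. Wit). ?f R \<omega>) \<le> spoiled_count x y z"
    unfolding spoiled_count_def using rR R PHm
    by (intro member_le_sum[of R _ "\<lambda>R. \<Sum>\<omega>\<in>PiE R (\<lambda>_. Wit). ?f R \<omega>"]) (auto intro!: sum_nonneg mult_nonneg_nonneg prod_nonneg)
  ultimately show False using spoiled_count by linarith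
qed

text \<open>Extensional representatives, so that the families can be counted; every matched pair
  restricts to one.\<close>

definition M where "M = {p \<in> PiE {..<m} (\<lambda>_. {..<n}) \<times> PiE {..<m} (\<lambda>_. {..<n}). matched n m (fst p) (snd p)}"

lemma M: "finite M" "real (card M) \<le> real n ^ (2 * m)"
proof -
  let ?P = "PiE {..<m} (\<lambda>_. {..<n}) \<times> PiE {..<m} (\<lambda>_. {..<n})"
  have f: "finite ?P" by (intro finite_cartesian_product finite_PiE) auto
  have s: "M \<subseteq> ?P" by (auto simp: M_def)
  show "finite M" using f s finite_subset by blast
  have "card M \<le> card ?P" by (rule card_mono[OF f s])
  also have "\<dots> = n ^ (2 * m)" by (simp add: card_cartesian_product card_PiE mult_2 power_add)
  finally show "real (card M) \<le> real n ^ (2 * m)" by (metis of_nat_le_iff of_nat_power)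
qed

theorem exists_graph:
  obtains H :: "nat \<Rightarrow> nat \<Rightarrow> bool" where
    "\<And>u v. H u v \<Longrightarrow> H v u" "\<And>u v. H u v \<Longrightarrow> u < n \<and> v < n \<and> u \<noteq> v"
    "\<And>u v w. H u v \<Longrightarrow> H v w \<Longrightarrow> H u w \<Longrightarrow> False"
    "\<And>x y. matched n m x y \<Longrightarrow> \<exists>i<m. \<exists>j<m. i \<noteq> j \<and> H (x i) (x j) \<and> H (y i) (y j)"
proof -
  let ?Y2 = "\<lambda>z. \<Sum>p\<in>M. of_bool (real (card (PH (fst p) (snd p) z)) < mu (fst p) (snd p) / 2) :: real"
  let ?spoiled_count = "\<lambda>z. \<Sum>p\<in>M. spoiled_count (fst p) (snd p) z"
  have E2: "pp.E ?Y2 \<le> 1/4"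
  proof -
    have "pp.E ?Y2 \<le> (\<Sum>p\<in>M. exp (- (\<mu>0 / 8)))"
      unfolding pp.E_sum by (intro sum_mono E_few_preserved) (simp add: M_def)
    also have "\<dots> \<le> real n ^ (2 * m) * exp (- (\<mu>0 / 8))"
      using M(2) by (simp add: mult_right_mono)
    finally show ?thesis using n2 by simp
  qed
  have E3: "pp.E ?spoiled_count \<le> 1/4"
  proof -
    have "pp.E ?spoiled_count \<le> (\<Sum>p\<in>M. exp (- (\<mu>0 / (16 * (real Dg + 1)))))"
      unfolding pp.E_sum by (intro sum_mono E_spoiled_count) (simp add: M_def)
    also have "\<dots> \<le> real n ^ (2 * m) * exp (- (\<mu>0 / (16 * (real Dg + 1))))"
      using M(2) by (simp add: mult_right_mono)
    finally show ?thesis using n3 by simp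
  qed
  have "pp.E (\<lambda>z. codeg_count z + (?Y2 z + ?spoiled_count z)) < 1"
    unfolding pp.E_add using E_codeg_count E2 E3 by linarith
  then obtain z where "codeg_count z + (?Y2 z + ?spoiled_count z) < 1" using pp.E_less_exists by blast
  moreover have "0 \<le> ?Y2 z" by (intro sum_nonneg zero_less_eq_of_bool)
  moreover have nn: "0 \<le> codeg_count z" "\<And>x y. 0 \<le> spoiled_count x y z"
    unfolding codeg_count_def spoiled_count_def by (intro sum_nonneg mult_nonneg_nonneg prod_nonneg zero_less_eq_of_bool)+
  moreover have "0 \<le> ?spoiled_count z" using nn(2) by (intro sum_nonneg)
  ultimately have lt: "codeg_count z < 1" "?Y2 z < 1" "?spoiled_count z < 1" by linarith+
  show thesis
  proof (rule that[of "good z"])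
    show "good z u v \<Longrightarrow> good z v u" for u v
      by (auto simp: good_def cn_def adj_commute)
    show "good z u v \<Longrightarrow> u < n \<and> v < n \<and> u \<noteq> v" for u v
      by (auto simp: good_def dest: adj_less)
    show "good z u v \<Longrightarrow> good z v w \<Longrightarrow> good z u w \<Longrightarrow> False" for u v w
      by (auto simp: good_def cn_def adj_commute)
    fix x y assume mt: "matched n m x y"
    let ?x = "restrict x {..<m}" and ?y = "restrict y {..<m}"
    have mt': "matched n m ?x ?y" using mt by (auto simp: matched_def inj_on_def)
    have inM: "(?x, ?y) \<in> M" using mt mt' by (auto simp: M_def matched_def)
    let ?b = "\<lambda>p. of_bool (real (card (PH (fst p) (snd p) z)) < mu (fst p) (snd p) / 2) :: real"
    have "?b (?x, ?y) \<le> ?Y2 z" by (rule member_le_sum[OF inM]) (use M(1) in auto)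
    then have "?b (?x, ?y) < 1" using lt(2) by linarith
    then have 2: "mu ?x ?y / 2 \<le> real (card (PH ?x ?y z))"
      by (cases "real (card (PH ?x ?y z)) < mu ?x ?y / 2") simp_all
    have "spoiled_count ?x ?y z \<le> ?spoiled_count z"
      using member_le_sum[OF inM, of "\<lambda>p. spoiled_count (fst p) (snd p) z"] M(1) nn(2) by simp
    then have 3: "spoiled_count ?x ?y z < 1" using lt(3) by linarith
    obtain p where "p \<in> upairs m" "good z (?x (fst p)) (?x (snd p))" "good z (?y (fst p)) (?y (snd p))"
      using good_pair_exists[OF mt' lt(1) 2 3] by auto
    then show "\<exists>i<m. \<exists>j<m. i \<noteq> j \<and> good z (x i) (x j) \<and> good z (y i) (y j)"
      by (intro exI[of _ "fst p"] exI[of _ "snd p"] conjI) (auto simp: upairs_def)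
  qed
qed

end

subsection \<open>Choice of parameters\<close>

lemma sum_Pow_power_card:
  fixes a :: real
  assumes "finite K" shows "(\<Sum>S\<in>Pow K. a ^ card S) = (1 + a) ^ card K"
proof -
  have "(\<Prod>l\<in>K. a + 1) = (\<Sum>S\<in>Pow K. (\<Prod>l\<in>S. a) * (\<Prod>l\<in>K - S. 1))"
    by (rule prod_add[OF assms])
  then show ?thesis by (simp add: add.commute)
qed

lemma one_plus_power_le_exp: "0 \<le> (a::real) \<Longrightarrow> (1 + a) ^ k \<le> exp (a * real k)"
proof -
  assume "0 \<le> a"
  then have "(1 + a) ^ k \<le> exp a ^ k" by (intro power_mono exp_ge_add_one_self) auto
  then show ?thesis by (simp add: mult.commute flip: exp_of_nat_mult)
qed

text \<open>Each low set gets weight k^d / k^(card S) \<ge> 1, and over all subsets these weights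
  sum to k^d (1 + 1/k)^k, at most 3 k^d.\<close>

lemma card_low_le:
  assumes "finite K" "1 \<le> card K"
  shows "real (card (low K d)) \<le> 3 * real (card K) ^ d"
proof -
  let ?k = "real (card K)"
  have "real (card (low K d)) = (\<Sum>S\<in>low K d. 1)" by simp
  also have "\<dots> \<le> (\<Sum>S\<in>low K d. ?k ^ d * (1 / ?k) ^ card S)"
  proof (intro sum_mono)
    fix S assume "S \<in> low K d"
    then have "?k ^ card S \<le> ?k ^ d" using assms by (intro power_increasing) (auto simp: low_def)
    then show "1 \<le> ?k ^ d * (1 / ?k) ^ card S" using assms by (simp add: power_one_over)
  qed
  also have "\<dots> \<le> (\<Sum>S\<in>Pow K. ?k ^ d * (1 / ?k) ^ card S)"
    using assms(1) by (intro sum_mono2) (auto simp: low_def)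
  also have "\<dots> = ?k ^ d * (1 + 1 / ?k) ^ card K"
    by (simp only: sum_Pow_power_card[OF assms(1)] sum_distrib_left[symmetric])
  also have "\<dots> \<le> ?k ^ d * exp (1 / ?k * ?k)"
    by (intro mult_left_mono one_plus_power_le_exp) auto
  also have "exp (1 / ?k * ?k) = exp 1" using assms(2) by simp
  also have "?k ^ d * exp 1 \<le> ?k ^ d * 3" by (intro mult_left_mono exp_le) auto
  finally show ?thesis by (simp add: mult.commute)
qed

lemma exp_two_le: "exp 2 \<le> (9::real)"
proof -
  have "exp (2::real) = exp 1 * exp 1" by (simp flip: exp_add)
  also have "\<dots> \<le> 3 * 3" by (intro mult_mono exp_le) auto
  finally show ?thesis by simp
qed

text \<open>Rankin's trick: beyond degree \<open>d\<close> the factor 9^(card S) / 9^d is at least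
  1. The base 9 is at least exp 2, which gives the decay exp (- 2 d).\<close>

lemma sum_high_le:
  assumes "finite K"
  shows "(\<Sum>S\<in>Pow K - low K d. c ^ (2 * card S)) \<le> exp (9 * c\<^sup>2 * real (card K) - 2 * real d)"
proof -
  have "(\<Sum>S\<in>Pow K - low K d. c ^ (2 * card S)) \<le> (\<Sum>S\<in>Pow K - low K d. (1/9) ^ d * (9 * c\<^sup>2) ^ card S)"
  proof (intro sum_mono)
    fix S assume "S \<in> Pow K - low K d"
    then have "(9::real) ^ d \<le> 9 ^ card S" by (intro power_increasing) (auto simp: low_def)
    then have "1 \<le> (1/9::real) ^ d * 9 ^ card S" by (simp add: power_one_over)
    then have "1 * c ^ (2 * card S) \<le> ((1/9) ^ d * 9 ^ card S) * c ^ (2 * card S)" by (intro mult_right_mono) auto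
    then show "c ^ (2 * card S) \<le> (1/9) ^ d * (9 * c\<^sup>2) ^ card S" by (simp add: power_mult_distrib power_mult mult.assoc)
  qed
  also have "\<dots> \<le> (\<Sum>S\<in>Pow K. (1/9) ^ d * (9 * c\<^sup>2) ^ card S)"
    using assms by (intro sum_mono2) auto
  also have "\<dots> = (1/9) ^ d * (1 + 9 * c\<^sup>2) ^ card K"
    by (simp only: sum_Pow_power_card[OF assms] sum_distrib_left[symmetric])
  also have "\<dots> \<le> exp (- 2 * real d) * exp (9 * c\<^sup>2 * real (card K))"
  proof (intro mult_mono one_plus_power_le_exp)
    have "(1/9::real) ^ d \<le> (1 / exp 2) ^ d" using exp_two_le by (intro power_mono divide_left_mono) auto
    also have "\<dots> = exp (- 2) ^ d" by (simp add: exp_minus inverse_eq_divide)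
    also have "\<dots> = exp (- 2 * real d)" by (simp only: exp_of_nat_mult[symmetric] mult.commute)
    finally show "(1/9::real) ^ d \<le> exp (- 2 * real d)" .
  qed auto
  also have "\<dots> = exp (9 * c\<^sup>2 * real (card K) - 2 * real d)" by (simp flip: exp_add)
  finally show ?thesis .
qed

lemma exp_ln_add_diff: "0 < (C::real) \<Longrightarrow> C * exp a * exp (- b) = exp (ln C + a - b)"
  by (simp add: exp_add exp_diff exp_minus divide_inverse)

text \<open>The dimension is \<open>k = 8 r\<^sup>7\<close> and \<open>c = 1 / (2 r\<^sup>2)\<close>. Then \<open>c\<^sup>2 k = 2 r\<^sup>3\<close>, so truncation at degree \<open>20 r\<^sup>3\<close> is
  harmless, while \<open>c\<^sup>3 k = r\<close>, so codegrees drop by the factor \<open>exp (- r / 2)\<close>.\<close>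

lemma exists_anticlique_graph:
  fixes r n m :: nat and \<epsilon> :: real
  defines "\<beta> \<equiv> exp (ln 648 + 80 * real r ^ 3 * ln (8 * real r ^ 7) - real r ^ 4 / 4)"
  defines "e \<equiv> 64 * exp (- 10 * real r ^ 3) + 32 * exp (- 22 * real r ^ 3) + \<beta>"
  assumes r4: "4 \<le> r" and n_lo: "real r ^ 4 / 4 \<le> ln (real n)" and n_hi: "ln (real n) \<le> real r ^ 4 / 2" and n3: "3 \<le> n"
    and eps: "0 < \<epsilon>" and m: "\<epsilon> * real n \<le> real m"
    and a: "\<beta> \<le> 1" "\<beta> \<le> 2 * sqrt \<epsilon>"
    and b: "ln 8 + real r ^ 4 \<le> 3 * real r ^ 5 / 40000"
    and cc: "ln 8 + real r ^ 4 \<le> exp (real r ^ 4 / 5 - real r / 2)"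
    and dd: "real r ^ 6 * exp (real r ^ 4 / 40) \<le> exp (real r ^ 4 / 8)"
    and ee: "864 * (real r ^ 5 + 1) * real r ^ 12 * exp (- (real r / 2)) \<le> 1"
    and ff: "ln 12 + real r ^ 4 \<le> real r ^ 5"
    and gg: "100 / real r ^ 2 + e + 2 * exp (- (real r ^ 3 / 10)) * (200 + e) \<le> \<epsilon>\<^sup>2 / 2"
    and hh: "ln 4 + real r ^ 4 \<le> real r ^ 12 * \<epsilon> / 32"
    and ii: "ln 4 + real r ^ 4 \<le> real r ^ 12 * \<epsilon> / (64 * (real r ^ 5 + 1))"
  obtains H :: "nat \<Rightarrow> nat \<Rightarrow> bool" where
    "\<And>u v. H u v \<Longrightarrow> H v u" "\<And>u v. H u v \<Longrightarrow> u < n \<and> v < n \<and> u \<noteq> v"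
    "\<And>u v w. H u v \<Longrightarrow> H v w \<Longrightarrow> H u w \<Longrightarrow> False"
    "\<And>x y. matched n m x y \<Longrightarrow> \<exists>i<m. \<exists>j<m. i \<noteq> j \<and> H (x i) (x j) \<and> H (y i) (y j)"
proof -
  define K where "K = {..<8 * r ^ 7}"
  define c where "c = 1 / (2 * real r ^ 2)"
  define d where "d = 20 * r ^ 3"
  \<comment> \<open>With these values lm R - lm^2 k = 3 r^5 / 40000, which beats 2 ln n \<le> r^4,
    while exp (2 c R) = exp (r^4 / 20) stays far below n \<ge> exp (r^4 / 4).\<close>
  define R where "R = real r ^ 6 / 20"
  define lm where "lm = 1 / (400 * real r)"
  define N where "N = card (low K d)"
  have rpos: "0 < real r" using r4 by simp
  have npos: "0 < real n" using n3 by simp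
  have finK: "finite K" by (simp add: K_def)
  have cK: "real (card K) = 8 * real r ^ 7" by (simp add: K_def)
  have c2k: "c\<^sup>2 * real (card K) = 2 * real r ^ 3"
    using rpos by (simp add: cK c_def field_simps power_numeral_reduce)
  have c3k: "c ^ 3 * real (card K) = real r"
    using rpos by (simp add: cK c_def field_simps power_numeral_reduce)
  have cR: "c * R = real r ^ 4 / 40"
    using rpos by (simp add: c_def R_def field_simps power_numeral_reduce)
  have lmk: "lm\<^sup>2 * real (card K) = real r ^ 5 / 20000"
    using rpos by (simp add: cK lm_def field_simps power_numeral_reduce)
  have lmR: "lm * R = real r ^ 5 / 8000"
    using rpos by (simp add: lm_def R_def field_simps power_numeral_reduce)
  have c0: "0 < c" and c1: "c \<le> 1/20"
  proof -
    show "0 < c" using rpos by (simp add: c_def)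
    have "4 ^ 2 \<le> real r ^ 2" using r4 by (intro power_mono) auto
    then have "20 \<le> 2 * real r ^ 2" by simp
    then show "c \<le> 1/20" using rpos unfolding c_def by (intro divide_left_mono) auto
  qed
  have tau: "exp (- (c ^ 3) * real (card K) / 2) = exp (- (real r / 2))"
    using c3k by simp
  have n_ge: "exp (real r ^ 4 / 4) \<le> real n" using n_lo npos by (metis exp_le_cancel_iff exp_ln)
  have n_le: "real n \<le> exp (real r ^ 4 / 2)" using n_hi npos by (metis exp_le_cancel_iff exp_ln)
  have n2_le: "(real n)\<^sup>2 \<le> exp (real r ^ 4)"
  proof -
    have "(real n)\<^sup>2 \<le> (exp (real r ^ 4 / 2))\<^sup>2" using n_le by (intro power_mono) auto
    then show ?thesis by (simp flip: exp_double)
  qed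
  have Nb: "8 * real N ^ 4 \<le> \<beta> * real n"
  proof -
    have "real N \<le> 3 * real (card K) ^ d"
      unfolding N_def using finK r4 by (intro card_low_le) (auto simp: K_def)
    then have "real N ^ 4 \<le> (3 * real (card K) ^ d) ^ 4" by (intro power_mono) auto
    then have "8 * real N ^ 4 \<le> 648 * real (card K) ^ (4 * d)"
      by (simp add: power_mult_distrib mult.commute flip: power_mult)
    also have "\<dots> = exp (ln 648 + 80 * real r ^ 3 * ln (8 * real r ^ 7))"
    proof -
      have "real (card K) ^ (4 * d) = exp (real (4 * d) * ln (real (card K)))"
        using rpos by (simp add: cK exp_of_nat_mult del: of_nat_mult)
      then show ?thesis by (simp add: exp_add cK d_def mult_ac)
    qed
    also have "\<dots> = \<beta> * exp (real r ^ 4 / 4)" by (simp add: \<beta>_def flip: exp_add)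
    also have "\<dots> \<le> \<beta> * real n" using n_ge by (intro mult_left_mono) (auto simp: \<beta>_def)
    finally show ?thesis .
  qed
  have beta0: "0 < \<beta>" by (simp add: \<beta>_def)
  \<comment> \<open>The moment order q = r^4 makes c^2 (2q - 1) just less than 1/2 and 9^q \<ge> exp
    (2 r^4) \<ge> n^4. Truncation leaves exp (18 r^3 - 40 r^3) = exp (- 22 r^3), small even against
    the norm exp (2 r^3).\<close>
  interpret S: sample_params K d c n "r ^ 4" "exp (- 22 * real r ^ 3)" "exp (2 * real r ^ 3)" R lm
  proof
    show "c\<^sup>2 * (2 * real (r ^ 4) - 1) \<le> 1"
    proof -
      have "c\<^sup>2 * (2 * real (r ^ 4) - 1) = 1/2 - c\<^sup>2"
        using rpos by (simp add: c_def field_simps power_numeral_reduce)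
      also have "\<dots> \<le> 1" using zero_le_power2[of c] by linarith
      finally show ?thesis .
    qed
    show "8 * real (card (low K d)) ^ 4 \<le> real n"
      using Nb mult_right_mono[OF a(1), of "real n"] by (simp add: N_def)
    show "real n ^ 4 \<le> 9 ^ r ^ 4"
    proof -
      have "real n ^ 4 = (real n)\<^sup>2 * (real n)\<^sup>2" by (simp add: power_numeral_reduce)
      also have "\<dots> \<le> exp (real r ^ 4) * exp (real r ^ 4)" using n2_le by (intro mult_mono) auto
      also have "\<dots> = exp 2 ^ r ^ 4" by (simp add: mult.commute flip: exp_add exp_of_nat_mult)
      also have "\<dots> \<le> 9 ^ r ^ 4" using exp_two_le by (intro power_mono) auto
      finally show ?thesis .
    qed
    show "(\<Sum>S\<in>Pow K - low K d. c ^ (2 * card S)) \<le> exp (- 22 * real r ^ 3)"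
    proof -
      have "9 * c\<^sup>2 * real (card K) - 2 * real d = - 22 * real r ^ 3"
        using c2k by (simp add: d_def mult.assoc)
      then show ?thesis using sum_high_le[OF finK, of c d] by simp
    qed
    show "(\<Sum>S\<in>Pow K. c ^ (2 * card S)) \<le> exp (2 * real r ^ 3)"
      using one_plus_power_le_exp[of "c\<^sup>2" "card K"] sum_Pow_power_card[OF finK, of "c\<^sup>2"] c2k
      by (simp add: power_mult)
    show "8 * (real n)\<^sup>2 * exp (lm\<^sup>2 * real (card K) - lm * R) \<le> 1"
    proof -
      have "8 * (real n)\<^sup>2 * exp (lm\<^sup>2 * real (card K) - lm * R) \<le> 8 * exp (real r ^ 4) * exp (- (3 * real r ^ 5 / 40000))"
        using n2_le lmk lmR by (intro mult_mono) auto
      also have "\<dots> = exp (ln 8 + real r ^ 4 - 3 * real r ^ 5 / 40000)"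
        by (rule exp_ln_add_diff) simp
      also have "\<dots> \<le> 1" using b by simp
      finally show ?thesis .
    qed
    show "8 * (real n)\<^sup>2 * exp (- (real n * exp (- (c ^ 3) * real (card K) / 2) / (exp (c * R))\<^sup>2)) \<le> 1"
    proof -
      have "exp (real r ^ 4 / 5 - real r / 2) = exp (real r ^ 4 / 4) * exp (- (real r / 2)) / (exp (c * R))\<^sup>2"
        by (simp add: cR flip: exp_add exp_double exp_diff)
      also have "\<dots> \<le> real n * exp (- (real r / 2)) / (exp (c * R))\<^sup>2"
        using n_ge by (intro divide_right_mono mult_right_mono) auto
      finally have "8 * (real n)\<^sup>2 * exp (- (real n * exp (- (c ^ 3) * real (card K) / 2) / (exp (c * R))\<^sup>2))
        \<le> 8 * exp (real r ^ 4) * exp (- (exp (real r ^ 4 / 5 - real r / 2)))"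
        unfolding tau using n2_le by (intro mult_mono) auto
      also have "\<dots> = exp (ln 8 + real r ^ 4 - exp (real r ^ 4 / 5 - real r / 2))"
        by (rule exp_ln_add_diff) simp
      also have "\<dots> \<le> 1" using cc by simp
      finally show ?thesis .
    qed
    show "lm \<le> 1" using r4 by (simp add: lm_def)
  qed (use finK c0 c1 n3 r4 in \<open>auto simp: lm_def\<close>)
  obtain z where cs: "cube_sample K d c n (N\<^sup>2 + 2) z" and "\<And>v. v < n \<Longrightarrow> z v \<subseteq> K"
    and err: "\<And>c'. c' \<in> {c, c/2} \<Longrightarrow> (\<Sum>p\<in>offd n. (wk K c' (z (fst p)) (z (snd p)) - wd K d c' (z (fst p)) (z (snd p)))\<^sup>2) \<le> (32 * exp (- 22 * real r ^ 3)) * (real n)\<^sup>2"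
    and nrm: "\<And>c'. c' \<in> {c, c/2} \<Longrightarrow> (\<Sum>p\<in>offd n. (wk K c' (z (fst p)) (z (snd p)))\<^sup>2) \<le> (32 * exp (2 * real r ^ 3)) * (real n)\<^sup>2"
    and ipR: "\<And>u v. u < n \<Longrightarrow> v < n \<Longrightarrow> u \<noteq> v \<Longrightarrow> - R \<le> ip K (z u) (z v)"
    and cg: "\<And>u v. u < n \<Longrightarrow> v < n \<Longrightarrow> u \<noteq> v \<Longrightarrow> ip K (z u) (z v) \<le> - c * real (card K) / 2 \<Longrightarrow>
        codeg K c R n z u v \<le> 3 * real n * exp (- (c ^ 3) * real (card K) / 2)"
    apply (rule S.exists_sample[folded N_def])
    subgoal premises p for z by (rule p(1)[OF p(2-7)])
    done
  define W where "W u v = Wk K c R (z u) (z v)" for u v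
  \<comment> \<open>So p0^2 n = r^12. With codegree cap r^5 the exponent \<mu>0 / (16 (r^5 + 1)) is
    at least of order \<epsilon> r^7 m, above the entropy 2 m ln n \<le> m r^4, while \<zeta> is
    still small owing to exp (- r / 2).\<close>
  define p0 where "p0 = real r ^ 6 / sqrt (real n)"
  define \<zeta> where "\<zeta> = 3 * real r ^ 12 * exp (- (real r / 2))"
  define \<mu>0 where "\<mu>0 = p0\<^sup>2 * (real m)\<^sup>2 / 4"
  have p0sq: "p0\<^sup>2 = real r ^ 12 / real n"
  proof -
    have "(real r ^ 6)\<^sup>2 = real r ^ (6 * 2)" by (rule power_mult[symmetric])
    then show ?thesis using npos by (simp add: p0_def power_divide)
  qed
  have p00: "0 \<le> p0" by (simp add: p0_def)
  have m1: "1 \<le> real m"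
  proof -
    have "0 < \<epsilon> * real n" using eps npos by simp
    then have "0 < real m" using m by linarith
    then show ?thesis by simp
  qed
  have mu0: "real r ^ 12 * \<epsilon> / 4 * real m \<le> \<mu>0"
  proof -
    have "\<epsilon> * real m \<le> real m * real m / real n"
      using m npos m1 by (simp add: field_simps mult_right_mono)
    then have "real r ^ 12 / 4 * (\<epsilon> * real m) \<le> real r ^ 12 / 4 * (real m * real m / real n)"
      by (intro mult_left_mono) auto
    moreover have "\<mu>0 = real r ^ 12 / 4 * (real m * real m / real n)"
      unfolding \<mu>0_def p0sq by (simp add: power2_eq_square)
    ultimately show ?thesis by (simp add: mult_ac)
  qed
  have npow: "real n ^ (2 * m) \<le> exp (real m * real r ^ 4)"
  proof -
    have "real n ^ (2 * m) = ((real n)\<^sup>2) ^ m" by (rule power_mult)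
    also have "\<dots> \<le> exp (real r ^ 4) ^ m" using n2_le by (intro power_mono) auto
    finally show ?thesis by (simp flip: exp_of_nat_mult)
  qed
  have fin: "4 * real n ^ (2 * m) * exp (- (\<mu>0 / t)) \<le> 1"
    if t: "0 < t" "ln 4 + real r ^ 4 \<le> real r ^ 12 * \<epsilon> / (4 * t)" for t
  proof -
    have "4 * real n ^ (2 * m) * exp (- (\<mu>0 / t)) \<le> 4 * exp (real m * real r ^ 4) * exp (- (real m * (real r ^ 12 * \<epsilon> / (4 * t))))"
    proof (intro mult_mono)
      have "real m * (real r ^ 12 * \<epsilon> / (4 * t)) = (real r ^ 12 * \<epsilon> / 4 * real m) / t" by simp
      also have "\<dots> \<le> \<mu>0 / t" using mu0 t(1) by (intro divide_right_mono) auto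
      finally show "exp (- (\<mu>0 / t)) \<le> exp (- (real m * (real r ^ 12 * \<epsilon> / (4 * t))))" by simp
    qed (use npow in auto)
    also have "\<dots> = exp (ln 4 + real m * real r ^ 4 - real m * (real r ^ 12 * \<epsilon> / (4 * t)))"
      by (rule exp_ln_add_diff) simp
    also have "\<dots> \<le> exp 0"
    proof (subst exp_le_cancel_iff)
      have "real m * (ln 4 + real r ^ 4) \<le> real m * (real r ^ 12 * \<epsilon> / (4 * t))"
        using t(2) by (intro mult_left_mono) auto
      moreover have "1 * ln 4 \<le> real m * ln 4" using m1 by (intro mult_right_mono) auto
      ultimately show "ln 4 + real m * real r ^ 4 - real m * (real r ^ 12 * \<epsilon> / (4 * t)) \<le> 0"
        unfolding distrib_left mult_1_left by linarith
    qed
    finally show ?thesis by simp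
  qed
  have zeta0: "0 < \<zeta>" using rpos by (simp add: \<zeta>_def)
  have zD: "288 * (real (r ^ 5) + 1) * \<zeta> \<le> 1"
  proof -
    have "288 * (real (r ^ 5) + 1) * \<zeta> = 864 * (real r ^ 5 + 1) * real r ^ 12 * exp (- (real r / 2))"
      by (simp add: \<zeta>_def algebra_simps)
    then show ?thesis using ee by simp
  qed
  interpret G: edge_sample n m "r ^ 5" W p0 \<zeta> \<mu>0
  proof
    show "W u v = W v u" for u v by (simp add: W_def Wk_commute[of K c R "z u"])
    show "0 \<le> W u v" for u v using c0 c1 by (simp add: W_def Wk_nonneg)
    show "p0 * W u v \<le> 1" for u v
    proof -
      have "W u v \<le> exp (real r ^ 4 / 40)"
        unfolding W_def cR[symmetric] using finK c0 c1 by (intro Wk_le_exp) auto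
      then have "p0 * W u v \<le> p0 * exp (real r ^ 4 / 40)" using p00 by (intro mult_left_mono)
      also have "\<dots> \<le> exp (real r ^ 4 / 8) / sqrt (real n)"
        using dd by (simp add: p0_def divide_right_mono)
      also have "\<dots> \<le> 1"
      proof -
        have "(exp (real r ^ 4 / 8))\<^sup>2 \<le> real n" using n_ge by (simp flip: exp_double)
        then have "exp (real r ^ 4 / 8) \<le> sqrt (real n)" by (rule real_le_rsqrt)
        then show ?thesis using npos by simp
      qed
      finally show ?thesis .
    qed
    show "(\<Sum>a\<in>{..<n} - {u, v}. (p0 * W u a) * (p0 * W v a)) \<le> \<zeta>"
      if "u < n" "v < n" "u \<noteq> v" "0 < W u v" for u v
    proof -
      have "ip K (z u) (z v) \<le> - c * real (card K) / 2"
        using that(4) by (auto simp: W_def Wk_def split: if_splits)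
      then have cgb: "codeg K c R n z u v \<le> 3 * real n * exp (- (real r / 2))"
        using cg[OF that(1-3)] unfolding tau by blast
      have "(\<Sum>a\<in>{..<n} - {u, v}. (p0 * W u a) * (p0 * W v a)) = p0\<^sup>2 * codeg K c R n z u v"
        by (simp add: codeg_def W_def sum_distrib_left power2_eq_square mult_ac)
      also have "\<dots> \<le> p0\<^sup>2 * (3 * real n * exp (- (real r / 2)))"
        using cgb by (intro mult_left_mono) auto
      also have "\<dots> = \<zeta>" using npos by (simp add: p0sq \<zeta>_def)
      finally show ?thesis .
    qed
    show "2 * \<mu>0 \<le> (\<Sum>p\<in>offd m. (p0 * W (x (fst p)) (x (snd p))) * (p0 * W (y (fst p)) (y (snd p))))"
      if mt: "matched n m x y" for x y
    proof -
      interpret MS: matched_sample K d c n "N\<^sup>2 + 2" z m x y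
        using cs mt by (simp add: matched_sample_def matched_sample_axioms_def)
      have N1: "1 \<le> real N" using S.N1 by (simp add: N_def)
      have N4: "real N ^ 2 \<le> real N ^ 4" "1 \<le> real N ^ 4" using N1 by (auto intro: power_increasing one_le_power)
      have sz: "(real (N\<^sup>2 + 2) + 1) * (real (card (low K d)))\<^sup>2 \<le> sqrt (real m * real n)"
      proof -
        have "(real (N\<^sup>2 + 2) + 1) * (real (card (low K d)))\<^sup>2 = real N ^ 4 + 3 * real N ^ 2"
          by (simp add: N_def power_numeral_reduce algebra_simps)
        also have "\<dots> \<le> 4 * real N ^ 4" using N4 by simp
        also have "\<dots> \<le> sqrt \<epsilon> * real n"
          using Nb a(2) mult_right_mono[OF a(2), of "real n"] by simp
        also have "\<dots> = sqrt (\<epsilon> * (real n)\<^sup>2)" by (simp add: real_sqrt_mult)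
        also have "\<dots> \<le> sqrt (real m * real n)"
          using m by (simp add: power2_eq_square mult_right_mono flip: mult.assoc)
        finally show ?thesis .
      qed
      have bn: "\<beta> * real n \<le> real n" using a(1) npos by simp
      have Dn: "real (card (low K d)) \<le> real n"
      proof -
        have "real N ^ 1 \<le> real N ^ 4" using N1 by (intro power_increasing) auto
        then have "real N \<le> real N ^ 4" by (simp only: power_one_right)
        then show ?thesis using Nb bn N4 unfolding N_def by linarith
      qed
      let ?e = "2 * sqrt (32 * exp (- 22 * real r ^ 3) * (32 * exp (2 * real r ^ 3))) + 32 * exp (- 22 * real r ^ 3) + (real N)\<^sup>2 / real n"
      have ee: "?e \<le> e"
      proof -
        have "32 * exp (- 22 * real r ^ 3) * (32 * exp (2 * real r ^ 3)) = (32 * exp (- 10 * real r ^ 3))\<^sup>2"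
          by (simp add: power_mult_distrib flip: exp_add exp_double)
        then have "sqrt (32 * exp (- 22 * real r ^ 3) * (32 * exp (2 * real r ^ 3))) = 32 * exp (- 10 * real r ^ 3)"
          by (simp only: real_sqrt_abs) simp
        moreover have "(real N)\<^sup>2 / real n \<le> \<beta>"
          using Nb N4 npos by (simp add: divide_le_eq)
        ultimately show ?thesis unfolding e_def by simp
      qed
      have low: "(real m)\<^sup>2 - (200 * c + ?e + 2 * exp (- c\<^sup>2 * real (card K) / 20) * (200 + ?e)) * (real n)\<^sup>2
         \<le> (\<Sum>p\<in>offd m. W (x (fst p)) (x (snd p)) * W (y (fst p)) (y (snd p)))"
        unfolding W_def N_def
        by (rule MS.sum_Wk_lower[OF sz Dn err nrm]) (use ipR in auto)
      have "(200 * c + ?e + 2 * exp (- c\<^sup>2 * real (card K) / 20) * (200 + ?e)) \<le> \<epsilon>\<^sup>2 / 2"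
      proof -
        have x1: "200 * c = 100 / real r ^ 2" by (simp add: c_def)
        have x2: "exp (- c\<^sup>2 * real (card K) / 20) = exp (- (real r ^ 3 / 10))" using c2k by simp
        have "2 * exp (- (real r ^ 3 / 10)) * (200 + ?e) \<le> 2 * exp (- (real r ^ 3 / 10)) * (200 + e)"
          using ee by (intro mult_left_mono) auto
        then show ?thesis unfolding x1 x2 using gg ee by linarith
      qed
      then have "(200 * c + ?e + 2 * exp (- c\<^sup>2 * real (card K) / 20) * (200 + ?e)) * (real n)\<^sup>2 \<le> \<epsilon>\<^sup>2 / 2 * (real n)\<^sup>2"
        by (intro mult_right_mono) auto
      also have "\<dots> \<le> (real m)\<^sup>2 / 2"
        using power_mono[OF m, of 2] eps by (simp add: power_mult_distrib)
      finally have "(real m)\<^sup>2 / 2 \<le> (\<Sum>p\<in>offd m. W (x (fst p)) (x (snd p)) * W (y (fst p)) (y (snd p)))"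
        using low by linarith
      then have "p0\<^sup>2 * ((real m)\<^sup>2 / 2) \<le> p0\<^sup>2 * (\<Sum>p\<in>offd m. W (x (fst p)) (x (snd p)) * W (y (fst p)) (y (snd p)))"
        by (intro mult_left_mono) auto
      then show ?thesis by (simp add: \<mu>0_def sum_distrib_left power2_eq_square mult_ac)
    qed
    show "288 * (real (r ^ 5) + 1) * \<zeta> \<le> 1" by (rule zD)
    \<comment> \<open>As \<zeta> \<le> 1/3, exceeding the cap r^5 has probability of order exp (-
      r^5) at most, far below 1 / n^2.\<close>
    show "4 * (real n)\<^sup>2 * (3 * \<zeta> ^ r ^ 5) \<le> 1"
    proof -
      have "\<zeta> \<le> exp (- 1)"
      proof -
        have "288 * \<zeta> \<le> 288 * (real (r ^ 5) + 1) * \<zeta>" using zeta0 by simp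
        then have "\<zeta> \<le> 1 / 3" using zD by linarith
        also have "1 / 3 \<le> 1 / exp (1::real)" by (intro divide_left_mono exp_le) auto
        finally show ?thesis by (simp add: exp_minus inverse_eq_divide)
      qed
      then have "\<zeta> ^ r ^ 5 \<le> exp (- 1) ^ r ^ 5" using zeta0 by (intro power_mono) auto
      also have "\<dots> = exp (- (real r ^ 5))" by (simp flip: exp_of_nat_mult)
      finally have "4 * (real n)\<^sup>2 * (3 * \<zeta> ^ r ^ 5) \<le> 4 * exp (real r ^ 4) * (3 * exp (- (real r ^ 5)))"
        using n2_le zeta0 by (intro mult_mono) auto
      also have "\<dots> = exp (ln 12 + real r ^ 4 - real r ^ 5)"
        using exp_ln_add_diff[of 12 "real r ^ 4" "real r ^ 5"] by simp
      also have "\<dots> \<le> 1" using ff by simp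
      finally show ?thesis .
    qed
    show "4 * real n ^ (2 * m) * exp (- (\<mu>0 / 8)) \<le> 1" by (rule fin) (use hh in auto)
    show "4 * real n ^ (2 * m) * exp (- (\<mu>0 / (16 * (real (r ^ 5) + 1)))) \<le> 1"
      by (rule fin) (use ii in \<open>auto simp: add_nonneg_pos\<close>)
  qed (use p00 zeta0 in auto)
  show thesis by (rule G.exists_graph) (use that in blast)
qed

subsection \<open>Odd clique minors in complements of triangle-free graphs\<close>

definition cograph :: "nat \<Rightarrow> (nat \<Rightarrow> nat \<Rightarrow> bool) \<Rightarrow> nat set set" where
  "cograph n H = {{u, v} | u v. u < n \<and> v < n \<and> u \<noteq> v \<and> \<not> H u v}"

locale triangle_free_anticliques =
  fixes n m :: nat and H :: "nat \<Rightarrow> nat \<Rightarrow> bool"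
  assumes sym: "H u v \<Longrightarrow> H v u"
    and bounded: "H u v \<Longrightarrow> u < n \<and> v < n \<and> u \<noteq> v"
    and triangle_free: "H u v \<Longrightarrow> H v w \<Longrightarrow> H u w \<Longrightarrow> False"
    and cross: "matched n m x y \<Longrightarrow> \<exists>i<m. \<exists>j<m. i \<noteq> j \<and> H (x i) (x j) \<and> H (y i) (y j)"
begin

lemma simple_cograph: "simple_graph {..<n} (cograph n H)"
  unfolding simple_graph_def
proof (intro conjI ballI)
  fix e assume "e \<in> cograph n H"
  then obtain u v where "e = {u, v}" "u < n" "v < n" "u \<noteq> v" by (auto simp: cograph_def)
  then show "\<exists>x y. x \<in> {..<n} \<and> y \<in> {..<n} \<and> x \<noteq> y \<and> e = {x, y}"
    by (intro exI[of _ u] exI[of _ v]) simp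
qed simp

lemma cograph_edge: "{u, v} \<in> cograph n H \<Longrightarrow> u < n \<and> v < n \<and> u \<noteq> v \<and> \<not> H u v"
proof -
  assume "{u, v} \<in> cograph n H"
  then obtain a b where "{u, v} = {a, b}" "a < n" "b < n" "a \<noteq> b" "\<not> H a b" by (auto simp: cograph_def)
  then show ?thesis using sym[of u v] by (auto simp: doubleton_eq_iff)
qed

lemma chromatic_cograph: "n \<le> 2 * chromatic_number {..<n} (cograph n H)"
proof -
  \<comment> \<open>The identity colouring shows that the minimum in \<open>chromatic_number\<close>
    is attained.\<close>
  have "proper_colouring {..<n} (cograph n H) n id"
    by (auto simp: proper_colouring_def dest: cograph_edge)
  then have "\<exists>k f. proper_colouring {..<n} (cograph n H) k f" by blast
  from LeastI_ex[OF this] obtain f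
    where f: "proper_colouring {..<n} (cograph n H) (chromatic_number {..<n} (cograph n H)) f"
    by (auto simp: chromatic_number_def)
  let ?k = "chromatic_number {..<n} (cograph n H)"
  have same: "H u v" if "u < n" "v < n" "u \<noteq> v" "f u = f v" for u v
  proof (rule ccontr)
    assume "\<not> H u v"
    then have "{u, v} \<in> cograph n H" using that by (auto simp: cograph_def)
    then show False using f that(4) unfolding proper_colouring_def by blast
  qed
  have "card {v \<in> {..<n}. f v = i} \<le> 2" for i
  proof (rule ccontr)
    assume "\<not> card {v \<in> {..<n}. f v = i} \<le> 2"
    then have "3 \<le> card {v \<in> {..<n}. f v = i}" by simp
    then obtain T where T: "T \<subseteq> {v \<in> {..<n}. f v = i}" "card T = 3"
      by (metis obtain_subset_with_card_n)
    then obtain u v w where "T = {u, v, w}" "u \<noteq> v" "v \<noteq> w" "u \<noteq> w" by (auto simp: card_3_iff)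
    with T(1) same triangle_free[of u v w] show False by auto
  qed
  then have "(\<Sum>i<?k. card {v \<in> {..<n}. f v = i}) \<le> (\<Sum>i<?k. 2)" by (intro sum_mono)
  moreover have "(\<Sum>i<?k. card {v \<in> {..<n}. f v = i}) = card (\<Union>i<?k. {v \<in> {..<n}. f v = i})"
    by (subst card_UN_disjoint) auto
  moreover have "(\<Union>i<?k. {v \<in> {..<n}. f v = i}) = {..<n}"
    using f by (auto simp: proper_colouring_def)
  ultimately show ?thesis by simp
qed

lemma tree_doubleton:
  assumes "is_tree T F" "card T = 2"
  obtains x y where "x \<noteq> y" "T = {x, y}" "{x, y} \<in> F"
proof -
  obtain x y where xy: "T = {x, y}" "x \<noteq> y" using assms(2) by (auto simp: card_2_iff)
  have "card F = 1" using assms by (simp add: is_tree_def)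
  then obtain e where e: "F = {e}" by (auto simp: card_1_singleton_iff)
  then obtain a b where "a \<in> T" "b \<in> T" "a \<noteq> b" "e = {a, b}"
    using assms(1) by (auto simp: is_tree_def simple_graph_def)
  then have "e = {x, y}" using xy by auto
  with e have in_F: "{x, y} \<in> F" by simp
  show thesis by (rule that[OF xy(2,1) in_F])
qed

lemma no_odd_clique_minor:
  assumes "n + 9 * m < 3 * t"
  shows "\<not> has_odd_clique_minor {..<n} (cograph n H) t"
proof
  assume "has_odd_clique_minor {..<n} (cograph n H) t"
  then obtain Ts Fs and c :: "nat \<Rightarrow> nat \<Rightarrow> bool" where
    trees: "\<forall>i<t. Ts i \<subseteq> {..<n} \<and> Fs i \<subseteq> cograph n H \<and> is_tree (Ts i) (Fs i)"
    and disj': "\<forall>i<t. \<forall>j<t. i \<noteq> j \<longrightarrow> Ts i \<inter> Ts j = {}"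
    and col': "\<forall>i<t. \<forall>x y. {x, y} \<in> Fs i \<longrightarrow> c i x \<noteq> c i y"
    and touch': "\<forall>i<t. \<forall>j<t. i \<noteq> j \<longrightarrow>
      (\<exists>x\<in>Ts i. \<exists>y\<in>Ts j. {x, y} \<in> cograph n H \<and> c i x = c j y)"
    unfolding has_odd_clique_minor_def by (elim exE conjE)
  have tree: "Ts i \<subseteq> {..<n} \<and> is_tree (Ts i) (Fs i)" if "i < t" for i
    using trees that by simp
  have disj: "Ts i \<inter> Ts j = {}" if "i < t" "j < t" "i \<noteq> j" for i j
    using disj' that by simp
  have col: "c i x \<noteq> c i y" if "i < t" "{x, y} \<in> Fs i" for i x y
    using col' that by simp
  have touch: "\<exists>x\<in>Ts i. \<exists>y\<in>Ts j. {x, y} \<in> cograph n H \<and> c i x = c j y" if "i < t" "j < t" "i \<noteq> j" for i j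
    using touch' that by blast
  have fin: "finite (Ts i)" if "i < t" for i using tree[OF that] finite_subset by blast
  define S where "S k = {i \<in> {..<t}. card (Ts i) = k}" for k
  have S1: "card (S 1) < 2 * m"
  proof (rule ccontr)
    assume "\<not> card (S 1) < 2 * m"
    then have "2 * m \<le> card (S 1)" by simp
    then obtain S' where S': "S' \<subseteq> S 1" "card S' = 2 * m" "finite S'"
      by (rule obtain_subset_with_card_n)
    obtain g where g: "bij_betw g {..<2 * m} S'"
      using finite_same_card_bij[of "{..<2 * m}" S'] S' by auto
    have gS: "g i \<in> S 1" if "i < 2 * m" for i
      using bij_betwE[OF g] S'(1) that by blast
    define p where "p i = the_elem (Ts (g i))" for i
    have p: "Ts (g i) = {p i}" "g i < t" if "i < 2 * m" for i
    proof -
      have "card (Ts (g i)) = Suc 0" and gi: "g i < t" using gS[OF that] by (simp_all add: S_def)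
      then obtain a where "Ts (g i) = {a}" by (auto simp: card_1_singleton_iff)
      then show "Ts (g i) = {p i}" "g i < t" using gi by (simp_all add: p_def)
    qed
    have nH: "p i \<noteq> p j \<and> \<not> H (p i) (p j)" if "i < 2 * m" "j < 2 * m" "i \<noteq> j" for i j
    proof -
      have "g i \<noteq> g j" using inj_onD[OF bij_betw_imp_inj_on[OF g], of i j] that by auto
      then show ?thesis using touch[of "g i" "g j"] p[OF that(1)] p[OF that(2)] cograph_edge by auto
    qed
    have pn: "p i < n" if "i < 2 * m" for i using tree[of "g i"] p[OF that] by auto
    \<comment> \<open>Singleton trees are pairwise adjacent in the complement whatever their
      colours. With 2m of them split into two families, the first edge from \<open>cross\<close> is
      already a contradiction.\<close>
    have "matched n m p (\<lambda>i. p (m + i))"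
      unfolding matched_def
    proof (intro conjI)
      show "inj_on p {..<m}"
      proof (rule inj_onI)
        fix i j assume "i \<in> {..<m}" "j \<in> {..<m}" "p i = p j"
        then show "i = j" using nH[of i j] by auto
      qed
      show "inj_on (\<lambda>i. p (m + i)) {..<m}"
      proof (rule inj_onI)
        fix i j assume "i \<in> {..<m}" "j \<in> {..<m}" "p (m + i) = p (m + j)"
        then show "i = j" using nH[of "m + i" "m + j"] by auto
      qed
      show "p ` {..<m} \<inter> (\<lambda>i. p (m + i)) ` {..<m} = {}"
      proof (rule ccontr)
        assume "p ` {..<m} \<inter> (\<lambda>i. p (m + i)) ` {..<m} \<noteq> {}"
        then obtain i j where "i < m" "j < m" "p i = p (m + j)" by blast
        then show False using nH[of i "m + j"] by simp
      qed
    qed (use pn in auto)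
    then obtain i j where "i < m" "j < m" "i \<noteq> j" "H (p i) (p j)" using cross by blast
    with nH[of i j] show False by simp
  qed
  have S2: "card (S 2) < m"
  proof (rule ccontr)
    assume "\<not> card (S 2) < m"
    then have "m \<le> card (S 2)" by simp
    then obtain S' where S': "S' \<subseteq> S 2" "card S' = m" "finite S'"
      by (rule obtain_subset_with_card_n)
    obtain g where g: "bij_betw g {..<m} S'"
      using finite_same_card_bij[of "{..<m}" S'] S' by auto
    have gS: "g i \<in> S 2" if "i < m" for i
      using bij_betwE[OF g] S'(1) that by blast
    \<comment> \<open>A two-vertex tree is an edge, so its ends have different colours and can be
      ordered with colour \<open>True\<close> first.\<close>
    have ex: "\<exists>q. Ts (g i) = {fst q, snd q} \<and> c (g i) (fst q) \<and> \<not> c (g i) (snd q)" if "i < m" for i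
    proof -
      have gi: "g i < t" "card (Ts (g i)) = 2" using gS[OF that] by (auto simp: S_def)
      then obtain x y where "Ts (g i) = {x, y}" "{x, y} \<in> Fs (g i)"
        using tree_doubleton[OF conjunct2[OF tree[OF gi(1)]] gi(2)] by blast
      then have "c (g i) x \<noteq> c (g i) y" using col[OF gi(1)] by blast
      moreover have "Ts (g i) = {y, x}" using \<open>Ts (g i) = {x, y}\<close> by auto
      ultimately show ?thesis
        using \<open>Ts (g i) = {x, y}\<close> exI[of _ "(x, y)"] exI[of _ "(y, x)"] by (cases "c (g i) x") auto
    qed
    define q where "q i = (SOME q. Ts (g i) = {fst q, snd q} \<and> c (g i) (fst q) \<and> \<not> c (g i) (snd q))" for i
    define x y where "x i = fst (q i)" and "y i = snd (q i)" for i
    have xy: "Ts (g i) = {x i, y i} \<and> c (g i) (x i) \<and> \<not> c (g i) (y i)" if "i < m" for i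
      unfolding x_def y_def q_def by (rule someI_ex[OF ex[OF that]])
    have gt: "g i < t" if "i < m" for i using gS[OF that] by (simp add: S_def)
    have gne: "g i \<noteq> g j" if "i < m" "j < m" "i \<noteq> j" for i j
      using inj_onD[OF bij_betw_imp_inj_on[OF g], of i j] that by auto
    have dis: "{x i, y i} \<inter> {x j, y j} = {}" if "i < m" "j < m" "i \<noteq> j" for i j
      using disj[OF gt[OF that(1)] gt[OF that(2)] gne[OF that]] xy that by simp
    have "x i \<noteq> y j" if "i < m" "j < m" for i j
      using dis[OF that] xy[OF that(1)] by (cases "i = j") auto
    moreover have "x i < n \<and> y i < n" if "i < m" for i using tree[OF gt[OF that]] xy[OF that] by auto
    ultimately have "matched n m x y"
      unfolding matched_def
    proof (intro conjI)
      show "inj_on x {..<m}"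
      proof (rule inj_onI)
        fix i j assume "i \<in> {..<m}" "j \<in> {..<m}" "x i = x j"
        then show "i = j" using dis[of i j] by auto
      qed
      show "inj_on y {..<m}"
      proof (rule inj_onI)
        fix i j assume "i \<in> {..<m}" "j \<in> {..<m}" "y i = y j"
        then show "i = j" using dis[of i j] by auto
      qed
    qed auto
    then obtain i j where ij: "i < m" "j < m" "i \<noteq> j" and H: "H (x i) (x j)" "H (y i) (y j)"
      using cross by blast
    \<comment> \<open>A monochromatic edge between the two trees could only join \<open>x i\<close>
      to \<open>x j\<close> or \<open>y i\<close> to \<open>y j\<close>, and both are edges of
      \<open>H\<close>.\<close>
    from touch[OF gt[OF ij(1)] gt[OF ij(2)] gne[OF ij]] xy[OF ij(1)] xy[OF ij(2)] H cograph_edge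
    show False by auto
  qed
  have "t = card (S 1) + card (S 2) + card {i \<in> {..<t}. 3 \<le> card (Ts i)}"
  proof -
    have "card (Ts i) = 1 \<or> card (Ts i) = 2 \<or> 3 \<le> card (Ts i)" if "i < t" for i
    proof -
      have "Ts i \<noteq> {}" using tree[OF that] by (simp add: is_tree_def connected_sub_def)
      then have "card (Ts i) \<noteq> 0" using fin[OF that] by simp
      then show ?thesis by linarith
    qed
    then have "{..<t} = S 1 \<union> S 2 \<union> {i \<in> {..<t}. 3 \<le> card (Ts i)}"
      unfolding S_def by blast
    moreover have "card (S 1 \<union> S 2 \<union> {i \<in> {..<t}. 3 \<le> card (Ts i)})
      = card (S 1) + card (S 2) + card {i \<in> {..<t}. 3 \<le> card (Ts i)}"
    proof -
      have "S 1 \<inter> S 2 = {}" "(S 1 \<union> S 2) \<inter> {i \<in> {..<t}. 3 \<le> card (Ts i)} = {}" "finite (S 1)" "finite (S 2)"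
        by (auto simp: S_def)
      then show ?thesis by (simp add: card_Un_disjoint)
    qed
    ultimately have "card {..<t} = card (S 1) + card (S 2) + card {i \<in> {..<t}. 3 \<le> card (Ts i)}" by (simp only:)
    then show ?thesis by simp
  qed
  moreover have "3 * card {i \<in> {..<t}. 3 \<le> card (Ts i)} \<le> n"
  proof -
    have "3 * card {i \<in> {..<t}. 3 \<le> card (Ts i)} = (\<Sum>i\<in>{i \<in> {..<t}. 3 \<le> card (Ts i)}. 3)" by simp
    also have "\<dots> \<le> (\<Sum>i\<in>{i \<in> {..<t}. 3 \<le> card (Ts i)}. card (Ts i))" by (intro sum_mono) auto
    also have "\<dots> = card (\<Union>i\<in>{i \<in> {..<t}. 3 \<le> card (Ts i)}. Ts i)"
      using fin disj by (subst card_UN_disjoint) auto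
    also have "\<dots> \<le> card {..<n}" using tree by (intro card_mono) auto
    finally show ?thesis by simp
  qed
  ultimately show False using S1 S2 assms by linarith
qed

end

section \<open>Asymptotics, and the choice of n and m in terms of t\<close>

lemma triangle_free_anticliques_eventually:
  fixes \<epsilon> :: real
  assumes eps: "0 < \<epsilon>"
  shows "\<forall>\<^sub>F n in sequentially. \<forall>m. \<epsilon> * real n \<le> real m \<longrightarrow> (\<exists>H. triangle_free_anticliques n m H)"
proof -
  define \<beta> where "\<beta> r = exp (ln 648 + 80 * real r ^ 3 * ln (8 * real r ^ 7) - real r ^ 4 / 4)" for r :: nat
  define e where "e r = 64 * exp (- 10 * real r ^ 3) + 32 * exp (- 22 * real r ^ 3) + \<beta> r" for r :: nat
  have "\<beta> \<longlonglongrightarrow> 0" unfolding \<beta>_def by real_asymp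
  then have a: "\<forall>\<^sub>F r in sequentially. \<beta> r < min 1 (2 * sqrt \<epsilon>)"
    using eps by (intro order_tendstoD) auto
  have "(\<lambda>r. 100 / real r ^ 2 + e r + 2 * exp (- (real r ^ 3 / 10)) * (200 + e r)) \<longlonglongrightarrow> 0"
    unfolding e_def \<beta>_def by real_asymp
  then have gg: "\<forall>\<^sub>F r in sequentially. 100 / real r ^ 2 + e r + 2 * exp (- (real r ^ 3 / 10)) * (200 + e r) < \<epsilon>\<^sup>2 / 2"
    using eps by (intro order_tendstoD) auto
  have b: "\<forall>\<^sub>F r in sequentially. ln 8 + real r ^ 4 \<le> 3 * real r ^ 5 / 40000" by real_asymp
  have cc: "\<forall>\<^sub>F r in sequentially. ln 8 + real r ^ 4 \<le> exp (real r ^ 4 / 5 - real r / 2)" by real_asymp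
  have dd: "\<forall>\<^sub>F r in sequentially. real r ^ 6 * exp (real r ^ 4 / 40) \<le> exp (real r ^ 4 / 8)" by real_asymp
  have ee: "\<forall>\<^sub>F r in sequentially. 864 * (real r ^ 5 + 1) * real r ^ 12 * exp (- (real r / 2)) \<le> 1" by real_asymp
  have ff: "\<forall>\<^sub>F r in sequentially. ln 12 + real r ^ 4 \<le> real r ^ 5" by real_asymp
  have hh: "\<forall>\<^sub>F r in sequentially. ln 4 + real r ^ 4 \<le> real r ^ 12 * \<epsilon> / 32" using eps by real_asymp
  have ii: "\<forall>\<^sub>F r in sequentially. ln 4 + real r ^ 4 \<le> real r ^ 12 * \<epsilon> / (64 * (real r ^ 5 + 1))"
    using eps by real_asymp
  have "\<forall>\<^sub>F r in sequentially. 4 \<le> r \<and> (\<forall>n m. real r ^ 4 / 4 \<le> ln (real n) \<longrightarrow> ln (real n) \<le> real r ^ 4 / 2 \<longrightarrow>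
      3 \<le> n \<longrightarrow> \<epsilon> * real n \<le> real m \<longrightarrow> (\<exists>H. triangle_free_anticliques n m H))"
    using a gg b cc dd ee ff hh ii eventually_ge_at_top[of 4]
  proof eventually_elim
    case (elim r)
    show ?case
    proof (intro conjI allI impI)
      fix n m assume n: "real r ^ 4 / 4 \<le> ln (real n)" "ln (real n) \<le> real r ^ 4 / 2" "3 \<le> n"
        and m: "\<epsilon> * real n \<le> real m"
      have h: "4 \<le> r" "\<beta> r \<le> 1" "\<beta> r \<le> 2 * sqrt \<epsilon>"
        "100 / real r ^ 2 + e r + 2 * exp (- (real r ^ 3 / 10)) * (200 + e r) \<le> \<epsilon>\<^sup>2 / 2"
        using elim(1,2,10) by auto
      note ex = exists_anticlique_graph[OF h(1) n eps m h(2,3)[unfolded \<beta>_def] elim(3-7) h(4)[unfolded e_def \<beta>_def] elim(8,9)]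
      obtain H where H: "\<And>u v. H u v \<Longrightarrow> H v u" "\<And>u v. H u v \<Longrightarrow> u < n \<and> v < n \<and> u \<noteq> v"
        "\<And>u v w. H u v \<Longrightarrow> H v w \<Longrightarrow> H u w \<Longrightarrow> False"
        "\<And>x y. matched n m x y \<Longrightarrow> \<exists>i<m. \<exists>j<m. i \<noteq> j \<and> H (x i) (x j) \<and> H (y i) (y j)"
        by (rule ex) (use that in blast)
      from H have "triangle_free_anticliques n m H" by (rule triangle_free_anticliques.intro)
      then show "\<exists>H. triangle_free_anticliques n m H" by blast
    qed (use elim in simp)
  qed
  then obtain r1 where r1: "\<And>r n m. r1 \<le> r \<Longrightarrow> real r ^ 4 / 4 \<le> ln (real n) \<Longrightarrow> ln (real n) \<le> real r ^ 4 / 2 \<Longrightarrow>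
      3 \<le> n \<Longrightarrow> \<epsilon> * real n \<le> real m \<Longrightarrow> \<exists>H. triangle_free_anticliques n m H"
    unfolding eventually_sequentially by blast
  have "\<forall>\<^sub>F x::real in at_top. (x + 1) ^ 4 / 4 \<le> x ^ 4 / 2 \<and> real r1 \<le> x"
    by (intro eventually_conj eventually_ge_at_top) real_asymp
  moreover have "filterlim (\<lambda>n. (2 * ln (real n)) powr (1/4)) at_top sequentially" by real_asymp
  ultimately have "\<forall>\<^sub>F n in sequentially. ((2 * ln (real n)) powr (1/4) + 1) ^ 4 / 4 \<le> ((2 * ln (real n)) powr (1/4)) ^ 4 / 2 \<and>
      real r1 \<le> (2 * ln (real n)) powr (1/4)"
    by (rule eventually_compose_filterlim)
  then show ?thesis using eventually_ge_at_top[of 3]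
  proof eventually_elim
    case (elim n)
    \<comment> \<open>Every large n is served by some r: rounding up (2 ln n)^(1/4) gives ln n \<le>
      r^4 / 2 at once, and r^4 / 4 \<le> (x + 1)^4 / 4 \<le> x^4 / 2 = ln n for large n.\<close>
    define x where "x = (2 * ln (real n)) powr (1/4)"
    define r where "r = nat \<lceil>x\<rceil>"
    have "0 < ln (real n)" using elim(2) by simp
    then have x4: "x ^ 4 = 2 * ln (real n)" unfolding x_def by (subst powr_power) auto
    have x0: "0 \<le> x" by (simp add: x_def)
    then have x_r: "x \<le> real r" "real r \<le> x + 1" unfolding r_def by linarith+
    have "x ^ 4 \<le> real r ^ 4" using x_r x0 by (intro power_mono)
    moreover have "real r ^ 4 \<le> (x + 1) ^ 4" using x_r by (intro power_mono) auto
    moreover have "(x + 1) ^ 4 / 4 \<le> x ^ 4 / 2" "real r1 \<le> x" using elim(1) by (simp_all add: x_def)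
    ultimately have "real r ^ 4 / 4 \<le> ln (real n)" "ln (real n) \<le> real r ^ 4 / 2" "r1 \<le> r"
      using x4 x_r by linarith+
    then show ?case using r1[of r n] elim(2) by blast
  qed
qed

theorem theorem1p3:
  shows "(\<forall>\<delta>::real. \<delta> > 0 \<longrightarrow>
           (\<exists>t0::nat. \<forall>t\<ge>t0. \<exists>(V :: nat set) E.
              simple_graph V E \<and>
              real (chromatic_number V E) \<ge> (3/2 - \<delta>) * real t \<and>
              \<not> has_odd_clique_minor V E t))
       \<and> (\<exists>t0::nat. \<forall>t\<ge>t0. \<exists>(V :: nat set) E.
              simple_graph V E \<and> chromatic_number V E \<ge> t \<and>
              \<not> has_odd_clique_minor V E t)"
proof -
  have main: "\<exists>t0::nat. \<forall>t\<ge>t0. \<exists>(V :: nat set) E. simple_graph V E \<and>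
      real (chromatic_number V E) \<ge> (3/2 - \<delta>) * real t \<and> \<not> has_odd_clique_minor V E t"
    if "\<delta> > 0" for \<delta> :: real
  proof -
    \<comment> \<open>With n near (3 - 30 \<epsilon>) t and m near \<epsilon> n, the sum n + 9 m is
      at most (3 - 30 \<epsilon>) t + 27 \<epsilon> t + 9, below 3 t once \<epsilon> t \<ge> 4. Half
      of n falls short of 3 t / 2 by only 15 \<epsilon> t plus rounding, within \<delta> t.\<close>
    define \<epsilon> where "\<epsilon> = min \<delta> 1 / 60"
    have eps: "0 < \<epsilon>" "\<epsilon> \<le> 1/60" "60 * \<epsilon> \<le> \<delta>" using that by (auto simp: \<epsilon>_def)
    define n where "n t = nat \<lfloor>(3 - 30 * \<epsilon>) * real t\<rfloor>" for t :: nat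
    define m where "m t = nat \<lceil>\<epsilon> * real (n t)\<rceil>" for t
    have n_bounds: "real (n t) \<le> (3 - 30 * \<epsilon>) * real t" "(3 - 30 * \<epsilon>) * real t - 1 \<le> real (n t)" for t
    proof -
      have "0 \<le> (3 - 30 * \<epsilon>) * real t" using eps by simp
      then show "real (n t) \<le> (3 - 30 * \<epsilon>) * real t" "(3 - 30 * \<epsilon>) * real t - 1 \<le> real (n t)"
        unfolding n_def by linarith+
    qed
    have "filterlim n at_top sequentially"
    proof (rule filterlim_at_top_mono[OF filterlim_ident])
      have "(3 - 30 * \<epsilon>) * real t - 1 \<ge> real t" if "1 \<le> t" for t
      proof -
        have "5/2 * real t \<le> (3 - 30 * \<epsilon>) * real t" using eps by (intro mult_right_mono) auto
        moreover have "1 \<le> real t" using that by simp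
        ultimately show ?thesis by linarith
      qed
      then have "t \<le> n t" if "1 \<le> t" for t using n_bounds(2)[of t] that by fastforce
      then show "\<forall>\<^sub>F t in sequentially. t \<le> n t" by (auto simp: eventually_sequentially)
    qed
    from eventually_compose_filterlim[OF triangle_free_anticliques_eventually[OF eps(1)] this]
    have "\<forall>\<^sub>F t in sequentially. \<forall>m. \<epsilon> * real (n t) \<le> real m \<longrightarrow> (\<exists>H. triangle_free_anticliques (n t) m H)" .
    moreover have "\<forall>\<^sub>F t in sequentially. 4 / \<epsilon> \<le> real t" by real_asymp
    ultimately have "\<forall>\<^sub>F t in sequentially. \<exists>(V :: nat set) E. simple_graph V E \<and>
      real (chromatic_number V E) \<ge> (3/2 - \<delta>) * real t \<and> \<not> has_odd_clique_minor V E t"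
    proof eventually_elim
      case (elim t)
      have et: "4 \<le> \<epsilon> * real t" using elim(2) eps by (simp add: field_simps)
      have "\<epsilon> * real (n t) \<le> real (m t)" unfolding m_def by linarith
      then obtain H where "triangle_free_anticliques (n t) (m t) H" using elim(1) by blast
      then interpret triangle_free_anticliques "n t" "m t" H .
      have "0 \<le> \<epsilon> * real (n t)" using eps by simp
      then have "real (m t) \<le> \<epsilon> * real (n t) + 1" unfolding m_def by linarith
      moreover have "\<epsilon> * real (n t) \<le> \<epsilon> * (3 * real t)"
      proof (intro mult_left_mono)
        have "0 \<le> \<epsilon> * real t" using et by simp
        then show "real (n t) \<le> 3 * real t" using n_bounds(1)[of t] by (simp add: algebra_simps)
      qed (use eps in simp)
      ultimately have "real (n t) + 9 * real (m t) \<le> 3 * real t - 3 * (\<epsilon> * real t) + 9"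
        using n_bounds(1)[of t] by (simp add: algebra_simps)
      then have "n t + 9 * m t < 3 * t" using et by linarith
      moreover have "(3/2 - \<delta>) * real t \<le> real (chromatic_number {..<n t} (cograph (n t) H))"
      proof -
        have "60 * \<epsilon> * real t \<le> \<delta> * real t" using eps by (intro mult_right_mono) auto
        moreover have "real (n t) \<le> 2 * real (chromatic_number {..<n t} (cograph (n t) H))"
          using chromatic_cograph by linarith
        ultimately show ?thesis using n_bounds(2)[of t] et by (simp add: algebra_simps)
      qed
      ultimately show ?case using simple_cograph no_odd_clique_minor by blast
    qed
    then show ?thesis by (simp add: eventually_sequentially)
  qed
  moreover have "\<exists>t0::nat. \<forall>t\<ge>t0. \<exists>(V :: nat set) E.
      simple_graph V E \<and> chromatic_number V E \<ge> t \<and> \<not> has_odd_clique_minor V E t"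
  proof -
    \<comment> \<open>The choice \<delta> = 1/4 leaves the factor 5/4, comfortably above 1.\<close>
    have le: "t \<le> k" if "(3/2 - 1/4) * real t \<le> real k" for t k :: nat
    proof -
      have "real t \<le> real k" using that by (simp add: algebra_simps)
      then show ?thesis by simp
    qed
    have "(0::real) < 1/4" by simp
    from main[OF this] obtain t0 where "\<forall>t\<ge>t0. \<exists>(V :: nat set) E. simple_graph V E \<and>
      real (chromatic_number V E) \<ge> (3/2 - 1/4) * real t \<and> \<not> has_odd_clique_minor V E t" by blast
    then show ?thesis using le by blast
  qed
  ultimately show ?thesis by blast
qed

end
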